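(* Let $(X,\sigma_X)$ and $(Y,\sigma_Y)$ be one-sided subshifts and let $\pi:(X,\sigma_X)\to(Y,\sigma_Y)$ be a (one-block) factor map. Define $F:Y\to\mathbb{R}$ by $F(y)=\limsup_{n\to\infty}\frac1n\log|D_n(y)|$. Then $F$ is a bounded Borel measurable function, and $-F\circ\pi$ is a compensation function for $(\sigma_X,\sigma_Y,\pi)$, i.e. for all $\phi\in C(Y)$, $$\sup_{\mu\in M(X,\sigma_X)}\Big\{h_\mu(\sigma_X)+\int(-F\circ\pi+\phi\circ\pi)\,d\mu\Big\}=\sup_{m\in M(Y,\sigma_Y)}\Big\{h_m(\sigma_Y)+\int\phi\,dm\Big\}.$$ Moreover, for every $\phi\in C(Y)$, the set $M_{-F\circ\pi+\phi\circ\pi}(X,\sigma_X)$ of equilibrium states for $-F\circ\pi+\phi\circ\pi$ is nonempty, and $\mu\in M(X,\sigma_X)$ is an equilibrium state for $-F\circ\pi+\phi\circ\pi$ if and only if (i) $\pi\mu$ is an equilibrium state for $\phi$ and (ii) $\mu$ is a measure of maximal relative entropy over $\pi\mu$.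
   Context: A (one-sided) subshift $(X,\sigma_X)$ is a closed shift-invariant subset $X\subseteq\{1,\dots,k\}^{\mathbb N}$ with the shift $\sigma_X$. A factor map $\pi:(X,\sigma_X)\to(Y,\sigma_Y)$ is a continuous surjection with $\pi\circ\sigma_X=\sigma_Y\circ\pi$; it is one-block if the $i$-th coordinate of $\pi(x)$ depends only on $x_i$. $M(X,\sigma_X)$ is the set of $\sigma_X$-invariant Borel probability measures on $X$, $h_\mu$ is measure-theoretic entropy, and $\pi\mu$ is the push-forward of $\mu$ by $\pi$. For $y\in Y$ and $n\in\mathbb N$, $D_n(y)$ is a set consisting of one point from each nonempty set $\pi^{-1}(y)\cap[i_1\cdots i_n]$, where $[i_1\cdots i_n]$ ranges over cylinders of length $n$ in $X$; $|D_n(y)|$ is its cardinality. (The function $F$ is the relative pressure function $P(\sigma_X,\pi,0)$.) For a bounded Borel measurable $f:X\to\mathbb R$, an equilibrium state for $f$ is a $\mu\in M(X,\sigma_X)$ attaining $\sup_{\nu\in M(X,\sigma_X)}\{h_\nu(\sigma_X)+\int f\,d\nu\}$; $M_f(X,\sigma_X)$ is the set of these (same on $Y$). A measure $\mu\in M(X,\sigma_X)$ is a measure of maximal relative entropy over $m\in M(Y,\sigma_Y)$ if $\pi\mu=m$ and $h_\mu(\sigma_X)=\sup\{h_{\bar\mu}(\sigma_X):\bar\mu\in M(X,\sigma_X),\ \pi\bar\mu=m\}$. *)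

theory Defs
  imports "HOL-Probability.Probability"
begin

section \<open>One-sided subshifts and factor maps\<close>

text \<open>
  Points are sequences \<open>nat \<Rightarrow> nat\<close>, indexed from \<open>0\<close>, with the product topology of the discrete
  topology on \<open>nat\<close>. The full shift over \<open>{1..k}\<close> is closed in this space, so a subset of
  it is closed in the full shift iff it is closed in \<open>nat \<Rightarrow> nat\<close>.
\<close>

definition shift :: "(nat \<Rightarrow> nat) \<Rightarrow> (nat \<Rightarrow> nat)" where
  "shift x = (\<lambda>i. x (Suc i))"

text \<open>
  Shift-invariance is forward invariance; \<open>shift ` X = X\<close> is not required. Subshifts are nonempty.
\<close>

definition subshift :: "nat \<Rightarrow> (nat \<Rightarrow> nat) set \<Rightarrow> bool" where
  "subshift k X \<longleftrightarrow>
     X \<noteq> {} \<and> (\<forall>x\<in>X. \<forall>i. x i \<in> {1..k}) \<and> closed X \<and> shift ` X \<subseteq> X"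

definition factor_map ::
    "(nat \<Rightarrow> nat) set \<Rightarrow> (nat \<Rightarrow> nat) set \<Rightarrow> ((nat \<Rightarrow> nat) \<Rightarrow> (nat \<Rightarrow> nat)) \<Rightarrow> bool" where
  "factor_map X Y \<pi> \<longleftrightarrow>
     continuous_on X \<pi> \<and> \<pi> ` X = Y \<and> (\<forall>x\<in>X. \<pi> (shift x) = shift (\<pi> x))"

definition one_block :: "(nat \<Rightarrow> nat) set \<Rightarrow> ((nat \<Rightarrow> nat) \<Rightarrow> (nat \<Rightarrow> nat)) \<Rightarrow> bool" where
  "one_block X \<pi> \<longleftrightarrow> (\<forall>i. \<exists>p. \<forall>x\<in>X. \<pi> x i = p (x i))"

definition cylinder :: "(nat \<Rightarrow> nat) set \<Rightarrow> nat list \<Rightarrow> (nat \<Rightarrow> nat) set" where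
  "cylinder X w = {x \<in> X. \<forall>i<length w. x i = w ! i}"

section \<open>Fibre growth\<close>

text \<open>
  \<open>fiber_selection X \<pi> n y D\<close>: the set \<open>D\<close> consists of exactly one point from each nonempty set
  \<open>\<pi>\<^sup>-\<^sup>1(y) \<inter> [i\<^sub>1 \<dots> i\<^sub>n]\<close>, and of no other points.
\<close>

definition fiber_selection ::
    "(nat \<Rightarrow> nat) set \<Rightarrow> ((nat \<Rightarrow> nat) \<Rightarrow> (nat \<Rightarrow> nat)) \<Rightarrow> nat \<Rightarrow> (nat \<Rightarrow> nat) \<Rightarrow> (nat \<Rightarrow> nat) set
      \<Rightarrow> bool" where
  "fiber_selection X \<pi> n y D \<longleftrightarrow>
     D \<subseteq> {x \<in> X. \<pi> x = y} \<and>
     (\<forall>w. length w = n \<and> {x \<in> X. \<pi> x = y} \<inter> cylinder X w \<noteq> {} \<longrightarrow>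
          (\<exists>!x. x \<in> D \<inter> cylinder X w))"

text \<open>
  The upper limit is taken in the extended reals; \<open>fiber_growth\<close> is its real value, and is
  meaningful at \<open>y\<close> only if the upper limit is finite there.
\<close>

definition fiber_growth_ereal :: "(nat \<Rightarrow> (nat \<Rightarrow> nat) \<Rightarrow> (nat \<Rightarrow> nat) set) \<Rightarrow> (nat \<Rightarrow> nat) \<Rightarrow> ereal" where
  "fiber_growth_ereal D y = limsup (\<lambda>n. ereal (1 / real n * ln (real (card (D n y)))))"

definition fiber_growth :: "(nat \<Rightarrow> (nat \<Rightarrow> nat) \<Rightarrow> (nat \<Rightarrow> nat) set) \<Rightarrow> (nat \<Rightarrow> nat) \<Rightarrow> real" where
  "fiber_growth D y = real_of_ereal (fiber_growth_ereal D y)"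

section \<open>Measure-theoretic entropy\<close>

definition finite_measurable_partition :: "'a measure \<Rightarrow> 'a set set \<Rightarrow> bool" where
  "finite_measurable_partition M \<xi> \<longleftrightarrow> finite \<xi> \<and> \<xi> \<subseteq> sets M \<and> partition_on (space M) \<xi>"

text \<open>Since \<open>ln 0 = 0\<close>, the convention \<open>0 log 0 = 0\<close> is built in.\<close>

definition partition_entropy :: "'a measure \<Rightarrow> 'a set set \<Rightarrow> real" where
  "partition_entropy M \<xi> = - (\<Sum>A\<in>\<xi>. measure M A * ln (measure M A))"

definition pullback_partition :: "'a measure \<Rightarrow> ('a \<Rightarrow> 'a) \<Rightarrow> 'a set set \<Rightarrow> 'a set set" where
  "pullback_partition M T \<xi> = (\<lambda>A. T -` A \<inter> space M) ` \<xi>"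

text \<open>The join of \<open>\<xi>, T\<^sup>-\<^sup>1\<xi>, \<dots>, T\<^sup>-\<^sup>(\<^sup>n\<^sup>-\<^sup>1\<^sup>)\<xi>\<close>.\<close>

definition iterated_join :: "'a measure \<Rightarrow> ('a \<Rightarrow> 'a) \<Rightarrow> 'a set set \<Rightarrow> nat \<Rightarrow> 'a set set" where
  "iterated_join M T \<xi> n = common_refinement ((\<lambda>i. pullback_partition M (T ^^ i) \<xi>) ` {..<n})"

text \<open>For \<open>T\<close>-invariant probability measures the limit exists by subadditivity.\<close>

definition entropy_wrt :: "'a measure \<Rightarrow> ('a \<Rightarrow> 'a) \<Rightarrow> 'a set set \<Rightarrow> real" where
  "entropy_wrt M T \<xi> = lim (\<lambda>n. 1 / real n * partition_entropy M (iterated_join M T \<xi> n))"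

definition measure_entropy :: "'a measure \<Rightarrow> ('a \<Rightarrow> 'a) \<Rightarrow> ereal" where
  "measure_entropy M T = (SUP \<xi>\<in>{\<xi>. finite_measurable_partition M \<xi>}. ereal (entropy_wrt M T \<xi>))"

section \<open>Invariant measures, equilibrium states, compensation functions\<close>

abbreviation borel_on :: "'a::topological_space set \<Rightarrow> 'a measure" where
  "borel_on X \<equiv> restrict_space borel X"

definition invariant_measures :: "(nat \<Rightarrow> nat) set \<Rightarrow> (nat \<Rightarrow> nat) measure set" where
  "invariant_measures X =
     {\<mu>. prob_space \<mu> \<and> sets \<mu> = sets (borel_on X) \<and> distr \<mu> \<mu> shift = \<mu>}"

definition push_forward ::
    "(nat \<Rightarrow> nat) set \<Rightarrow> ((nat \<Rightarrow> nat) \<Rightarrow> (nat \<Rightarrow> nat)) \<Rightarrow> (nat \<Rightarrow> nat) measure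
      \<Rightarrow> (nat \<Rightarrow> nat) measure" where
  "push_forward Y \<pi> \<mu> = distr \<mu> (borel_on Y) \<pi>"

definition free_energy :: "((nat \<Rightarrow> nat) \<Rightarrow> real) \<Rightarrow> (nat \<Rightarrow> nat) measure \<Rightarrow> ereal" where
  "free_energy f \<mu> = measure_entropy \<mu> shift + ereal (\<integral>x. f x \<partial>\<mu>)"

definition variational_pressure :: "(nat \<Rightarrow> nat) set \<Rightarrow> ((nat \<Rightarrow> nat) \<Rightarrow> real) \<Rightarrow> ereal" where
  "variational_pressure X f = (SUP \<mu>\<in>invariant_measures X. free_energy f \<mu>)"

definition equilibrium_states ::
    "(nat \<Rightarrow> nat) set \<Rightarrow> ((nat \<Rightarrow> nat) \<Rightarrow> real) \<Rightarrow> (nat \<Rightarrow> nat) measure set" where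
  "equilibrium_states X f =
     {\<mu> \<in> invariant_measures X. free_energy f \<mu> = variational_pressure X f}"

definition compensation_function ::
    "(nat \<Rightarrow> nat) set \<Rightarrow> (nat \<Rightarrow> nat) set \<Rightarrow> ((nat \<Rightarrow> nat) \<Rightarrow> (nat \<Rightarrow> nat))
      \<Rightarrow> ((nat \<Rightarrow> nat) \<Rightarrow> real) \<Rightarrow> bool" where
  "compensation_function X Y \<pi> f \<longleftrightarrow>
     (\<forall>\<phi>. continuous_on Y \<phi> \<longrightarrow>
        variational_pressure X (\<lambda>x. f x + \<phi> (\<pi> x)) = variational_pressure Y \<phi>)"

definition max_relative_entropy ::
    "(nat \<Rightarrow> nat) set \<Rightarrow> (nat \<Rightarrow> nat) set \<Rightarrow> ((nat \<Rightarrow> nat) \<Rightarrow> (nat \<Rightarrow> nat))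
      \<Rightarrow> (nat \<Rightarrow> nat) measure \<Rightarrow> (nat \<Rightarrow> nat) measure \<Rightarrow> bool" where
  "max_relative_entropy X Y \<pi> m \<mu> \<longleftrightarrow>
     \<mu> \<in> invariant_measures X \<and> push_forward Y \<pi> \<mu> = m \<and>
     measure_entropy \<mu> shift =
       (SUP \<nu>\<in>{\<nu> \<in> invariant_measures X. push_forward Y \<pi> \<nu> = m}. measure_entropy \<nu> shift)"

end

theory Submission
  imports Defs
begin

text \<open>
  Everything follows from the relative variational principle: for every invariant measure \<open>m\<close> on \<open>Y\<close>,
  the largest entropy of an invariant measure on \<open>X\<close> over \<open>m\<close> is attained and equals
  \<open>h(m) + \<integral>F dm\<close>.

  For the upper bound, let \<open>\<mu>\<close> lie over \<open>m\<close>. The entropy of \<open>n\<close>-blocks of \<open>X\<close> relative to those of \<open>Y\<close> grows,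
  per \<open>q\<close> further symbols, by at most \<open>\<integral>ln N dm\<close>, where \<open>N(y)\<close> counts the \<open>q\<close>-blocks of points lying over a long
  cylinder around \<open>y\<close>; by compactness \<open>N(y)\<close> decreases to \<open>|D\<^sub>q(y)|\<close> as the cylinder shrinks.
  So \<open>h(\<mu>) - h(m) \<le> (1/q) \<integral>ln |D\<^sub>q| dm\<close>, and Fatou's lemma applies.

  For the lower bound, distribute \<open>n\<close>-blocks uniformly over the fibres of the \<open>2n\<close>-blocks of \<open>Y\<close>, weighted by \<open>m\<close>,
  and average along orbits. A weak limit \<open>\<mu>\<close> lies over \<open>m\<close>, and
  \<open>h(\<mu>) \<ge> h(m) + inf\<^sub>q (1/q) \<integral>ln |D\<^sub>q| dm\<close>. As \<open>ln |D\<^sub>n(y)|\<close> is a subadditive cocycle, \<open>F\<close> is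
  dominated by limits of Birkhoff averages of \<open>(1/q) ln |D\<^sub>q|\<close>, so \<open>\<integral>F dm\<close> is at most this infimum.
\<close>

section \<open>Entropy of finite-valued functions\<close>

text \<open>Conditional entropy occurs only as a difference \<open>H(f, g) - H(g)\<close> for
  finite-valued \<open>f\<close> and \<open>g\<close>, so that no disintegration over \<pi> is
  needed. In the same spirit fibres are replaced by preimages of cylinders of \<open>Y\<close>:
  these involve finitely many symbols, require no measurable choice of points over \<open>y\<close>,
  and only enlarge the fibre, which helps the lower bound and disappears in the limit for the upper
  one.

  \<open>F\<close> is merely Borel, so \<open>-F o \<pi> + \<phi> o \<pi>\<close> offers no
  semicontinuity from which to obtain an equilibrium state on \<open>X\<close>; one is lifted from
  \<open>Y\<close> instead, where \<phi> is continuous. In place of a pointwise subadditive ergodic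
  theorem there is one inequality of integrals, based on \<open>F(y) \<le> F(shift y)\<close>.

  Orbit averaging moves an \<open>n\<close>-block by up to \<open>n - 1\<close> places; this is why
  the law on \<open>Y\<close> is prescribed on \<open>2n\<close>-blocks. In the end the free energy
  of \<mu> is that of \<open>m = \<pi> \<mu>\<close> plus
  \<open>h(\<mu>) - h(m) - \<integral>F dm\<close>, a quantity that is never positive, and
  conditions (i) and (ii) say that neither of the two parts falls short of its maximum.\<close>

definition level_prob :: "'a measure \<Rightarrow> ('a \<Rightarrow> 'b) \<Rightarrow> 'b \<Rightarrow> real" where
  "level_prob M f v = measure M {x \<in> space M. f x = v}"

text \<open>Entropy of the partition into level sets. With functions in place of partitions, a join
  is a pair, a pullback is a composition, and refinement means that one function determines the
  other.\<close>

definition fin_entropy :: "'a measure \<Rightarrow> ('a \<Rightarrow> 'b) \<Rightarrow> real" where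
  "fin_entropy M f = - (\<Sum>v\<in>f ` space M. level_prob M f v * ln (level_prob M f v))"

lemma level_prob_eq_0:
  assumes "v \<notin> f ` space M" shows "level_prob M f v = 0"
proof -
  have "{x \<in> space M. f x = v} = {}" using assms by auto
  then show ?thesis by (simp only: level_prob_def measure_empty)
qed

lemma fin_entropy_superset:
  assumes "finite S" "f ` space M \<subseteq> S"
  shows "fin_entropy M f = - (\<Sum>v\<in>S. level_prob M f v * ln (level_prob M f v))"
  unfolding fin_entropy_def
  by (intro arg_cong[of _ _ uminus] sum.mono_neutral_left assms) (simp add: level_prob_eq_0)

lemma simple_function_level_sets [measurable]:
  "simple_function M f \<Longrightarrow> {x \<in> space M. P (f x)} \<in> sets M"
  using simple_functionD(2)[of M f "Collect P"] by (simp add: vimage_def Int_def conj_commute)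

lemma simple_function_refined:
  assumes "simple_function M f" and "\<And>x y. x \<in> space M \<Longrightarrow> y \<in> space M \<Longrightarrow> f x = f y \<Longrightarrow> g x = g y"
  shows "simple_function M g"
proof -
  define h where "h v = g (SOME y. y \<in> space M \<and> f y = v)" for v
  have "h (f x) = g x" if "x \<in> space M" for x
    unfolding h_def using assms(2) that by (metis (mono_tags, lifting) someI_ex)
  with simple_function_compose1[OF assms(1), of h] show ?thesis
    by (subst simple_function_cong[of _ _ "\<lambda>x. h (f x)"]) auto
qed

section \<open>Shannon's inequalities\<close>

context prob_space
begin

lemma level_prob_nonneg: "0 \<le> level_prob M f v"
  by (simp add: level_prob_def)

lemma level_prob_mono:
  assumes "simple_function M g" "\<And>x. x \<in> space M \<Longrightarrow> f x = v \<Longrightarrow> g x = w"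
  shows "level_prob M f v \<le> level_prob M g w"
  unfolding level_prob_def using assms by (intro finite_measure_mono) (auto simp: simple_function_level_sets)

lemma integral_simple_compose:
  fixes \<phi> :: "'b \<Rightarrow> real"
  assumes f: "simple_function M f"
  shows "(\<integral>x. \<phi> (f x) \<partial>M) = (\<Sum>v\<in>f ` space M. level_prob M f v * \<phi> v)"
proof -
  have fin: "finite (f ` space M)" using f by (simp add: simple_function_def)
  have "(\<integral>x. \<phi> (f x) \<partial>M) = (\<integral>x. (\<Sum>v\<in>f ` space M. indicator {x \<in> space M. f x = v} x * \<phi> v) \<partial>M)"
  proof (rule Bochner_Integration.integral_cong[OF refl])
    fix x assume "x \<in> space M"
    then have "(\<Sum>v\<in>f ` space M. indicator {x \<in> space M. f x = v} x * \<phi> v)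
        = (\<Sum>v\<in>f ` space M. if f x = v then \<phi> v else 0)"
      by (intro sum.cong) (auto simp: indicator_def)
    then show "\<phi> (f x) = (\<Sum>v\<in>f ` space M. indicator {x \<in> space M. f x = v} x * \<phi> v)"
      using fin \<open>x \<in> space M\<close> by simp
  qed
  also have "\<dots> = (\<Sum>v\<in>f ` space M. level_prob M f v * \<phi> v)"
    using simple_function_level_sets[OF f]
    by (subst Bochner_Integration.integral_sum)
       (auto simp: level_prob_def emeasure_eq_measure intro!: integrable_real_indicator sum.cong)
  finally show ?thesis .
qed

lemma integrable_simple_compose:
  fixes \<phi> :: "'b \<Rightarrow> real"
  assumes f: "simple_function M f"
  shows "integrable M (\<lambda>x. \<phi> (f x))"
proof (rule integrable_const_bound)
  have "finite ((\<lambda>x. \<bar>\<phi> (f x)\<bar>) ` space M)"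
    using f by (metis (no_types) finite_imageI image_image simple_function_def)
  then show "AE x in M. norm (\<phi> (f x)) \<le> Max ((\<lambda>x. \<bar>\<phi> (f x)\<bar>) ` space M)"
    by (intro AE_I2) auto
  show "(\<lambda>x. \<phi> (f x)) \<in> borel_measurable M"
    using simple_function_compose1[OF f] by (rule borel_measurable_simple_function)
qed

lemma sum_level_prob:
  assumes "simple_function M f" shows "(\<Sum>v\<in>f ` space M. level_prob M f v) = 1"
  using integral_simple_compose[OF assms, of "\<lambda>_. 1"] by (simp add: prob_space)

lemma fin_entropy_integral:
  "simple_function M f \<Longrightarrow> fin_entropy M f = - (\<integral>x. ln (level_prob M f (f x)) \<partial>M)"
  by (simp add: fin_entropy_def integral_simple_compose[where \<phi>="\<lambda>v. ln (level_prob M f v)"])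

lemma level_prob_AE_pos:
  assumes f: "simple_function M f"
  shows "AE x in M. 0 < level_prob M f (f x)"
proof -
  have "AE x in M. \<forall>v\<in>{v \<in> f ` space M. level_prob M f v = 0}. f x \<noteq> v"
  proof (rule AE_finite_allI)
    show "finite {v \<in> f ` space M. level_prob M f v = 0}" using f by (auto simp: simple_function_def)
    fix v assume "v \<in> {v \<in> f ` space M. level_prob M f v = 0}"
    then have "emeasure M {x \<in> space M. f x = v} = 0"
      by (simp add: level_prob_def emeasure_eq_measure)
    then show "AE x in M. f x \<noteq> v"
      using simple_function_level_sets[OF f] by (intro AE_I[where N="{x \<in> space M. f x = v}"]) auto
  qed
  then show ?thesis
    using AE_space by eventually_elim (auto simp: less_le level_prob_nonneg)
qed

text \<open>Sum \<open>ln t \<le> t - 1\<close> at \<open>t = exp (L v) / p v\<close>, where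
  \<open>exp (L v)\<close> is a competing weight of total mass at most 1. Values of probability zero
  are kept out of that mass: for a weight given by its logarithm they could contribute
  \<open>exp (ln 0) = 1\<close>.\<close>

lemma gibbs_inequality:
  assumes f: "simple_function M f"
    and L: "(\<Sum>v\<in>{v \<in> f ` space M. 0 < level_prob M f v}. exp (L v)) \<le> 1"
  shows "fin_entropy M f \<le> - (\<integral>x. L (f x) \<partial>M)"
proof -
  let ?p = "level_prob M f" and ?S = "{v \<in> f ` space M. 0 < level_prob M f v}"
  have fin: "finite (f ` space M)" using f by (simp add: simple_function_def)
  have drop: "(\<Sum>v\<in>f ` space M. ?p v * h v) = (\<Sum>v\<in>?S. ?p v * h v)" for h
    using fin level_prob_nonneg[of f] by (intro sum.mono_neutral_right) (auto simp: less_le)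
  have "(\<Sum>v\<in>?S. ?p v * L v) - (\<Sum>v\<in>?S. ?p v * ln (?p v)) = (\<Sum>v\<in>?S. ?p v * (L v - ln (?p v)))"
    by (simp add: sum_subtractf right_diff_distrib)
  also have "\<dots> \<le> (\<Sum>v\<in>?S. exp (L v) - ?p v)"
  proof (rule sum_mono)
    fix v assume v: "v \<in> ?S"
    then have "L v - ln (?p v) = ln (exp (L v) / ?p v)" by (simp add: ln_div)
    also have "\<dots> \<le> exp (L v) / ?p v - 1" using v by (intro ln_le_minus_one) auto
    finally have "?p v * (L v - ln (?p v)) \<le> ?p v * (exp (L v) / ?p v - 1)"
      by (intro mult_left_mono level_prob_nonneg)
    also have "\<dots> = exp (L v) - ?p v" using v by (simp add: field_simps)
    finally show "?p v * (L v - ln (?p v)) \<le> exp (L v) - ?p v" .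
  qed
  also have "\<dots> \<le> 0"
    using L drop[of "\<lambda>_. 1"] sum_level_prob[OF f] by (simp add: sum_subtractf)
  finally show ?thesis
    unfolding fin_entropy_def integral_simple_compose[OF f] drop[of L] drop[of "\<lambda>v. ln (?p v)"] by simp
qed

lemma sum_level_prob_pair:
  assumes X: "simple_function M X" and Z: "simple_function M Z"
  shows "(\<Sum>x\<in>X ` space M. level_prob M (\<lambda>w. (X w, Z w)) (x, z)) = level_prob M Z z"
  unfolding level_prob_def
proof (rule prob_sum[symmetric])
  show "finite (X ` space M)" using X by (simp add: simple_function_def)
  show "{w \<in> space M. (X w, Z w) = (x, z)} \<in> events" for x
    by (rule simple_function_level_sets[OF simple_function_Pair[OF X Z], where P="\<lambda>v. v = (x, z)"])
  show "{w \<in> space M. Z w = z} \<in> events" by (rule simple_function_level_sets[OF Z])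
qed (auto intro!: AE_I2)

text \<open>Conditioning on more does not raise entropy. The competing weight in Gibbs' inequality
  is \<open>p(x, z) q(y, z) / r(z)\<close>, the law under which \<open>X\<close> and
  \<open>Y\<close> are independent given \<open>Z\<close>.\<close>

lemma fin_entropy_submodular:
  assumes X: "simple_function M X" and Y: "simple_function M Y" and Z: "simple_function M Z"
  shows "fin_entropy M (\<lambda>w. (X w, Y w, Z w)) + fin_entropy M Z
    \<le> fin_entropy M (\<lambda>w. (X w, Z w)) + fin_entropy M (\<lambda>w. (Y w, Z w))"
proof -
  let ?XZ = "\<lambda>w. (X w, Z w)" and ?YZ = "\<lambda>w. (Y w, Z w)" and ?F = "\<lambda>w. (X w, Y w, Z w)"
  have XZ: "simple_function M ?XZ" and YZ: "simple_function M ?YZ" and F: "simple_function M ?F"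
    using X Y Z by (auto intro: simple_function_Pair)
  have fin: "finite (X ` space M)" "finite (Y ` space M)" "finite (Z ` space M)"
    using X Y Z by (auto simp: simple_function_def)
  let ?p = "level_prob M ?XZ" and ?q = "level_prob M ?YZ" and ?r = "level_prob M Z"
  define L where "L = (\<lambda>(x, y, z). ln (?p (x, z)) + ln (?q (y, z)) - ln (?r z))"
  let ?S = "{v \<in> ?F ` space M. 0 < level_prob M ?F v}"
  let ?R = "X ` space M \<times> Y ` space M \<times> Z ` space M"
  have "(\<Sum>v\<in>?S. exp (L v)) = (\<Sum>(x, y, z)\<in>?S. ?p (x, z) * ?q (y, z) / ?r z)"
  proof (rule sum.cong[OF refl])
    fix v assume v: "v \<in> ?S"
    obtain x y z where [simp]: "v = (x, y, z)" by (cases v)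
    have "level_prob M ?F v \<le> ?p (x, z)" "level_prob M ?F v \<le> ?q (y, z)" "level_prob M ?F v \<le> ?r z"
      using level_prob_mono[OF XZ, of ?F v "(x, z)"] level_prob_mono[OF YZ, of ?F v "(y, z)"]
        level_prob_mono[OF Z, of ?F v z] by simp_all
    then have "0 < ?p (x, z)" "0 < ?q (y, z)" "0 < ?r z" using v by auto
    then show "exp (L v) = (case v of (x, y, z) \<Rightarrow> ?p (x, z) * ?q (y, z) / ?r z)"
      by (simp add: L_def exp_add exp_diff)
  qed
  also have "\<dots> \<le> (\<Sum>(x, y, z)\<in>?R. ?p (x, z) * ?q (y, z) / ?r z)"
    using fin by (intro sum_mono2) (auto intro!: divide_nonneg_nonneg mult_nonneg_nonneg level_prob_nonneg)
  also have "\<dots> = (\<Sum>x\<in>X ` space M. \<Sum>y\<in>Y ` space M. \<Sum>z\<in>Z ` space M. ?p (x, z) * ?q (y, z) / ?r z)"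
    by (simp add: sum.cartesian_product)
  also have "\<dots> = (\<Sum>x\<in>X ` space M. \<Sum>z\<in>Z ` space M. \<Sum>y\<in>Y ` space M. ?p (x, z) * ?q (y, z) / ?r z)"
    by (intro sum.cong refl sum.swap)
  also have "\<dots> = (\<Sum>z\<in>Z ` space M. \<Sum>x\<in>X ` space M. \<Sum>y\<in>Y ` space M. ?p (x, z) * ?q (y, z) / ?r z)"
    by (rule sum.swap)
  also have "\<dots> = (\<Sum>z\<in>Z ` space M. (\<Sum>x\<in>X ` space M. ?p (x, z)) * (\<Sum>y\<in>Y ` space M. ?q (y, z)) / ?r z)"
    by (simp add: sum_product sum_divide_distrib)
  also have "\<dots> = (\<Sum>z\<in>Z ` space M. ?r z * ?r z / ?r z)"
    by (simp add: sum_level_prob_pair X Y Z)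
  also have "\<dots> = (\<Sum>z\<in>Z ` space M. ?r z)" by (intro sum.cong) auto
  also have "\<dots> = 1" by (rule sum_level_prob[OF Z])
  finally have "fin_entropy M ?F \<le> - (\<integral>w. L (?F w) \<partial>M)"
    by (intro gibbs_inequality F) auto
  also have "(\<integral>w. L (?F w) \<partial>M)
      = (\<integral>w. ln (?p (?XZ w)) \<partial>M) + (\<integral>w. ln (?q (?YZ w)) \<partial>M) - (\<integral>w. ln (?r (Z w)) \<partial>M)"
    using integrable_simple_compose[OF XZ, of "\<lambda>v. ln (?p v)"] integrable_simple_compose[OF YZ, of "\<lambda>v. ln (?q v)"]
      integrable_simple_compose[OF Z, of "\<lambda>v. ln (?r v)"]
    by (simp add: L_def)
  finally show ?thesis
    by (simp add: fin_entropy_integral XZ YZ Z)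
qed

text \<open>As \<open>f\<close> determines \<open>g\<close>, each level set of \<open>f\<close> lies
  inside one of \<open>g\<close>, and the logarithms compare pointwise wherever the level of
  \<open>f\<close> has positive probability.\<close>

lemma fin_entropy_mono:
  assumes f: "simple_function M f"
    and g: "\<And>x y. x \<in> space M \<Longrightarrow> y \<in> space M \<Longrightarrow> f x = f y \<Longrightarrow> g x = g y"
  shows "fin_entropy M g \<le> fin_entropy M f"
proof -
  have g': "simple_function M g" by (rule simple_function_refined[OF f g])
  have "(\<integral>x. ln (level_prob M f (f x)) \<partial>M) \<le> (\<integral>x. ln (level_prob M g (g x)) \<partial>M)"
  proof (rule integral_mono_AE)
    show "AE x in M. ln (level_prob M f (f x)) \<le> ln (level_prob M g (g x))"
      using level_prob_AE_pos[OF f] AE_space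
    proof eventually_elim
      case (elim x)
      have "level_prob M f (f x) \<le> level_prob M g (g x)"
        using g elim by (intro level_prob_mono g') blast
      with elim show ?case by simp
    qed
  qed (auto intro: integrable_simple_compose[OF f] integrable_simple_compose[OF g'])
  then show ?thesis by (simp add: fin_entropy_integral f g')
qed

lemma fin_entropy_cong:
  assumes f: "simple_function M f"
    and "\<And>x y. x \<in> space M \<Longrightarrow> y \<in> space M \<Longrightarrow> f x = f y \<longleftrightarrow> g x = g y"
  shows "fin_entropy M f = fin_entropy M g"
proof -
  have "simple_function M g" by (rule simple_function_refined[OF f]) (simp add: assms(2))
  then show ?thesis
    using fin_entropy_mono[OF f, of g] fin_entropy_mono[of g f] assms(2) by (intro antisym) auto
qed

lemma fin_entropy_const: "fin_entropy M (\<lambda>x. c) = 0"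
proof -
  obtain x where "x \<in> space M" using not_empty by blast
  then have "(\<lambda>x. c) ` space M = {c}" by auto
  then show ?thesis by (simp add: fin_entropy_def level_prob_def prob_space)
qed

lemma fin_entropy_nonneg:
  assumes "simple_function M f" shows "0 \<le> fin_entropy M f"
  using fin_entropy_mono[OF assms, of "\<lambda>_. ()"] by (simp add: fin_entropy_const)

lemma fin_entropy_Pair_le:
  assumes "simple_function M X" "simple_function M Y"
  shows "fin_entropy M (\<lambda>w. (X w, Y w)) \<le> fin_entropy M X + fin_entropy M Y"
proof -
  have 1: "fin_entropy M (\<lambda>w. (X w, Y w, ())) = fin_entropy M (\<lambda>w. (X w, Y w))"
    "fin_entropy M (\<lambda>w. (X w, ())) = fin_entropy M X"  "fin_entropy M (\<lambda>w. (Y w, ())) = fin_entropy M Y"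
    using assms by (auto intro!: fin_entropy_cong simple_function_Pair)
  show ?thesis using fin_entropy_submodular[OF assms, of "\<lambda>_. ()"] by (simp add: 1 fin_entropy_const)
qed

text \<open>Given \<open>W = w\<close>, the weight \<open>1 / N w\<close> on at most
  \<open>N w\<close> values competes in Gibbs' inequality. The estimate serves three times: for the
  bound by the number of values, for Fano's inequality, and for the count of words over a cylinder
  of \<open>Y\<close>.\<close>

lemma fin_entropy_Pair_le_card:
  fixes X :: "'a \<Rightarrow> 'b"
  assumes X: "simple_function M X" and W: "simple_function M W"
    and N: "\<And>w. w \<in> W ` space M \<Longrightarrow> real (card (X ` {x \<in> space M. W x = w})) \<le> N w"
  shows "fin_entropy M (\<lambda>x. (X x, W x)) \<le> fin_entropy M W + (\<integral>x. ln (N (W x)) \<partial>M)"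
proof -
  let ?F = "\<lambda>x. (X x, W x)" and ?r = "level_prob M W"
  have F: "simple_function M ?F" using X W by (rule simple_function_Pair)
  have finX: "finite (X ` space M)" and finW: "finite (W ` space M)"
    using X W by (auto simp: simple_function_def)
  let ?C = "\<lambda>w. X ` {x \<in> space M. W x = w}"
  have finC: "finite (?C w)" for w by (rule finite_subset[OF _ finX]) auto
  have Npos: "0 < N w" if "w \<in> W ` space M" for w
  proof -
    have "0 < card (?C w)" using that finC by (auto simp: card_gt_0_iff)
    with N[OF that] show ?thesis by linarith
  qed
  define L where "L = (\<lambda>(x :: 'b, w). ln (?r w) - ln (N w))"
  let ?S = "{v \<in> ?F ` space M. 0 < level_prob M ?F v}"
  have "(\<Sum>v\<in>?S. exp (L v)) = (\<Sum>(x, w)\<in>?S. ?r w / N w)"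
  proof (rule sum.cong[OF refl])
    fix v assume v: "v \<in> ?S"
    obtain x w where [simp]: "v = (x, w)" by (cases v)
    have "level_prob M ?F v \<le> ?r w" using level_prob_mono[OF W, of ?F v w] by simp
    then have "0 < ?r w" "0 < N w" using v by (auto intro: Npos)
    then show "exp (L v) = (case v of (x, w) \<Rightarrow> ?r w / N w)"
      by (simp add: L_def exp_diff)
  qed
  \<comment> \<open>Exchanging the coordinates sorts the pairs by \<open>w\<close>, so that the
    inner sum runs over the values of \<open>X\<close> on \<open>W = w\<close>.\<close>
  also have "\<dots> \<le> (\<Sum>(w, x)\<in>(SIGMA w:W ` space M. ?C w). ?r w / N w)"
    unfolding sum.reindex[OF inj_on_subset[OF swap_inj_on subset_UNIV], of _ ?S for f, simplified]
  proof -
    have "(\<Sum>(x, w)\<in>?S. ?r w / N w) = (\<Sum>(w, x)\<in>prod.swap ` ?S. ?r w / N w)"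
      by (subst sum.reindex) (auto simp: split_def)
    also have "\<dots> \<le> (\<Sum>(w, x)\<in>(SIGMA w:W ` space M. ?C w). ?r w / N w)"
      using finW finC Npos by (intro sum_mono2) (auto intro!: divide_nonneg_nonneg level_prob_nonneg less_imp_le[OF Npos])
    finally show "(\<Sum>(x, w)\<in>?S. ?r w / N w) \<le> (\<Sum>(w, x)\<in>(SIGMA w:W ` space M. ?C w). ?r w / N w)" .
  qed
  also have "\<dots> = (\<Sum>w\<in>W ` space M. real (card (?C w)) * (?r w / N w))"
    using finW finC by (subst sum.Sigma[symmetric]) auto
  also have "\<dots> \<le> (\<Sum>w\<in>W ` space M. N w * (?r w / N w))"
    using Npos by (intro sum_mono mult_right_mono N) (auto intro!: divide_nonneg_nonneg level_prob_nonneg less_imp_le[OF Npos])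
  also have "\<dots> = (\<Sum>w\<in>W ` space M. ?r w)" using Npos by (intro sum.cong refl) (metis less_irrefl nonzero_mult_div_cancel_left times_divide_eq_right)
  also have "\<dots> = 1" by (rule sum_level_prob[OF W])
  finally have "fin_entropy M ?F \<le> - (\<integral>x. L (?F x) \<partial>M)"
    by (intro gibbs_inequality F) auto
  also have "(\<integral>x. L (?F x) \<partial>M) = (\<integral>x. ln (?r (W x)) \<partial>M) - (\<integral>x. ln (N (W x)) \<partial>M)"
    using integrable_simple_compose[OF W, of "\<lambda>v. ln (?r v)"] integrable_simple_compose[OF W, of "\<lambda>v. ln (N v)"]
    by (simp add: L_def)
  finally show ?thesis by (simp add: fin_entropy_integral W)
qed

lemma fin_entropy_le_card:
  assumes X: "simple_function M X" and "X ` space M \<subseteq> S" "finite S"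
  shows "fin_entropy M X \<le> ln (real (card S))"
proof -
  have "fin_entropy M (\<lambda>x. (X x, ())) \<le> fin_entropy M (\<lambda>_. ()) + (\<integral>x. ln (real (card S)) \<partial>M)"
    using assms(2,3) by (intro fin_entropy_Pair_le_card X) (auto intro!: card_mono)
  moreover have "fin_entropy M (\<lambda>x. (X x, ())) = fin_entropy M X"
    by (intro fin_entropy_cong simple_function_Pair X) auto
  ultimately show ?thesis by (simp add: fin_entropy_const prob_space)
qed

lemma fin_entropy_distr:
  assumes T: "T \<in> measurable M N" and f: "simple_function N f"
  shows "fin_entropy (distr M N T) f = fin_entropy M (\<lambda>x. f (T x))"
proof -
  interpret D: prob_space "distr M N T" using T by (rule prob_space_distr)
  have f1: "simple_function (distr M N T) f" using f by (simp add: simple_function_def)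
  have f2: "simple_function M (\<lambda>x. f (T x))"
    using simple_function_comp[OF T f] by (simp add: comp_def)
  have lp: "level_prob (distr M N T) f v = level_prob M (\<lambda>x. f (T x)) v" for v
    unfolding level_prob_def using measurable_space[OF T]
    by (subst measure_distr[OF T]) (auto intro!: arg_cong[of _ _ prob] simple_function_level_sets[OF f])
  have "(\<lambda>x. ln (level_prob M (\<lambda>x. f (T x)) (f x))) \<in> borel_measurable N"
    using simple_function_compose1[OF f] by (rule borel_measurable_simple_function)
  then show ?thesis
    by (simp add: D.fin_entropy_integral[OF f1] fin_entropy_integral[OF f2] lp integral_distr[OF T])
qed

end

section \<open>Entropy rates and generators\<close>

lemma fekete:
  fixes u :: "nat \<Rightarrow> real"
  assumes sub: "\<And>m n. u (m + n) \<le> u m + u n" and nonneg: "\<And>n. 0 \<le> u n"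
  obtains L where "(\<lambda>n. u n / real n) \<longlonglongrightarrow> L" "\<And>n. 1 \<le> n \<Longrightarrow> L \<le> u n / real n"
proof -
  define L where "L = (INF n\<in>{1..}. u n / real n)"
  have bdd: "bdd_below ((\<lambda>n. u n / real n) ` {1..})"
    using nonneg by (intro bdd_belowI2[where m=0]) auto
  have le: "L \<le> u n / real n" if "1 \<le> n" for n
    unfolding L_def using that bdd by (intro cINF_lower) auto
  have mult: "u (j * q) \<le> real j * u q + u 0" for j q
  proof (induction j)
    case (Suc j)
    have "u (Suc j * q) \<le> u q + u (j * q)" using sub[of q "j * q"] by simp
    with Suc show ?case by (simp add: algebra_simps)
  qed simp
  have "(\<lambda>n. u n / real n) \<longlonglongrightarrow> L"
  proof (rule LIMSEQ_I)
    fix e :: real assume e: "0 < e"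
    have "\<exists>q\<in>{1..}. u q / real q < L + e / 2"
      using cINF_less_iff[OF _ bdd, of "L + e / 2"] e by (auto simp: L_def)
    then obtain q where q: "1 \<le> q" "u q / real q < L + e / 2" by auto
    \<comment> \<open>\<open>C\<close> absorbs the remainder \<open>n mod q\<close> together with
      the term \<open>u 0\<close>, which starts the induction in \<open>mult\<close>.\<close>
    define C where "C = u 0 + (\<Sum>r<q. u r)"
    have C: "0 \<le> C" using nonneg by (auto simp: C_def intro!: add_nonneg_nonneg sum_nonneg)
    have bound: "u n / real n \<le> u q / real q + C / real n" if n: "1 \<le> n" for n
    proof -
      have "u n \<le> u (n div q * q) + u (n mod q)"
        using sub[of "n div q * q" "n mod q"] by simp
      also have "u (n mod q) \<le> (\<Sum>r<q. u r)"
        using q nonneg by (intro member_le_sum) auto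
      also have "u (n div q * q) \<le> real (n div q) * u q + u 0" by (rule mult)
      finally have "u n \<le> real (n div q) * u q + C" by (simp add: C_def)
      also have "real (n div q) * u q \<le> real n / real q * u q"
        using of_nat_div_le_of_nat[of n q, where 'a=real] nonneg by (intro mult_right_mono) auto
      finally have "u n / real n \<le> (real n / real q * u q + C) / real n" by (simp add: divide_right_mono)
      also have "\<dots> = u q / real q + C / real n" using n by (simp add: field_simps)
      finally show ?thesis .
    qed
    obtain N where N: "C / (e / 2) < real N" using reals_Archimedean2 by blast
    show "\<exists>no. \<forall>n\<ge>no. norm (u n / real n - L) < e"
    proof (intro exI allI impI)
      fix n assume n: "max 1 N \<le> n"
      then have "C / (e / 2) < real n" using N by linarith
      then have "C / real n < e / 2" using e n by (simp add: field_simps)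
      then have "u n / real n < L + e" using bound[of n] q n by linarith
      with le[of n] n show "norm (u n / real n - L) < e" by simp
    qed
  qed
  then show ?thesis using le by (rule that)
qed

text \<open>The \<open>f\<close>-name of \<open>x\<close>. Its level sets are the cells of the
  iterated join of the level sets of \<open>f\<close>, so joins can be forgotten once
  \<open>iterated_join_eq\<close> is available.\<close>

definition itinerary :: "('a \<Rightarrow> 'a) \<Rightarrow> ('a \<Rightarrow> 'b) \<Rightarrow> nat \<Rightarrow> 'a \<Rightarrow> 'b list" where
  "itinerary T f n x = map (\<lambda>i. f ((T ^^ i) x)) [0..<n]"

definition entropy_rate :: "'a measure \<Rightarrow> ('a \<Rightarrow> 'a) \<Rightarrow> ('a \<Rightarrow> 'b) \<Rightarrow> real" where
  "entropy_rate M T f = lim (\<lambda>n. fin_entropy M (itinerary T f n) / real n)"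

lemma length_itinerary [simp]: "length (itinerary T f n x) = n"
  by (simp add: itinerary_def)

lemma itinerary_eq_iff:
  "itinerary T f n x = itinerary T f n y \<longleftrightarrow> (\<forall>i<n. f ((T ^^ i) x) = f ((T ^^ i) y))"
  by (auto simp: itinerary_def list_eq_iff_nth_eq)

lemma itinerary_add: "itinerary T f (m + n) x = itinerary T f m x @ itinerary T f n ((T ^^ m) x)"
proof -
  have "(T ^^ (i - m)) ((T ^^ m) x) = (T ^^ i) x" if "m \<le> i" for i
    using that by (metis comp_apply funpow_add le_add_diff_inverse2)
  then show ?thesis by (intro nth_equalityI) (auto simp: itinerary_def nth_append)
qed

lemma itinerary_Suc: "itinerary T f (Suc n) x = itinerary T f n x @ [f ((T ^^ n) x)]"
  by (simp add: itinerary_def)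

locale measure_preserving = prob_space M for M :: "'a measure" +
  fixes T :: "'a \<Rightarrow> 'a"
  assumes T_meas: "T \<in> measurable M M" and distr_T: "distr M M T = M"
begin

lemma funpow_measurable: "T ^^ n \<in> measurable M M"
proof (induction n)
  case (Suc n) then show ?case using measurable_comp[OF Suc T_meas] by (simp add: comp_def)
qed (simp add: id_def)

lemma distr_funpow: "distr M M (T ^^ n) = M"
proof (induction n)
  case 0 show ?case by (simp add: id_def distr_id)
next
  case (Suc n)
  have "distr M M (T ^^ Suc n) = distr (distr M M (T ^^ n)) M T"
    using distr_distr[OF T_meas funpow_measurable, of n] by simp
  with Suc show ?case by (simp add: distr_T del: funpow.simps)
qed

lemma funpow_space: "x \<in> space M \<Longrightarrow> (T ^^ n) x \<in> space M"
  using measurable_space[OF funpow_measurable] .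

lemma simple_function_funpow:
  "simple_function M f \<Longrightarrow> simple_function M (\<lambda>x. f ((T ^^ n) x))"
  using simple_function_comp[OF funpow_measurable, of f n] by (simp add: comp_def)

lemma fin_entropy_funpow:
  assumes "simple_function M f"
  shows "fin_entropy M (\<lambda>x. f ((T ^^ n) x)) = fin_entropy M f"
  using fin_entropy_distr[OF funpow_measurable[of n] assms] by (simp add: distr_funpow)

lemma simple_function_itinerary:
  assumes f: "simple_function M f" shows "simple_function M (itinerary T f n)"
proof (induction n)
  case 0 show ?case by (simp add: itinerary_def[abs_def])
next
  case (Suc n)
  show ?case
    by (rule simple_function_refined[OF simple_function_Pair[OF Suc simple_function_funpow[OF f, of n]]])
       (simp add: itinerary_Suc)
qed

lemma fin_entropy_itinerary_add:
  assumes f: "simple_function M f"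
  shows "fin_entropy M (itinerary T f (m + n)) \<le> fin_entropy M (itinerary T f m) + fin_entropy M (itinerary T f n)"
proof -
  note s = simple_function_itinerary[OF f] and s' = simple_function_funpow[OF simple_function_itinerary[OF f]]
  have "fin_entropy M (itinerary T f (m + n))
      \<le> fin_entropy M (\<lambda>x. (itinerary T f m x, itinerary T f n ((T ^^ m) x)))"
    by (rule fin_entropy_mono[OF simple_function_Pair[OF s s']]) (simp add: itinerary_add)
  also have "\<dots> \<le> fin_entropy M (itinerary T f m) + fin_entropy M (\<lambda>x. itinerary T f n ((T ^^ m) x))"
    by (rule fin_entropy_Pair_le[OF s s'])
  also have "fin_entropy M (\<lambda>x. itinerary T f n ((T ^^ m) x)) = fin_entropy M (itinerary T f n)"
    by (rule fin_entropy_funpow[OF s])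
  finally show ?thesis .
qed

lemma
  assumes f: "simple_function M f"
  shows entropy_rate_tendsto: "(\<lambda>n. fin_entropy M (itinerary T f n) / real n) \<longlonglongrightarrow> entropy_rate M T f"
    and entropy_rate_le: "\<And>n. 1 \<le> n \<Longrightarrow> entropy_rate M T f \<le> fin_entropy M (itinerary T f n) / real n"
proof -
  obtain L where L: "(\<lambda>n. fin_entropy M (itinerary T f n) / real n) \<longlonglongrightarrow> L"
    "\<And>n. 1 \<le> n \<Longrightarrow> L \<le> fin_entropy M (itinerary T f n) / real n"
    using fekete[of "\<lambda>n. fin_entropy M (itinerary T f n)", OF fin_entropy_itinerary_add[OF f]
        fin_entropy_nonneg[OF simple_function_itinerary[OF f]]] by blast
  have "entropy_rate M T f = L" unfolding entropy_rate_def using L(1) by (rule limI)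
  with L show "(\<lambda>n. fin_entropy M (itinerary T f n) / real n) \<longlonglongrightarrow> entropy_rate M T f"
    "\<And>n. 1 \<le> n \<Longrightarrow> entropy_rate M T f \<le> fin_entropy M (itinerary T f n) / real n" by auto
qed

text \<open>In terms of conditional entropy, \<open>H(f^n | g^n) \<le> n H(f | g)\<close>. Each
  induction step uses submodularity twice: the new symbol of \<open>f\<close> is conditioned on the
  past as well as on the new symbol of \<open>g\<close>, and then the past of \<open>f\<close> on
  the new symbol of \<open>g\<close> as well as on the past of \<open>g\<close>.\<close>

lemma fin_entropy_itinerary_relative:
  assumes f: "simple_function M f" and g: "simple_function M g"
  shows "fin_entropy M (\<lambda>x. (itinerary T f n x, itinerary T g n x)) \<le> fin_entropy M (itinerary T g n)
    + real n * (fin_entropy M (\<lambda>x. (f x, g x)) - fin_entropy M g)"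
proof (induction n)
  case 0
  have "fin_entropy M (\<lambda>x. (itinerary T f 0 x, itinerary T g 0 x)) = 0" "fin_entropy M (itinerary T g 0) = 0"
    by (simp_all add: itinerary_def[abs_def] fin_entropy_const)
  then show ?case by simp
next
  case (Suc n)
  let ?F = "itinerary T f n" and ?G = "itinerary T g n"
  let ?f = "\<lambda>x. f ((T ^^ n) x)" and ?g = "\<lambda>x. g ((T ^^ n) x)"
  note sF = simple_function_itinerary[OF f, of n] and sG = simple_function_itinerary[OF g, of n]
  note sf = simple_function_funpow[OF f, of n] and sg = simple_function_funpow[OF g, of n]
  note sFG = simple_function_Pair[OF sF sG] and sfg = simple_function_Pair[OF f g]
  have "fin_entropy M (\<lambda>x. (?f x, (?F x, ?G x), ?g x)) + fin_entropy M ?g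
      \<le> fin_entropy M (\<lambda>x. (?f x, ?g x)) + fin_entropy M (\<lambda>x. ((?F x, ?G x), ?g x))"
    by (rule fin_entropy_submodular[OF sf sFG sg])
  moreover have "fin_entropy M (\<lambda>x. (?g x, ?F x, ?G x)) + fin_entropy M ?G
      \<le> fin_entropy M (\<lambda>x. (?g x, ?G x)) + fin_entropy M (\<lambda>x. (?F x, ?G x))"
    by (rule fin_entropy_submodular[OF sg sF sG])
  moreover have "fin_entropy M (\<lambda>x. ((?F x, ?G x), ?g x)) = fin_entropy M (\<lambda>x. (?g x, ?F x, ?G x))"
    by (rule fin_entropy_cong[OF simple_function_Pair[OF sFG sg]]) auto
  moreover have "fin_entropy M (\<lambda>x. (?f x, ?g x)) = fin_entropy M (\<lambda>x. (f x, g x))" "fin_entropy M ?g = fin_entropy M g"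
    using fin_entropy_funpow[OF sfg] fin_entropy_funpow[OF g] by auto
  moreover have "fin_entropy M (\<lambda>x. (itinerary T f (Suc n) x, itinerary T g (Suc n) x))
      = fin_entropy M (\<lambda>x. (?f x, (?F x, ?G x), ?g x))"
    by (rule fin_entropy_cong[symmetric, OF simple_function_Pair[OF sf simple_function_Pair[OF sFG sg]]])
       (auto simp: itinerary_Suc)
  moreover have "fin_entropy M (itinerary T g (Suc n)) = fin_entropy M (\<lambda>x. (?g x, ?G x))"
    by (rule fin_entropy_cong[symmetric, OF simple_function_Pair[OF sg sG]]) (auto simp: itinerary_Suc)
  ultimately show ?case using Suc by (simp add: algebra_simps)
qed

lemma entropy_rate_relative:
  assumes f: "simple_function M f" and g: "simple_function M g"
  shows "entropy_rate M T f \<le> entropy_rate M T g + (fin_entropy M (\<lambda>x. (f x, g x)) - fin_entropy M g)"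
    (is "_ \<le> _ + ?d")
proof (rule LIMSEQ_le[OF entropy_rate_tendsto[OF f]])
  show "(\<lambda>n. fin_entropy M (itinerary T g n) / real n + ?d) \<longlonglongrightarrow> entropy_rate M T g + ?d"
    by (intro tendsto_add tendsto_const entropy_rate_tendsto g)
  have "fin_entropy M (itinerary T f n) / real n \<le> fin_entropy M (itinerary T g n) / real n + ?d" if "1 \<le> n" for n
  proof -
    note sF = simple_function_itinerary[OF f, of n] and sG = simple_function_itinerary[OF g, of n]
    have "fin_entropy M (itinerary T f n) \<le> fin_entropy M (\<lambda>x. (itinerary T f n x, itinerary T g n x))"
      by (rule fin_entropy_mono[OF simple_function_Pair[OF sF sG]]) simp
    also note fin_entropy_itinerary_relative[OF f g, of n]
    finally have "fin_entropy M (itinerary T f n) / real n \<le> (fin_entropy M (itinerary T g n) + real n * ?d) / real n"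
      by (simp add: divide_right_mono)
    with that show ?thesis by (simp add: add_divide_distrib)
  qed
  then show "\<exists>N. \<forall>n\<ge>N. fin_entropy M (itinerary T f n) / real n \<le> fin_entropy M (itinerary T g n) / real n + ?d"
    by blast
qed

text \<open>The \<open>n\<close>-itinerary of \<open>g\<close> can be read off the
  \<open>(n + N)\<close>-itinerary of \<open>f\<close>; the \<open>N\<close> extra steps cost a
  fixed amount of entropy, which division by \<open>n\<close> removes.\<close>

lemma entropy_rate_determined:
  assumes f: "simple_function M f" and g: "simple_function M g"
    and det: "\<And>x y. x \<in> space M \<Longrightarrow> y \<in> space M \<Longrightarrow> itinerary T f N x = itinerary T f N y \<Longrightarrow> g x = g y"
  shows "entropy_rate M T g \<le> entropy_rate M T f"
proof (rule LIMSEQ_le[OF entropy_rate_tendsto[OF g]])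
  let ?c = "fin_entropy M (itinerary T f N)"
  have "(\<lambda>n. fin_entropy M (itinerary T f n) / real n + ?c / real n) \<longlonglongrightarrow> entropy_rate M T f + 0"
    by (intro tendsto_add entropy_rate_tendsto f lim_const_over_n)
  then show "(\<lambda>n. fin_entropy M (itinerary T f n) / real n + ?c / real n) \<longlonglongrightarrow> entropy_rate M T f" by simp
  have "fin_entropy M (itinerary T g n) / real n \<le> fin_entropy M (itinerary T f n) / real n + ?c / real n" for n
  proof -
    have "fin_entropy M (itinerary T g n) \<le> fin_entropy M (itinerary T f (n + N))"
    proof (rule fin_entropy_mono[OF simple_function_itinerary[OF f]])
      fix x y assume x: "x \<in> space M" and y: "y \<in> space M" and eq: "itinerary T f (n + N) x = itinerary T f (n + N) y"
      have "g ((T ^^ i) x) = g ((T ^^ i) y)" if "i < n" for i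
      proof (rule det[OF funpow_space[OF x] funpow_space[OF y]])
        show "itinerary T f N ((T ^^ i) x) = itinerary T f N ((T ^^ i) y)"
          unfolding itinerary_eq_iff
        proof (intro allI impI)
          fix j assume "j < N"
          then have "f ((T ^^ (j + i)) x) = f ((T ^^ (j + i)) y)"
            using eq that by (simp add: itinerary_eq_iff)
          then show "f ((T ^^ j) ((T ^^ i) x)) = f ((T ^^ j) ((T ^^ i) y))"
            by (simp add: funpow_add)
        qed
      qed
      then show "itinerary T g n x = itinerary T g n y" by (simp add: itinerary_eq_iff)
    qed
    also have "\<dots> \<le> fin_entropy M (itinerary T f n) + ?c" by (rule fin_entropy_itinerary_add[OF f])
    finally show ?thesis by (simp add: divide_right_mono flip: add_divide_distrib)
  qed
  then show "\<exists>N'. \<forall>n\<ge>N'. fin_entropy M (itinerary T g n) / real n \<le> fin_entropy M (itinerary T f n) / real n + ?c / real n"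
    by blast
qed

end

lemma (in prob_space) fin_entropy_Pair_le_fano:
  assumes f: "simple_function M f" and g: "simple_function M g"
  defines "\<delta> \<equiv> prob {x \<in> space M. f x \<noteq> g x}"
  shows "fin_entropy M (\<lambda>x. (f x, g x)) \<le> fin_entropy M g
    + (\<delta> * ln (real (card (f ` space M))) - \<delta> * ln \<delta> - (1 - \<delta>) * ln (1 - \<delta>))"
proof -
  let ?e = "\<lambda>x. f x \<noteq> g x" and ?s = "real (card (f ` space M))"
  have fg: "simple_function M (\<lambda>x. (f x, g x))" by (rule simple_function_Pair[OF f g])
  have e: "simple_function M ?e"
    by (rule simple_function_refined[OF fg]) simp
  have ge: "simple_function M (\<lambda>x. (g x, ?e x))" by (rule simple_function_Pair[OF g e])
  have fin: "finite (f ` space M)" using f by (simp add: simple_function_def)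
  have ev: "{x \<in> space M. ?e x} \<in> events" using simple_function_level_sets[OF fg, of "\<lambda>(a, b). a \<noteq> b"] by simp
  define N where "N = (\<lambda>(v :: 'b, b). if b then ?s else 1)"
  have "fin_entropy M (\<lambda>x. (f x, g x)) \<le> fin_entropy M (\<lambda>x. (f x, (g x, ?e x)))"
    by (rule fin_entropy_mono[OF simple_function_Pair[OF f ge]]) auto
  also have "\<dots> \<le> fin_entropy M (\<lambda>x. (g x, ?e x)) + (\<integral>x. ln (N (g x, ?e x)) \<partial>M)"
  proof (rule fin_entropy_Pair_le_card[OF f ge])
    fix w assume "w \<in> (\<lambda>x. (g x, ?e x)) ` space M"
    obtain v b where w: "w = (v, b)" by (cases w)
    show "real (card (f ` {x \<in> space M. (g x, ?e x) = w})) \<le> N w"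
    proof (cases b)
      case True
      then show ?thesis using fin by (auto simp: N_def w intro!: card_mono)
    next
      case False
      have "f ` {x \<in> space M. (g x, ?e x) = w} \<subseteq> {v}" using False by (auto simp: w)
      from card_mono[OF _ this] have "card (f ` {x \<in> space M. (g x, ?e x) = w}) \<le> 1" by simp
      then show ?thesis using False by (simp add: N_def w)
    qed
  qed
  also have "(\<integral>x. ln (N (g x, ?e x)) \<partial>M) = (\<integral>x. indicator {x \<in> space M. ?e x} x * ln ?s \<partial>M)"
    by (intro Bochner_Integration.integral_cong) (auto simp: N_def indicator_def)
  also have "\<dots> = \<delta> * ln ?s" using ev by (simp add: \<delta>_def)
  also have "fin_entropy M (\<lambda>x. (g x, ?e x)) \<le> fin_entropy M g + fin_entropy M ?e"
    by (rule fin_entropy_Pair_le[OF g e])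
  finally have "fin_entropy M (\<lambda>x. (f x, g x)) \<le> fin_entropy M g + fin_entropy M ?e + \<delta> * ln ?s" by simp
  moreover have "fin_entropy M ?e = - (\<Sum>b\<in>{True, False}. level_prob M ?e b * ln (level_prob M ?e b))"
    by (rule fin_entropy_superset) auto
  moreover have "level_prob M ?e True = \<delta>" by (simp add: level_prob_def \<delta>_def)
  moreover have "level_prob M ?e False = 1 - \<delta>"
    using prob_neg[OF ev] by (simp add: level_prob_def \<delta>_def)
  ultimately show ?thesis by simp
qed

lemma continuous_on_x_ln_x: "continuous_on {0..} (\<lambda>x::real. x * ln x)"
  unfolding continuous_on_def
proof
  fix x :: real assume "x \<in> {0..}"
  show "((\<lambda>x. x * ln x) \<longlongrightarrow> x * ln x) (at x within {0..})"
  proof (cases "x = 0")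
    case False
    then show ?thesis by (intro tendsto_intros) auto
  next
    case True
    \<comment> \<open>\<open>ln s \<le> s - 1\<close> at \<open>s = 1 / sqrt t\<close> trades the
      logarithm for a square root that tends to 0, which is also the value of
      \<open>0 * ln 0\<close>.\<close>
    have bound: "norm (t * ln t) \<le> 2 * sqrt t" if "0 \<le> t" "t < 1" for t :: real
    proof (cases "t = 0")
      case False
      then have t: "0 < t" using that by simp
      have "ln (1 / sqrt t) \<le> 1 / sqrt t - 1" using t by (intro ln_le_minus_one) auto
      then have "- ln t \<le> 2 * (1 / sqrt t)" using t by (simp add: ln_div ln_sqrt)
      then have "t * - ln t \<le> t * (2 * (1 / sqrt t))" using t by (intro mult_left_mono) auto
      also have "\<dots> = 2 * (t / sqrt t)" by simp
      also have "\<dots> = 2 * sqrt t" using t by (simp only: real_div_sqrt less_imp_le)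
      finally show ?thesis using t that by (simp add: abs_mult)
    qed simp
    have lim: "((\<lambda>t. 2 * sqrt t) \<longlongrightarrow> 2 * sqrt 0) (at 0 within {0..})" by (intro tendsto_intros)
    have "\<forall>\<^sub>F t in at 0 within {0..}. norm (t * ln t) \<le> 2 * sqrt (t :: real)"
      unfolding eventually_at by (rule exI[of _ 1]) (auto intro: bound[simplified])
    from Lim_null_comparison[OF this] lim have "((\<lambda>t::real. t * ln t) \<longlongrightarrow> 0) (at 0 within {0..})" by simp
    with True show ?thesis by simp
  qed
qed

section \<open>Partitions and the functions naming their cells\<close>

lemma partition_entropy_level_sets:
  assumes "P = (\<lambda>v. {x \<in> space M. f x = v}) ` f ` space M"
  shows "partition_entropy M P = fin_entropy M f"
proof -
  have inj: "inj_on (\<lambda>v. {x \<in> space M. f x = v}) (f ` space M)"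
    by (auto simp: inj_on_def)
  show ?thesis
    unfolding partition_entropy_def fin_entropy_def assms sum.reindex[OF inj] by (simp add: level_prob_def)
qed

definition cell :: "'a set set \<Rightarrow> 'a \<Rightarrow> 'a set" where
  "cell \<xi> x = (THE A. A \<in> \<xi> \<and> x \<in> A)"

lemma cell_eq:
  assumes "partition_on \<Omega> \<xi>" "A \<in> \<xi>" "x \<in> A" shows "cell \<xi> x = A"
  unfolding cell_def
proof (rule the_equality)
  show "A \<in> \<xi> \<and> x \<in> A" using assms by simp
  show "B = A" if "B \<in> \<xi> \<and> x \<in> B" for B
    using that assms disjointD[OF partition_onD2[OF assms(1)], of B A] by blast
qed

lemma cell:
  assumes "partition_on \<Omega> \<xi>" "x \<in> \<Omega>" shows "cell \<xi> x \<in> \<xi>" "x \<in> cell \<xi> x"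
proof -
  obtain A where A: "A \<in> \<xi>" "x \<in> A" using assms by (auto dest!: partition_onD1)
  with cell_eq[OF assms(1) A] show "cell \<xi> x \<in> \<xi>" "x \<in> cell \<xi> x" by auto
qed

lemma simple_function_cell:
  assumes "finite_measurable_partition M \<xi>" shows "simple_function M (cell \<xi>)"
  unfolding simple_function_def
proof (intro conjI ballI)
  have P: "partition_on (space M) \<xi>" "finite \<xi>" "\<xi> \<subseteq> sets M"
    using assms by (auto simp: finite_measurable_partition_def)
  have sub: "cell \<xi> ` space M \<subseteq> \<xi>" using cell[OF P(1)] by auto
  then show "finite (cell \<xi> ` space M)" using P(2) finite_subset by blast
  fix A assume "A \<in> cell \<xi> ` space M"
  with sub have A: "A \<in> \<xi>" by auto
  then have "cell \<xi> -` {A} \<inter> space M = A"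
    using cell_eq[OF P(1) A] cell(2)[OF P(1)] A partition_onD1[OF P(1)] by blast
  then show "cell \<xi> -` {A} \<inter> space M \<in> sets M" using A P(3) by auto
qed

context measure_preserving
begin

text \<open>A member of the common refinement is a nonempty intersection of one choice from each
  pulled-back partition, and any point \<open>x\<close> in it forces the choice to be the cell of
  \<open>(T ^^ i) x\<close>. At \<open>n = 0\<close> the intersection would be over nothing and
  hence the whole type rather than \<open>space M\<close>.\<close>

lemma iterated_join_eq:
  assumes \<xi>: "partition_on (space M) \<xi>" and n: "1 \<le> n"
  shows "iterated_join M T \<xi> n
    = (\<lambda>v. {x \<in> space M. itinerary T (cell \<xi>) n x = v}) ` itinerary T (cell \<xi>) n ` space M"
    (is "_ = ?R")
proof -
  let ?pb = "\<lambda>i. pullback_partition M (T ^^ i) \<xi>"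
  let ?P = "?pb ` {..<n}"
  let ?C = "\<lambda>x. {y \<in> space M. itinerary T (cell \<xi>) n y = itinerary T (cell \<xi>) n x}"
  have R: "?R = ?C ` space M" by auto
  have in_pb: "B = (T ^^ i) -` cell \<xi> ((T ^^ i) x) \<inter> space M" if "B \<in> ?pb i" "x \<in> B" for B i x
    using that cell_eq[OF \<xi>] by (auto simp: pullback_partition_def)
  have mem: "y \<in> (T ^^ i) -` cell \<xi> ((T ^^ i) x) \<inter> space M \<longleftrightarrow> y \<in> space M \<and> cell \<xi> ((T ^^ i) y) = cell \<xi> ((T ^^ i) x)"
    if "x \<in> space M" for x y i
    using cell_eq[OF \<xi> cell(1)[OF \<xi> funpow_space[OF that, of i]]] cell(2)[OF \<xi> funpow_space, of y i] by auto
  have common: "\<Inter> (g ` ?P) = ?C x" if g: "\<And>Q. Q \<in> ?P \<Longrightarrow> g Q \<in> Q \<and> x \<in> g Q" and x: "x \<in> space M" for g x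
  proof -
    have "g (?pb i) = (T ^^ i) -` cell \<xi> ((T ^^ i) x) \<inter> space M" if "i < n" for i
      using g[of "?pb i"] that by (intro in_pb) auto
    then have "\<Inter> (g ` ?P) = (\<Inter>i<n. (T ^^ i) -` cell \<xi> ((T ^^ i) x) \<inter> space M)" by auto
    also have "\<dots> = ?C x"
    proof (rule set_eqI)
      fix y
      have "y \<in> (\<Inter>i<n. (T ^^ i) -` cell \<xi> ((T ^^ i) x) \<inter> space M)
          \<longleftrightarrow> (\<forall>i<n. y \<in> (T ^^ i) -` cell \<xi> ((T ^^ i) x) \<inter> space M)" by auto
      also have "\<dots> \<longleftrightarrow> (\<forall>i<n. y \<in> space M \<and> cell \<xi> ((T ^^ i) y) = cell \<xi> ((T ^^ i) x))"
        by (simp only: mem[OF x])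
      also have "\<dots> \<longleftrightarrow> y \<in> ?C x"
        using n by (auto simp: itinerary_eq_iff dest: spec[of _ 0])
      finally show "y \<in> (\<Inter>i<n. (T ^^ i) -` cell \<xi> ((T ^^ i) x) \<inter> space M) \<longleftrightarrow> y \<in> ?C x" .
    qed
    finally show ?thesis .
  qed
  show ?thesis
  proof (intro equalityI subsetI)
    fix B assume "B \<in> iterated_join M T \<xi> n"
    then obtain g where g: "g \<in> (\<Pi> Q\<in>?P. Q)" "B = \<Inter> (g ` ?P)" "B \<noteq> {}"
      unfolding iterated_join_def common_refinement by auto
    then obtain x where x: "x \<in> B" by auto
    have "x \<in> g (?pb 0)" "g (?pb 0) \<in> ?pb 0" using x g n by (auto simp del: funpow.simps)
    then have "x \<in> space M" by (auto simp: pullback_partition_def)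
    moreover have "g Q \<in> Q \<and> x \<in> g Q" if "Q \<in> ?P" for Q
      using that g x by auto
    ultimately have "B = ?C x" using common[of g x] g(2) by simp
    then show "B \<in> ?R" unfolding R using \<open>x \<in> space M\<close> by blast
  next
    fix B assume "B \<in> ?R"
    then obtain x where x: "x \<in> space M" "B = ?C x" unfolding R by auto
    define g where "g Q = (SOME A. A \<in> Q \<and> x \<in> A)" for Q
    have g: "g Q \<in> Q \<and> x \<in> g Q" if "Q \<in> ?P" for Q
      unfolding g_def
    proof (rule someI_ex)
      obtain i where "Q = ?pb i" using \<open>Q \<in> ?P\<close> by auto
      then show "\<exists>A. A \<in> Q \<and> x \<in> A"
        using cell[OF \<xi> funpow_space[OF x(1), of i]] x(1) by (auto simp: pullback_partition_def)
    qed
    have "B = \<Inter> (g ` ?P)" using common[OF g x(1)] x(2) by simp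
    moreover have "x \<in> B" using x by simp
    ultimately show "B \<in> iterated_join M T \<xi> n"
      unfolding iterated_join_def common_refinement using g by blast
  qed
qed

lemma entropy_wrt_eq:
  assumes \<xi>: "finite_measurable_partition M \<xi>"
  shows "entropy_wrt M T \<xi> = entropy_rate M T (cell \<xi>)"
proof -
  have p: "partition_on (space M) \<xi>" using \<xi> by (simp add: finite_measurable_partition_def)
  have "1 / real n * partition_entropy M (iterated_join M T \<xi> n)
      = fin_entropy M (itinerary T (cell \<xi>) n) / real n" for n
  \<comment> \<open>At \<open>n = 0\<close> both sides vanish, since division by zero gives
    zero.\<close>
  proof (cases "n = 0")
    case False
    then show ?thesis
      using partition_entropy_level_sets[OF iterated_join_eq[OF p, of n]] by simp
  qed simp
  then show ?thesis by (simp only: entropy_wrt_def entropy_rate_def)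
qed

lemma level_set_partition:
  assumes f: "simple_function M f"
  defines "\<xi> \<equiv> (\<lambda>v. {x \<in> space M. f x = v}) ` f ` space M"
  shows "finite_measurable_partition M \<xi>" "entropy_wrt M T \<xi> = entropy_rate M T f"
proof -
  have p: "partition_on (space M) \<xi>"
    by (rule partition_onI) (auto simp: \<xi>_def disjnt_def)
  show fp: "finite_measurable_partition M \<xi>"
    unfolding finite_measurable_partition_def using p f simple_function_level_sets[OF f]
    by (auto simp: \<xi>_def simple_function_def)
  have c: "cell \<xi> x = {y \<in> space M. f y = f x}" if "x \<in> space M" for x
    by (rule cell_eq[OF p]) (use that in \<open>auto simp: \<xi>_def\<close>)
  have ceq: "cell \<xi> x = cell \<xi> y \<longleftrightarrow> f x = f y" if "x \<in> space M" "y \<in> space M" for x y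
    using that by (auto simp: c)
  have "fin_entropy M (itinerary T (cell \<xi>) n) = fin_entropy M (itinerary T f n)" for n
    by (rule fin_entropy_cong[OF simple_function_itinerary[OF simple_function_cell[OF fp]]])
       (simp add: itinerary_eq_iff ceq funpow_space)
  then show "entropy_wrt M T \<xi> = entropy_rate M T f"
    by (simp add: entropy_wrt_eq[OF fp] entropy_rate_def)
qed

section \<open>Finitely determined sets and the Kolmogorov--Sinai theorem\<close>

definition determined :: "('a \<Rightarrow> 'b) \<Rightarrow> nat \<Rightarrow> 'a set \<Rightarrow> bool" where
  "determined f N B \<longleftrightarrow> B \<in> sets M \<and>
     (\<forall>x\<in>space M. \<forall>y\<in>space M. itinerary T f N x = itinerary T f N y \<longrightarrow> (x \<in> B \<longleftrightarrow> y \<in> B))"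

lemma determined_mono:
  assumes "determined f N B" "N \<le> N'" shows "determined f N' B"
  using assms unfolding determined_def itinerary_eq_iff by (meson order_less_le_trans)

text \<open>Sets depending on finitely many steps of the itinerary form an algebra, hence are dense in the
  \<open>\<sigma>\<close>-algebra they generate.\<close>

lemma determined_dense:
  assumes gen: "sets M = sigma_sets (space M) G" and G: "\<And>B. B \<in> G \<Longrightarrow> \<exists>N. determined f N B"
    and A: "A \<in> sets M" and e: "0 < e"
  shows "\<exists>N B. determined f N B \<and> measure M (A - B \<union> (B - A)) < e"
proof -
  define app where "app A \<longleftrightarrow> (\<forall>e>0. \<exists>N B. determined f N B \<and> measure M (A - B \<union> (B - A)) < e)" for A
  have det_sets: "determined f N B \<Longrightarrow> B \<in> sets M" for N B by (simp add: determined_def)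
  have det_app: "app A" if "determined f N A" for N A
    unfolding app_def using that by (auto intro!: exI[of _ N] exI[of _ A])
  have app_Un: "app (A1 \<union> A2)" if A: "app A1" "app A2" "A1 \<in> sets M" "A2 \<in> sets M" for A1 A2
    unfolding app_def
  proof (intro allI impI)
    fix e :: real assume "0 < e"
    then obtain N1 B1 N2 B2 where B: "determined f N1 B1" "measure M (A1 - B1 \<union> (B1 - A1)) < e / 2"
      "determined f N2 B2" "measure M (A2 - B2 \<union> (B2 - A2)) < e / 2"
      using A(1,2) unfolding app_def by (meson half_gt_zero)
    have "determined f (max N1 N2) B1" "determined f (max N1 N2) B2"
      using determined_mono[OF B(1)] determined_mono[OF B(3)] by auto
    then have d: "determined f (max N1 N2) (B1 \<union> B2)" unfolding determined_def by blast
    have "measure M ((A1 \<union> A2) - (B1 \<union> B2) \<union> ((B1 \<union> B2) - (A1 \<union> A2)))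
        \<le> measure M ((A1 - B1 \<union> (B1 - A1)) \<union> (A2 - B2 \<union> (B2 - A2)))"
      using det_sets[OF B(1)] det_sets[OF B(3)] A by (intro finite_measure_mono) auto
    also have "\<dots> \<le> measure M (A1 - B1 \<union> (B1 - A1)) + measure M (A2 - B2 \<union> (B2 - A2))"
      using det_sets[OF B(1)] det_sets[OF B(3)] A by (intro measure_Un_le) auto
    also have "\<dots> < e" using B by simp
    finally show "\<exists>N B. determined f N B \<and> measure M ((A1 \<union> A2) - B \<union> (B - (A1 \<union> A2))) < e" using d by blast
  qed
  have "A \<in> sets M \<and> app A" if "A \<in> sigma_sets (space M) G" for A
    using that
  proof induction
    case (Basic a)
    then obtain N where "determined f N a" using G by blast
    then show ?case using det_app det_sets by blast
  next
    case Empty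
    have "determined f 0 {}" by (simp add: determined_def)
    then show ?case using det_app by simp
  next
    case (Compl a)
    have "app (space M - a)"
      unfolding app_def
    proof (intro allI impI)
      fix e :: real assume "0 < e"
      then obtain N B where B: "determined f N B" "measure M (a - B \<union> (B - a)) < e"
        using Compl unfolding app_def by blast
      have "determined f N (space M - B)" using B(1) sets.compl_sets[of B M] unfolding determined_def by blast
      moreover have "(space M - a) - (space M - B) \<union> ((space M - B) - (space M - a)) = a - B \<union> (B - a)"
        using sets.sets_into_space[OF det_sets[OF B(1)]] sets.sets_into_space[of a M] Compl by auto
      ultimately show "\<exists>N B. determined f N B \<and> measure M ((space M - a) - B \<union> (B - (space M - a))) < e"
        using B(2) by (metis (no_types, lifting))
    qed
    with Compl show ?case by blast
  next
    case (Union a)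
    have am: "a i \<in> sets M" for i using Union by blast
    have fin: "app (\<Union>i<n. a i)" for n :: nat
    proof (induction n)
      case 0 show ?case using det_app[of 0 "{}"] by (simp add: determined_def)
    next
      case (Suc n)
      have "app ((\<Union>i<n. a i) \<union> a n)" using Suc Union am by (intro app_Un) auto
      then show ?case by (simp add: lessThan_Suc Un_commute)
    qed
    have "app (\<Union>i. a i)"
      unfolding app_def
    proof (intro allI impI)
      fix e :: real assume e: "0 < e"
      \<comment> \<open>Finitely many of the sets exhaust the union up to \<open>e / 2\<close>, and
        \<open>fin\<close> approximates their union within the other \<open>e / 2\<close>.\<close>
      have "(\<lambda>n. measure M (\<Union>i<n. a i)) \<longlonglongrightarrow> measure M (\<Union>n. \<Union>i<n. a i)"
        using am by (intro finite_Lim_measure_incseq) (auto simp: incseq_def intro: order_less_le_trans)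
      moreover have "(\<Union>n. \<Union>i<n. a i) = (\<Union>i. a i)" by auto
      ultimately obtain n where n: "\<bar>measure M (\<Union>i<n. a i) - measure M (\<Union>i. a i)\<bar> < e / 2"
        using e by (metis (no_types, lifting) LIMSEQ_D half_gt_zero order_refl real_norm_def)
      let ?An = "\<Union>i<n. a i" and ?A = "\<Union>i. a i"
      obtain N B where B: "determined f N B" "measure M (?An - B \<union> (B - ?An)) < e / 2"
        using fin[of n] e unfolding app_def by (meson half_gt_zero)
      have "measure M (?A - ?An) = measure M ?A - measure M ?An"
        using am by (intro finite_measure_Diff) auto
      then have "measure M (?A - ?An) < e / 2" using n by linarith
      moreover have "measure M (?A - B \<union> (B - ?A)) \<le> measure M ((?A - ?An) \<union> (?An - B \<union> (B - ?An)))"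
        using am det_sets[OF B(1)] by (intro finite_measure_mono) auto
      moreover have "\<dots> \<le> measure M (?A - ?An) + measure M (?An - B \<union> (B - ?An))"
        using am det_sets[OF B(1)] by (intro measure_Un_le) auto
      ultimately have "measure M (?A - B \<union> (B - ?A)) < e" using B(2) by linarith
      with B(1) show "\<exists>N B. determined f N B \<and> measure M (?A - B \<union> (B - ?A)) < e" by blast
    qed
    with am show ?case by auto
  qed
  with A e show ?thesis unfolding gen app_def by blast
qed

text \<open>Replacing every level set of \<open>h\<close> by a nearby set determined by finitely
  many steps of \<open>f\<close> produces a function \<open>g\<close> that can be read off those
  steps and differs from \<open>h\<close> only on a set of measure \<delta>. The rate of
  \<open>h\<close> then exceeds that of \<open>f\<close> by at most the Fano error
  \<open>?E \<delta>\<close>, which vanishes with \<delta>.\<close>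

lemma entropy_rate_le_generator:
  fixes h :: "'a \<Rightarrow> 'c"
  assumes f: "simple_function M f" and h: "simple_function M h"
    and gen: "sets M = sigma_sets (space M) G" and G: "\<And>B. B \<in> G \<Longrightarrow> \<exists>N. determined f N B"
  shows "entropy_rate M T h \<le> entropy_rate M T f"
proof -
  let ?V = "h ` space M"
  define s where "s = real (card ?V)"
  have finV: "finite ?V" using h by (simp add: simple_function_def)
  obtain x0 where x0: "x0 \<in> space M" using not_empty by blast
  have s: "0 < s" using finV x0 by (auto simp: s_def card_gt_0_iff)
  let ?E = "\<lambda>\<delta>. \<delta> * ln s - \<delta> * ln \<delta> - (1 - \<delta>) * ln (1 - \<delta>)"
  have "\<exists>\<delta>. 0 \<le> \<delta> \<and> \<delta> < e \<and> entropy_rate M T h \<le> entropy_rate M T f + ?E \<delta>" if e: "0 < e" for e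
  proof -
    have "\<forall>v\<in>?V. \<exists>N B. determined f N B \<and> measure M ({x \<in> space M. h x = v} - B \<union> (B - {x \<in> space M. h x = v})) < e / s"
      using e s simple_function_level_sets[OF h] by (intro ballI determined_dense[OF gen G]) auto
    from bchoice[OF this] obtain N where "\<forall>v\<in>?V. \<exists>B. determined f (N v) B
        \<and> measure M ({x \<in> space M. h x = v} - B \<union> (B - {x \<in> space M. h x = v})) < e / s" by blast
    from bchoice[OF this] obtain B where B: "\<And>v. v \<in> ?V \<Longrightarrow> determined f (N v) (B v)"
      "\<And>v. v \<in> ?V \<Longrightarrow> measure M ({x \<in> space M. h x = v} - B v \<union> (B v - {x \<in> space M. h x = v})) < e / s"
      by blast
    define D where "D v = {x \<in> space M. h x = v} - B v \<union> (B v - {x \<in> space M. h x = v})" for v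
    define N' where "N' = Max (N ` ?V)"
    have B': "determined f N' (B v)" if "v \<in> ?V" for v
      using that finV by (intro determined_mono[OF B(1)]) (auto simp: N'_def)
    \<comment> \<open>The sets \<open>B v\<close> may overlap and need not cover the space:
      \<open>g\<close> takes any \<open>v\<close> with \<open>x \<in> B v\<close>, and the dummy
      value \<open>h x0\<close> if there is none. Outside the error sets \<open>D v\<close> the only
      candidate is \<open>h x\<close>.\<close>
    define g where "g x = (if \<exists>v\<in>?V. x \<in> B v then SOME v. v \<in> ?V \<and> x \<in> B v else h x0)" for x
    have g_det: "g x = g y" if "x \<in> space M" "y \<in> space M" "itinerary T f N' x = itinerary T f N' y" for x y
    proof -
      have "\<And>v. v \<in> ?V \<Longrightarrow> x \<in> B v \<longleftrightarrow> y \<in> B v" using B' that unfolding determined_def by blast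
      then have "(\<lambda>v. v \<in> ?V \<and> x \<in> B v) = (\<lambda>v. v \<in> ?V \<and> y \<in> B v)" by blast
      then show ?thesis unfolding g_def by (auto dest: fun_cong)
    qed
    have g: "simple_function M g" by (rule simple_function_refined[OF simple_function_itinerary[OF f] g_det])
    have D: "D v \<in> sets M" if "v \<in> ?V" for v
      using B(1)[OF that] simple_function_level_sets[OF h] by (auto simp: D_def determined_def)
    define \<delta> where "\<delta> = prob {x \<in> space M. h x \<noteq> g x}"
    have sub: "{x \<in> space M. h x \<noteq> g x} \<subseteq> (\<Union>v\<in>?V. D v)"
    proof (rule subsetI, rule ccontr)
      fix x assume x: "x \<in> {x \<in> space M. h x \<noteq> g x}" and n: "x \<notin> (\<Union>v\<in>?V. D v)"
      then have "\<And>v. v \<in> ?V \<Longrightarrow> x \<in> B v \<longleftrightarrow> h x = v" by (auto simp: D_def)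
      then have "(SOME v. v \<in> ?V \<and> x \<in> B v) = h x" "\<exists>v\<in>?V. x \<in> B v"
        using x by (auto intro!: some_equality)
      then show False using x by (simp add: g_def)
    qed
    have "\<delta> \<le> measure M (\<Union>v\<in>?V. D v)" unfolding \<delta>_def using sub sets.finite_UN[OF finV D] by (rule finite_measure_mono)
    also have "\<dots> \<le> (\<Sum>v\<in>?V. measure M (D v))" using D finV by (intro finite_measure_subadditive_finite) (auto simp del: image_iff)
    also have "\<dots> < (\<Sum>v\<in>?V. e / s)"
      using B(2) finV x0 by (intro sum_strict_mono) (auto simp: D_def)
    also have "\<dots> = e" using s by (simp add: s_def)
    finally have "\<delta> < e" .
    moreover have "0 \<le> \<delta>" by (simp add: \<delta>_def)
    moreover have "entropy_rate M T g \<le> entropy_rate M T f"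
      using g_det by (rule entropy_rate_determined[OF f g])
    then have "entropy_rate M T h \<le> entropy_rate M T f + ?E \<delta>"
      using entropy_rate_relative[OF h g] fin_entropy_Pair_le_fano[OF h g]
      unfolding \<delta>_def s_def by linarith
    ultimately show ?thesis by blast
  qed
  then have "\<forall>n. \<exists>\<delta>. 0 \<le> \<delta> \<and> \<delta> < 1 / real (Suc n) \<and> entropy_rate M T h \<le> entropy_rate M T f + ?E \<delta>"
    by simp
  from choice[OF this] obtain \<delta> where \<delta>: "\<And>n. 0 \<le> \<delta> n" "\<And>n. \<delta> n < 1 / real (Suc n)"
    "\<And>n. entropy_rate M T h \<le> entropy_rate M T f + ?E (\<delta> n)" by blast
  have \<delta>0: "\<delta> \<longlonglongrightarrow> 0"
    by (rule tendsto_sandwich[OF _ _ tendsto_const LIMSEQ_Suc[OF lim_const_over_n[of 1]]])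
       (use \<delta> in \<open>auto intro!: always_eventually less_imp_le\<close>)
  have "(\<lambda>n. ?E (\<delta> n)) \<longlonglongrightarrow> 0 * ln s - 0 * ln 0 - (1 - 0) * ln (1 - 0)"
  proof (intro tendsto_diff tendsto_mult_right \<delta>0)
    show "(\<lambda>n. \<delta> n * ln (\<delta> n)) \<longlonglongrightarrow> 0 * ln 0"
      using continuous_on_tendsto_compose[OF continuous_on_x_ln_x \<delta>0] \<delta>(1) by simp
    show "(\<lambda>n. (1 - \<delta> n) * ln (1 - \<delta> n)) \<longlonglongrightarrow> (1 - 0) * ln (1 - 0)"
      by (intro tendsto_intros \<delta>0) simp
  qed
  then have "(\<lambda>n. entropy_rate M T f + ?E (\<delta> n)) \<longlonglongrightarrow> entropy_rate M T f + 0"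
    by (intro tendsto_add tendsto_const) simp
  then show ?thesis
    using \<delta>(3) by (intro LIMSEQ_le_const) auto
qed

theorem measure_entropy_generator:
  assumes f: "simple_function M f"
    and gen: "sets M = sigma_sets (space M) G" and G: "\<And>B. B \<in> G \<Longrightarrow> \<exists>N. determined f N B"
  shows "measure_entropy M T = ereal (entropy_rate M T f)"
  unfolding measure_entropy_def
proof (rule antisym)
  show "(SUP \<xi>\<in>{\<xi>. finite_measurable_partition M \<xi>}. ereal (entropy_wrt M T \<xi>)) \<le> ereal (entropy_rate M T f)"
    using entropy_rate_le_generator[OF f simple_function_cell gen G]
    by (intro SUP_least) (simp add: entropy_wrt_eq)
  show "ereal (entropy_rate M T f) \<le> (SUP \<xi>\<in>{\<xi>. finite_measurable_partition M \<xi>}. ereal (entropy_wrt M T \<xi>))"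
    using level_set_partition[OF f] by (intro SUP_upper2) auto
qed

end

section \<open>Ergodic averages and weak compactness\<close>

lemma (in measure_preserving) integral_funpow:
  fixes g :: "'a \<Rightarrow> real"
  assumes "g \<in> borel_measurable M"
  shows "(\<integral>x. g ((T ^^ n) x) \<partial>M) = (\<integral>x. g x \<partial>M)"
  using integral_distr[OF funpow_measurable assms] by (simp add: distr_funpow)

text \<open>The Katznelson--Weiss argument: cover an orbit segment by blocks on which the average of \<open>g\<close> nearly
  reaches \<open>u\<close>, replacing \<open>g\<close> by a large constant on the small set where such a block would be too long.\<close>

lemma (in measure_preserving) ergodic_integral_le:
  fixes g u :: "'a \<Rightarrow> real"
  assumes g[measurable]: "g \<in> borel_measurable M" and u[measurable]: "u \<in> borel_measurable M"
    and K: "\<And>x. x \<in> space M \<Longrightarrow> \<bar>g x\<bar> \<le> K" "\<And>x. x \<in> space M \<Longrightarrow> \<bar>u x\<bar> \<le> K"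
    and inc: "\<And>x. x \<in> space M \<Longrightarrow> u x \<le> u (T x)"
    and blocks: "\<And>x e. x \<in> space M \<Longrightarrow> 0 < e \<Longrightarrow> \<exists>n\<ge>1. real n * (u x - e) \<le> (\<Sum>i<n. g ((T ^^ i) x))"
  shows "(\<integral>x. u x \<partial>M) \<le> (\<integral>x. g x \<partial>M)"
proof -
  note [measurable] = funpow_measurable T_meas
  obtain x0 where x0: "x0 \<in> space M" using not_empty by blast
  have K0: "0 \<le> K" using K(1)[OF x0] by linarith
  have int: "integrable M g" "integrable M u"
    using K by (auto intro!: integrable_const_bound[where B=K] AE_I2)
  have incn: "u x \<le> u ((T ^^ n) x)" if "x \<in> space M" for x n
  proof (induction n)
    case (Suc n) then show ?case using inc[OF funpow_space[OF that, of n]] by simp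
  qed simp
  have main: "(\<integral>x. u x \<partial>M) - e \<le> (\<integral>x. g x \<partial>M) + 2 * K * e" if e: "0 < e" for e
  proof -
    define A where "A m = {x \<in> space M. \<exists>n\<in>{1..m}. real n * (u x - e) \<le> (\<Sum>i<n. g ((T ^^ i) x))}" for m
    have A[measurable]: "A m \<in> sets M" for m unfolding A_def by measurable
    have "(\<lambda>m. measure M (A m)) \<longlonglongrightarrow> measure M (\<Union>m. A m)"
      by (intro finite_Lim_measure_incseq) (auto simp: incseq_def A_def)
    also have "(\<Union>m. A m) = space M"
      using blocks[OF _ e] by (fastforce simp: A_def)
    finally have "(\<lambda>m. measure M (A m)) \<longlonglongrightarrow> 1" by (simp add: prob_space)
    from LIMSEQ_D[OF this e] obtain m where "norm (measure M (A m) - 1) < e" by blast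
    then have m: "measure M (space M - A m) < e"
      using prob_compl[OF A[of m]] by simp
    \<comment> \<open>The constant \<open>K\<close> is at least \<open>u x\<close>, so off
      \<open>A m\<close> a single step is already a good block for \<open>h\<close>.\<close>
    define h where "h x = (if x \<in> A m then g x else K)" for x
    have h[measurable]: "h \<in> borel_measurable M" unfolding h_def by measurable
    have hg: "g x \<le> h x" "\<bar>h x\<bar> \<le> K" if "x \<in> space M" for x
      using K(1)[OF that] K0 by (auto simp: h_def)
    \<comment> \<open>Good blocks are laid end to end, and \<open>inc\<close> keeps the bound with
      the initial value \<open>u x\<close> valid along the orbit. Only the last block can overrun
      \<open>L\<close>; fewer than \<open>m\<close> terms are then left, each losing at most
      \<open>2 * K\<close>.\<close>
    have cover: "real L * (u x - e) - 2 * K * real m \<le> (\<Sum>i<L. h ((T ^^ i) x))" if "x \<in> space M" for L x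
      using that
    proof (induction L arbitrary: x rule: less_induct)
      case (less L)
      have split: "real L * (u x - e) - 2 * K * real m \<le> (\<Sum>i<L. h ((T ^^ i) x))"
        if n: "1 \<le> n" "n \<le> L" "real n * (u x - e) \<le> (\<Sum>i<n. h ((T ^^ i) x))" for n
      proof -
        have "real (L - n) * (u x - e) \<le> real (L - n) * (u ((T ^^ n) x) - e)"
          using incn[OF less.prems] by (intro mult_left_mono) auto
        also have "\<dots> - 2 * K * real m \<le> (\<Sum>i<L - n. h ((T ^^ i) ((T ^^ n) x)))"
          using n by (intro less.IH funpow_space less.prems) auto
        also have "\<dots> = (\<Sum>i\<in>{n..<L}. h ((T ^^ i) x))"
          using n by (intro sum.reindex_bij_witness[of _ "\<lambda>i. i - n" "\<lambda>i. i + n"])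
            (auto simp: funpow_add)
        finally have "real (L - n) * (u x - e) - 2 * K * real m \<le> (\<Sum>i\<in>{n..<L}. h ((T ^^ i) x))" by simp
        moreover have "(\<Sum>i<L. h ((T ^^ i) x)) = (\<Sum>i<n. h ((T ^^ i) x)) + (\<Sum>i\<in>{n..<L}. h ((T ^^ i) x))"
          using n by (simp add: lessThan_atLeast0 sum.atLeastLessThan_concat)
        moreover have "real L * (u x - e) = real n * (u x - e) + real (L - n) * (u x - e)"
          using n by (simp add: of_nat_diff algebra_simps)
        ultimately show ?thesis using n(3) by linarith
      qed
      have ux: "\<bar>u x\<bar> \<le> K" using K(2) less.prems by blast
      show ?case
      proof (cases "L = 0")
        case True then show ?thesis using K0 by simp
      next
        case False
        show ?thesis
        proof (cases "x \<in> A m")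
          case False
          then show ?thesis using \<open>L \<noteq> 0\<close> ux e by (intro split[of 1]) (auto simp: h_def)
        next
          case True
          then obtain n where n: "1 \<le> n" "n \<le> m" "real n * (u x - e) \<le> (\<Sum>i<n. g ((T ^^ i) x))"
            by (auto simp: A_def)
          show ?thesis
          proof (cases "n \<le> L")
            case True
            have "(\<Sum>i<n. g ((T ^^ i) x)) \<le> (\<Sum>i<n. h ((T ^^ i) x))"
              by (intro sum_mono hg funpow_space less.prems)
            with n True show ?thesis by (intro split[of n]) auto
          next
            case False
            have "real L * (u x - e) \<le> real L * K" using ux e by (intro mult_left_mono) auto
            moreover have "real L * K \<le> real m * K" using False n K0 by (intro mult_right_mono) auto
            moreover have "(\<Sum>i<L. - K) \<le> (\<Sum>i<L. h ((T ^^ i) x))"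
              using hg(2) funpow_space[OF less.prems] by (intro sum_mono) (smt (verit))
            ultimately show ?thesis by (simp add: algebra_simps)
          qed
        qed
      qed
    qed
    have inth: "integrable M h" "integrable M (\<lambda>x. h ((T ^^ i) x))" for i
      using hg(2) funpow_space by (auto intro!: integrable_const_bound[where B=K] AE_I2)
    \<comment> \<open>By invariance all terms on the right have the same integral. The error does
      not grow with \<open>L\<close>, so the mean excess of \<open>u - e\<close> over
      \<open>h\<close> cannot be positive.\<close>
    have L: "real L * ((\<integral>x. u x \<partial>M) - e - (\<integral>x. h x \<partial>M)) \<le> 2 * K * real m" for L
    proof -
      have "(\<integral>x. real L * (u x - e) - 2 * K * real m \<partial>M) \<le> (\<integral>x. (\<Sum>i<L. h ((T ^^ i) x)) \<partial>M)"
        using int inth cover by (intro integral_mono) auto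
      also have "\<dots> = real L * (\<integral>x. h x \<partial>M)"
        using inth by (simp add: integral_funpow)
      finally show ?thesis using int by (simp add: prob_space algebra_simps)
    qed
    have "(\<integral>x. u x \<partial>M) - e - (\<integral>x. h x \<partial>M) \<le> 0"
    proof (rule ccontr)
      assume "\<not> ?thesis"
      then obtain L :: nat where "2 * K * real m < real L * ((\<integral>x. u x \<partial>M) - e - (\<integral>x. h x \<partial>M))"
        using reals_Archimedean3 by (metis not_le)
      with L[of L] show False by simp
    qed
    moreover have "(\<integral>x. h x \<partial>M) \<le> (\<integral>x. g x + 2 * K * indicator (space M - A m) x \<partial>M)"
    proof (rule integral_mono[OF inth(1)])
      show "integrable M (\<lambda>x. g x + 2 * K * indicator (space M - A m) x)"
        using int by (intro Bochner_Integration.integrable_add integrable_mult_right integrable_real_indicator)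
          (auto simp: emeasure_eq_measure)
      show "h x \<le> g x + 2 * K * indicator (space M - A m) x" if "x \<in> space M" for x
        using K(1)[OF that] that by (auto simp: h_def)
    qed
    moreover have "(\<integral>x. g x + 2 * K * indicator (space M - A m) x \<partial>M) = (\<integral>x. g x \<partial>M) + 2 * K * measure M (space M - A m)"
      using int by (subst Bochner_Integration.integral_add)
        (auto simp: emeasure_eq_measure intro!: integrable_mult_right integrable_real_indicator)
    moreover have "2 * K * measure M (space M - A m) \<le> 2 * K * e" using m K0 by (intro mult_left_mono) auto
    ultimately show ?thesis by linarith
  qed
  show ?thesis
  proof (rule field_le_epsilon)
    fix d :: real assume d: "0 < d"
    define e where "e = d / (1 + 2 * K)"
    have "0 < e" "e * (1 + 2 * K) = d" using d K0 by (auto simp: e_def)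
    with main[of e] show "(\<integral>x. u x \<partial>M) \<le> (\<integral>x. g x \<partial>M) + d" by (simp add: algebra_simps)
  qed
qed

text \<open>Fatou's lemma for upper limits, dominated by the constant \<open>B\<close>. The index 0
  is exempt from the bound by \<open>c\<close> because the functions will be the averages
  \<open>fibre_log n y / real n\<close>.\<close>

lemma (in prob_space) le_integral_limsup:
  fixes f :: "nat \<Rightarrow> 'a \<Rightarrow> real" and F :: "'a \<Rightarrow> real"
  assumes f: "\<And>n. f n \<in> borel_measurable M" and F: "F \<in> borel_measurable M"
    and bd: "\<And>n x. x \<in> space M \<Longrightarrow> 0 \<le> f n x" "\<And>n x. x \<in> space M \<Longrightarrow> f n x \<le> B"
    and lim: "\<And>x. x \<in> space M \<Longrightarrow> limsup (\<lambda>n. ereal (f n x)) = ereal (F x)"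
    and F0: "\<And>x. x \<in> space M \<Longrightarrow> 0 \<le> F x" "\<And>x. x \<in> space M \<Longrightarrow> F x \<le> B"
    and c: "\<And>n. 1 \<le> n \<Longrightarrow> c \<le> (\<integral>x. f n x \<partial>M)"
  shows "c \<le> (\<integral>x. F x \<partial>M)"
proof -
  note [measurable] = f F
  have B0: "0 \<le> B" using bd not_empty by (meson all_not_in_conv order_trans)
  have intf: "integrable M (f n)" for n
    using bd by (intro integrable_const_bound[where B=B]) (auto intro!: AE_I2)
  have intF: "integrable M F"
    using F0 by (intro integrable_const_bound[where B=B]) (auto intro!: AE_I2)
  have "ennreal c \<le> limsup (\<lambda>n. \<integral>\<^sup>+x. ennreal (f n x) \<partial>M)"
  proof (rule le_Limsup)
    show "\<forall>\<^sub>F n in sequentially. ennreal c \<le> (\<integral>\<^sup>+x. ennreal (f n x) \<partial>M)"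
      using eventually_ge_at_top[of 1]
    proof eventually_elim
      case (elim n)
      then show ?case using c[of n] bd by (subst nn_integral_eq_integral[OF intf]) (auto intro!: AE_I2 ennreal_leI)
    qed
  qed simp
  also have "\<dots> \<le> (\<integral>\<^sup>+x. limsup (\<lambda>n. ennreal (f n x)) \<partial>M)"
  proof (rule nn_integral_limsup[where w="\<lambda>_. ennreal B"])
    show "AE x in M. ennreal (f n x) \<le> ennreal B" for n
      using bd by (auto intro!: AE_I2 ennreal_leI)
    show "(\<integral>\<^sup>+x. ennreal B \<partial>M) < \<infinity>" by (simp add: emeasure_space_1)
  qed measurable
  also have "\<dots> \<le> (\<integral>\<^sup>+x. ennreal (F x) \<partial>M)"
  proof (rule nn_integral_mono)
    fix x assume x: "x \<in> space M"
    show "limsup (\<lambda>n. ennreal (f n x)) \<le> ennreal (F x)"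
    proof (rule ennreal_le_epsilon)
      fix e :: real assume e: "0 < e"
      have "limsup (\<lambda>n. ereal (f n x)) < ereal (F x + e)" using lim[OF x] e by simp
      then have "\<forall>\<^sub>F n in sequentially. ereal (f n x) < ereal (F x + e)" by (rule Limsup_lessD)
      then have "\<forall>\<^sub>F n in sequentially. ennreal (f n x) \<le> ennreal (F x + e)"
        by eventually_elim (auto intro!: ennreal_leI)
      then have "limsup (\<lambda>n. ennreal (f n x)) \<le> ennreal (F x + e)" by (rule Limsup_bounded)
      then show "limsup (\<lambda>n. ennreal (f n x)) \<le> ennreal (F x) + ennreal e"
        using F0(1)[OF x] e by (simp add: ennreal_plus)
    qed
  qed
  also have "\<dots> = ennreal (\<integral>x. F x \<partial>M)" using F0 by (intro nn_integral_eq_integral intF) (auto intro!: AE_I2)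
  finally show ?thesis
    using F0(1) by (subst (asm) ennreal_le_iff) (auto intro!: integral_nonneg_AE AE_I2)
qed

section \<open>Weak compactness of probability measures on sequence spaces\<close>

lemma continuous_on_finitely_determined:
  fixes X :: "(nat \<Rightarrow> nat) set"
  assumes "\<And>x y. x \<in> X \<Longrightarrow> y \<in> X \<Longrightarrow> (\<forall>i<n. x i = y i) \<Longrightarrow> f x = f y"
  shows "continuous_on X f"
  unfolding continuous_on_topological
proof (intro ballI allI impI)
  fix x B assume x: "x \<in> X" and B: "open B" "f x \<in> B"
  have "open (\<Inter>i<n. (\<lambda>y :: nat \<Rightarrow> nat. y i) -` {x i})"
    by (intro open_INT ballI open_vimage Topological_Spaces.open_discrete) auto
  moreover have "f y \<in> B" if "y \<in> X" "y \<in> (\<Inter>i<n. (\<lambda>y. y i) -` {x i})" for y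
    using assms[OF x that(1)] that(2) B(2) by simp
  ultimately show "\<exists>A. open A \<and> x \<in> A \<and> (\<forall>y\<in>X. y \<in> A \<longrightarrow> f y \<in> B)"
    by (intro exI[of _ "\<Inter>i<n. (\<lambda>y. y i) -` {x i}"]) auto
qed

lemma compact_bounded_sequences:
  fixes X :: "(nat \<Rightarrow> nat) set"
  assumes "closed X" and "\<And>x i. x \<in> X \<Longrightarrow> x i \<le> k"
  shows "compact X"
proof -
  have "compactin (product_topology (\<lambda>_. euclidean) UNIV) (PiE UNIV (\<lambda>_::nat. {..k}))"
    unfolding compactin_PiE by (simp add: finite_imp_compact)
  then have "compact (PiE UNIV (\<lambda>_::nat. {..k}))" by (simp add: euclidean_product_topology)
  moreover have "X = X \<inter> PiE UNIV (\<lambda>_. {..k})" using assms(2) by auto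
  ultimately show ?thesis using assms(1) closed_Int_compact by metis
qed

text \<open>Base-\<open>k + 2\<close> expansion embeds sequences with digits at most \<open>k\<close> into the reals; it reduces weak
  compactness to Helly's selection theorem.\<close>

definition expansion :: "nat \<Rightarrow> (nat \<Rightarrow> nat) \<Rightarrow> real" where
  "expansion k x = (\<Sum>i. real (x i) / (real k + 2) ^ i)"

lemma
  assumes "\<And>i. x i \<le> k"
  shows expansion_summable: "summable (\<lambda>i. real (x i) / (real k + 2) ^ i)"
    and expansion_nonneg: "0 \<le> expansion k x"
    and expansion_less: "expansion k x < real k + 2"
proof -
  have geo: "(\<lambda>i. (1 / (real k + 2)) ^ i) sums (1 / (1 - 1 / (real k + 2)))"
    by (rule geometric_sums) simp
  then have geo': "(\<lambda>i. real k * (1 / (real k + 2)) ^ i) sums (real k * (1 / (1 - 1 / (real k + 2))))"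
    by (rule sums_mult)
  have le: "real (x i) / (real k + 2) ^ i \<le> real k * (1 / (real k + 2)) ^ i" for i
    using assms[of i] by (simp add: power_divide divide_right_mono)
  show s: "summable (\<lambda>i. real (x i) / (real k + 2) ^ i)"
    by (rule summable_comparison_test'[OF sums_summable[OF geo'], of 0]) (use le in auto)
  show "0 \<le> expansion k x" unfolding expansion_def using s by (intro suminf_nonneg) auto
  have "expansion k x \<le> real k * (1 / (1 - 1 / (real k + 2)))"
    unfolding expansion_def sums_unique[OF geo'] using le s sums_summable[OF geo'] by (intro suminf_le) auto
  also have "\<dots> < real k + 2" by (simp add: field_simps)
  finally show "expansion k x < real k + 2" .
qed

lemma expansion_shift:
  assumes "\<And>i. x i \<le> k"
  shows "expansion k x = real (x 0) + expansion k (shift x) / (real k + 2)"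
proof -
  have s: "summable (\<lambda>i. real (shift x i) / (real k + 2) ^ i)"
    by (rule expansion_summable) (simp add: shift_def assms)
  have "expansion k x = real (x 0) + (\<Sum>i. real (shift x i) / (real k + 2) ^ i / (real k + 2))"
    unfolding expansion_def
    using suminf_split_head[OF expansion_summable[of x k, OF assms]] by (simp add: shift_def field_simps)
  also have "(\<Sum>i. real (shift x i) / (real k + 2) ^ i / (real k + 2)) = expansion k (shift x) / (real k + 2)"
    unfolding expansion_def using s by (rule suminf_divide)
  finally show ?thesis .
qed

text \<open>The first digit is the integer part, because the rest of the expansion stays strictly
  below 1; with base \<open>k + 1\<close> it could equal 1 and two sequences could share an
  expansion. Removing the first digit is a shift, and induction gives the others.\<close>

lemma expansion_inj:
  assumes "\<And>i. x i \<le> k" "\<And>i. y i \<le> k" "expansion k x = expansion k y"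
  shows "x = y"
proof
  have head: "x 0 = \<lfloor>expansion k x\<rfloor>" if "\<And>i. x i \<le> k" for x
  proof -
    have "0 \<le> expansion k (shift x)" "expansion k (shift x) < real k + 2"
      by (rule expansion_nonneg expansion_less, simp add: shift_def that)+
    then have "0 \<le> expansion k (shift x) / (real k + 2)" "expansion k (shift x) / (real k + 2) < 1" by auto
    then show ?thesis using expansion_shift[of x k, OF that] by (intro floor_unique[symmetric]) auto
  qed
  fix n show "x n = y n"
    using assms
  proof (induction n arbitrary: x y)
    case 0 then show ?case using head[of x] head[of y] by simp
  next
    case (Suc n)
    have "x 0 = y 0" using Suc.prems head[of x] head[of y] by simp
    then have "expansion k (shift x) / (real k + 2) = expansion k (shift y) / (real k + 2)"
      using expansion_shift[of x k] expansion_shift[of y k] Suc.prems by simp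
    then have "expansion k (shift x) = expansion k (shift y)" by (simp add: add_nonneg_eq_0_iff)
    then have "shift x n = shift y n" using Suc.prems by (intro Suc.IH) (auto simp: shift_def)
    then show ?case by (simp add: shift_def)
  qed
qed

lemma continuous_on_expansion:
  assumes "\<And>x i. x \<in> X \<Longrightarrow> x i \<le> k"
  shows "continuous_on X (expansion k)"
proof (rule uniform_limit_theorem)
  show "uniform_limit X (\<lambda>n x. \<Sum>i<n. real (x i) / (real k + 2) ^ i) (expansion k) sequentially"
    unfolding expansion_def[abs_def]
  proof (rule Weierstrass_m_test)
    show "norm (real (x i) / (real k + 2) ^ i) \<le> real k * (1 / (real k + 2)) ^ i" if "x \<in> X" for i x
      using assms[OF that, of i] by (simp add: power_divide divide_right_mono)
    show "summable (\<lambda>i. real k * (1 / (real k + 2)) ^ i)"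
      by (intro summable_mult summable_geometric) simp
  qed
  show "\<forall>\<^sub>F n in sequentially. continuous_on X (\<lambda>x. \<Sum>i<n. real (x i) / (real k + 2) ^ i)"
  proof (intro always_eventually allI)
    show "continuous_on X (\<lambda>x. \<Sum>i<n. real (x i) / (real k + 2) ^ i)" for n
      by (rule continuous_on_finitely_determined[where n=n]) simp
  qed
qed simp

text \<open>The image \<open>E\<close> of \<open>X\<close> under the expansion is compact, so the
  image measures are tight and Helly's theorem gives a limit on the real line. It remains to see
  that the limit lives on \<open>E\<close>, to carry it back to \<open>X\<close>, and to turn a
  continuous function on \<open>X\<close> into a test function on the line.\<close>

theorem weak_compactness:
  fixes X :: "(nat \<Rightarrow> nat) set"
  assumes X: "closed X" and k: "\<And>x i. x \<in> X \<Longrightarrow> x i \<le> k"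
    and \<nu>: "\<And>n. prob_space (\<nu> n)" "\<And>n. sets (\<nu> n) = sets (borel_on X)"
  obtains r \<mu> where "strict_mono (r :: nat \<Rightarrow> nat)" "prob_space \<mu>" "sets \<mu> = sets (borel_on X)"
    "\<And>f :: (nat \<Rightarrow> nat) \<Rightarrow> real. continuous_on X f \<Longrightarrow> (\<lambda>n. \<integral>x. f x \<partial>\<nu> (r n)) \<longlonglongrightarrow> (\<integral>x. f x \<partial>\<mu>)"
proof -
  let ?e = "expansion k"
  have cX: "compact X" using X k by (rule compact_bounded_sequences)
  have ce: "continuous_on X ?e" using k by (rule continuous_on_expansion)
  have inj: "inj_on ?e X" using k by (intro inj_onI expansion_inj) auto
  define E where "E = ?e ` X"
  have E: "compact E" "closed E" unfolding E_def using compact_continuous_image[OF ce cX] compact_imp_closed by auto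
  define inv where "inv = the_inv_into X ?e"
  have inv: "inv (?e x) = x" if "x \<in> X" for x
    unfolding inv_def using inj that by (rule the_inv_into_f_f)
  have cinv: "continuous_on E inv"
    unfolding E_def inv_def using ce cX inj by (rule continuous_on_inv_into)
  have spX: "space (\<nu> n) = X" for n using sets_eq_imp_space_eq[OF \<nu>(2)] by (simp add: space_restrict_space)
  have Xne: "X \<noteq> {}" using prob_space.not_empty[OF \<nu>(1)] spX by metis
  then obtain x0 where x0: "x0 \<in> X" by blast
  have me: "?e \<in> borel_measurable (\<nu> n)" for n
    using borel_measurable_continuous_on_restrict[OF ce] \<nu>(2) measurable_cong_sets by blast
  define \<kappa> where "\<kappa> n = distr (\<nu> n) borel ?e" for n
  have rd: "real_distribution (\<kappa> n)" for n
    unfolding \<kappa>_def using prob_space.real_distribution_distr[OF \<nu>(1) me] .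
  have intl: "(\<integral>t. g t \<partial>\<kappa> n) = (\<integral>x. g (?e x) \<partial>\<nu> n)" if "continuous_on UNIV g" for g :: "real \<Rightarrow> real" and n
    unfolding \<kappa>_def using me borel_measurable_continuous_onI[OF that] by (rule integral_distr)
  have "tight \<kappa>"
    unfolding tight_def
  proof (intro conjI allI impI)
    fix e :: real assume "0 < e"
    have "measure (\<kappa> n) {-1<..real k + 2} = 1" for n
    proof -
      have "-1 < ?e x \<and> ?e x \<le> real k + 2" if "x \<in> X" for x
        using expansion_nonneg[of x k, OF k[OF that]] expansion_less[of x k, OF k[OF that]] by linarith
      then have "?e -` {-1<..real k + 2} \<inter> X = X" by auto
      then show ?thesis
        unfolding \<kappa>_def using prob_space.prob_space[OF \<nu>(1), of n] by (simp add: measure_distr[OF me] spX)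
    qed
    with \<open>0 < e\<close> show "\<exists>a b. a < b \<and> (\<forall>n. 1 - e < measure (\<kappa> n) {a<..b})"
      by (intro exI[of _ "-1"] exI[of _ "real k + 2"]) auto
  qed (rule rd)
  from tight_imp_convergent_subsubsequence[OF this strict_mono_id]
  obtain r \<Lambda> where r: "strict_mono (r :: nat \<Rightarrow> nat)" and \<Lambda>: "real_distribution \<Lambda>" and conv: "weak_conv_m (\<kappa> \<circ> id \<circ> r) \<Lambda>"
    by blast
  interpret \<Lambda>: real_distribution \<Lambda> by (rule \<Lambda>)
  have lim: "(\<lambda>n. \<integral>x. g (?e x) \<partial>\<nu> (r n)) \<longlonglongrightarrow> (\<integral>t. g t \<partial>\<Lambda>)"
    if g: "continuous_on UNIV g" "\<And>t. norm (g t) \<le> B" for g :: "real \<Rightarrow> real" and B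
  proof -
    have "(\<lambda>n. \<integral>t. g t \<partial>(\<kappa> \<circ> id \<circ> r) n) \<longlonglongrightarrow> (\<integral>t. g t \<partial>\<Lambda>)"
      using rd g by (intro weak_conv_imp_integral_bdd_continuous_conv[OF _ \<Lambda> conv, of g B])
        (auto simp: continuous_on_eq_continuous_at)
    then show ?thesis by (simp add: intl[OF g(1)])
  qed
  \<comment> \<open>A bounded continuous function vanishing exactly on the closed set
    \<open>E\<close>. Its integrals are 0 along the sequence, hence also in the limit, so the limit
    measure is carried by \<open>E\<close>.\<close>
  define d where "d t = min 1 (infdist t E)" for t
  have cd: "continuous_on UNIV d" unfolding d_def[abs_def] by (intro continuous_intros)
  have "(\<lambda>n. \<integral>x. d (?e x) \<partial>\<nu> (r n)) \<longlonglongrightarrow> (\<integral>t. d t \<partial>\<Lambda>)"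
    by (rule lim[OF cd, of 1]) (simp add: d_def infdist_nonneg)
  moreover have "(\<integral>x. d (?e x) \<partial>\<nu> (r n)) = (\<integral>x. 0 \<partial>\<nu> (r n))" for n
    by (rule Bochner_Integration.integral_cong) (auto simp: d_def spX E_def)
  ultimately have "(\<integral>t. d t \<partial>\<Lambda>) = 0" by (simp add: LIMSEQ_const_iff)
  moreover have "integrable \<Lambda> d"
    by (rule \<Lambda>.integrable_const_bound[where B=1])
       (use borel_measurable_continuous_onI[OF cd] in \<open>auto simp: d_def[abs_def] infdist_nonneg\<close>)
  ultimately have "AE t in \<Lambda>. d t = 0"
    by (subst (asm) integral_nonneg_eq_0_iff_AE) (auto simp: d_def infdist_nonneg)
  moreover have "t \<in> E" if "d t = 0" for t
    using that E(2) Xne in_closed_iff_infdist_zero[of E t] by (simp add: d_def min_def E_def split: if_splits)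
  ultimately have AE_E: "AE t in \<Lambda>. t \<in> E" by (rule AE_mp[OF _ AE_I2, rule_format]) auto
  \<comment> \<open>The value \<open>x0\<close> off \<open>E\<close>, a null set for the limit, only
    makes the inverse a measurable map from the whole line into \<open>X\<close>.\<close>
  define p where "p t = (if t \<in> E then inv t else x0)" for t
  have p: "p \<in> measurable \<Lambda> (borel_on X)"
  proof -
    have "p \<in> borel_measurable borel"
      unfolding p_def
    proof (rule measurable_If_restrict_space_iff[THEN iffD2])
      show "inv \<in> measurable (restrict_space borel {t. t \<in> E}) borel \<and>
        (\<lambda>t. x0) \<in> measurable (restrict_space borel {t. t \<notin> E}) borel"
        using borel_measurable_continuous_on_restrict[OF cinv] by simp
    qed (use E in auto)
    moreover have "p t \<in> X" for t using x0 inv by (auto simp: p_def E_def)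
    ultimately have "p \<in> measurable borel (borel_on X)" by (intro measurable_restrict_space2) auto
    then show ?thesis by (simp add: measurable_cong_sets[OF \<Lambda>.events_eq_borel refl])
  qed
  show ?thesis
  proof
    show "strict_mono r" by (rule r)
    show "prob_space (distr \<Lambda> (borel_on X) p)" using p by (rule \<Lambda>.prob_space_distr)
    show "sets (distr \<Lambda> (borel_on X) p) = sets (borel_on X)" by simp
    fix f :: "(nat \<Rightarrow> nat) \<Rightarrow> real" assume f: "continuous_on X f"
    have mf: "f \<in> borel_measurable (borel_on X)" using f by (rule borel_measurable_continuous_on_restrict)
    have "bounded (f ` X)" using compact_continuous_image[OF f cX] by (rule compact_imp_bounded)
    then obtain B where B: "0 < B" "\<And>x. x \<in> X \<Longrightarrow> norm (f x) \<le> B" unfolding bounded_pos by auto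
    have cf: "continuous_on E (\<lambda>t. f (inv t))"
      by (rule continuous_on_compose2[OF f cinv]) (auto simp: E_def inv)
    \<comment> \<open>Weak convergence on the line tests with bounded continuous functions on all of
      it; Tietze's theorem extends \<open>f o inv\<close> from \<open>E\<close> to such a
      function.\<close>
    obtain g where g: "continuous_on UNIV g" "\<And>t. t \<in> E \<Longrightarrow> g t = f (inv t)" "\<And>t. t \<in> UNIV \<Longrightarrow> norm (g t) \<le> B"
      by (rule Tietze[OF cf, of UNIV B]) (use B E in \<open>auto simp: E_def inv\<close>)
    have "(\<lambda>n. \<integral>x. g (?e x) \<partial>\<nu> (r n)) \<longlonglongrightarrow> (\<integral>t. g t \<partial>\<Lambda>)" using g by (intro lim) auto
    moreover have "(\<integral>x. g (?e x) \<partial>\<nu> (r n)) = (\<integral>x. f x \<partial>\<nu> (r n))" for n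
      by (rule Bochner_Integration.integral_cong) (auto simp: spX g E_def inv)
    moreover have "(\<integral>t. g t \<partial>\<Lambda>) = (\<integral>t. f (p t) \<partial>\<Lambda>)"
    proof (rule integral_cong_AE)
      show "AE t in \<Lambda>. g t = f (p t)" using AE_E by eventually_elim (simp add: g p_def)
      show "(\<lambda>t. f (p t)) \<in> borel_measurable \<Lambda>" using measurable_compose[OF p mf] .
      show "g \<in> borel_measurable \<Lambda>" using borel_measurable_continuous_onI[OF g(1)] by simp
    qed
    moreover have "(\<integral>t. f (p t) \<partial>\<Lambda>) = (\<integral>x. f x \<partial>distr \<Lambda> (borel_on X) p)"
      using p mf by (rule integral_distr[symmetric])
    ultimately show "(\<lambda>n. \<integral>x. f x \<partial>\<nu> (r n)) \<longlonglongrightarrow> (\<integral>x. f x \<partial>distr \<Lambda> (borel_on X) p)" by simp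
  qed
qed

section \<open>One-sided subshifts\<close>

definition block :: "nat \<Rightarrow> (nat \<Rightarrow> 'b) \<Rightarrow> 'b list" where
  "block n x = map x [0..<n]"

lemma length_block [simp]: "length (block n x) = n"
  by (simp add: block_def)

lemma block_eq_iff: "block n x = block n y \<longleftrightarrow> (\<forall>i<n. x i = y i)"
  by (auto simp: block_def list_eq_iff_nth_eq)

lemma nth_block: "i < n \<Longrightarrow> block n x ! i = x i"
  by (simp add: block_def)

lemma take_block: "m \<le> n \<Longrightarrow> take m (block n x) = block m x"
  by (simp add: block_def take_map)

lemma funpow_shift: "(shift ^^ n) x = (\<lambda>i. x (i + n))"
proof (induction n arbitrary: x)
  case (Suc n)
  have "(shift ^^ Suc n) x = (shift ^^ n) (shift x)" by (simp only: funpow_Suc_right comp_apply)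
  also have "\<dots> = (\<lambda>i. x (i + Suc n))" by (simp only: Suc) (simp add: shift_def)
  finally show ?case .
qed simp

lemma itinerary_shift: "itinerary shift (\<lambda>x. x 0) n = block n"
  by (rule ext) (simp add: itinerary_def block_def funpow_shift)

lemma block_add: "block (m + n) x = block m x @ block n ((shift ^^ m) x)"
  by (rule nth_equalityI) (auto simp: block_def funpow_shift nth_append add.commute)

lemma block_shift: "block n (shift x) = tl (block (Suc n) x)"
  by (rule nth_equalityI) (auto simp: nth_tl nth_block shift_def)

text \<open>The entropy rate of the partition by the first symbol, as a real number. That partition
  generates the Borel sets, so \<open>measure_entropy_eq\<close> identifies it with the supremum
  over all partitions.\<close>

definition shift_entropy :: "(nat \<Rightarrow> nat) measure \<Rightarrow> real" where
  "shift_entropy \<mu> = entropy_rate \<mu> shift (\<lambda>x. x 0)"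

locale one_sided_subshift =
  fixes k :: nat and X :: "(nat \<Rightarrow> nat) set"
  assumes subshift: "subshift k X"
begin

lemma closed_X: "closed X" and X_nonempty: "X \<noteq> {}"
  and digit: "x \<in> X \<Longrightarrow> x i \<in> {1..k}" and shift_X: "x \<in> X \<Longrightarrow> shift x \<in> X"
  using subshift by (auto simp: subshift_def)

lemma digit_le: "x \<in> X \<Longrightarrow> x i \<le> k"
  using digit[of x i] by simp

lemma funpow_shift_X: "x \<in> X \<Longrightarrow> (shift ^^ n) x \<in> X"
  by (induction n) (auto intro: shift_X)

lemma k_pos: "1 \<le> k"
  using X_nonempty digit by fastforce

lemma compact_X: "compact X"
  using closed_X digit_le by (rule compact_bounded_sequences)

lemma space_eq_X: "sets M = sets (borel_on X) \<Longrightarrow> space M = X"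
  by (drule sets_eq_imp_space_eq) (simp add: space_restrict_space)

definition words :: "nat \<Rightarrow> nat list set" where
  "words n = {w. set w \<subseteq> {1..k} \<and> length w = n}"

lemma finite_words: "finite (words n)" and card_words: "card (words n) = k ^ n"
  by (simp_all add: words_def finite_lists_length_eq card_lists_length_eq)

lemma block_words: "x \<in> X \<Longrightarrow> block n x \<in> words n"
  using digit by (auto simp: words_def block_def)

lemma coordinate_borel:
  assumes "sets M = sets (borel_on X)" shows "(\<lambda>x. x i) \<in> borel_measurable M"
  unfolding measurable_cong_sets[OF assms refl]
  by (intro borel_measurable_continuous_on_restrict continuous_on_finitely_determined[of _ "Suc i"]) auto

lemma coordinate_measurable:
  assumes "sets M = sets (borel_on X)" shows "(\<lambda>x. x i) \<in> measurable M (count_space UNIV)"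
proof -
  have "measurable M (count_space UNIV) = measurable M (borel :: nat measure)"
    by (rule measurable_cong_sets) (simp_all add: sets_borel_eq_count_space)
  then show ?thesis using coordinate_borel[OF assms] by simp
qed

lemma cylinder_measurable: "sets M = sets (borel_on X) \<Longrightarrow> {x \<in> X. block n x = w} \<in> sets M"
proof -
  assume M: "sets M = sets (borel_on X)"
  note [measurable] = coordinate_measurable[OF M]
  have "{x \<in> X. block n x = w} = (if length w = n then {x \<in> space M. \<forall>i\<in>{..<n}. x i = w ! i} else {})"
    using space_eq_X[OF M] by (auto simp: list_eq_iff_nth_eq nth_block)
  also have "\<dots> \<in> sets M" by simp
  finally show ?thesis .
qed

lemma simple_function_block: "sets M = sets (borel_on X) \<Longrightarrow> simple_function M (block n)"
  unfolding simple_function_def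
proof (intro conjI ballI)
  assume M: "sets M = sets (borel_on X)"
  show "finite (block n ` space M)"
    by (rule finite_subset[OF _ finite_words[of n]]) (auto simp: space_eq_X[OF M] block_words)
  have "block n -` {w} \<inter> space M = {x \<in> X. block n x = w}" for w using space_eq_X[OF M] by auto
  then show "block n -` {w} \<inter> space M \<in> sets M" for w using cylinder_measurable[OF M] by simp
qed

lemma block_event_measurable:
  "sets M = sets (borel_on X) \<Longrightarrow> {x \<in> X. P (block n x)} \<in> sets M"
  using simple_function_level_sets[OF simple_function_block, of M P n] space_eq_X by simp

lemma simple_function_determined:
  assumes M: "sets M = sets (borel_on X)"
    and f: "\<And>x y. x \<in> X \<Longrightarrow> y \<in> X \<Longrightarrow> block n x = block n y \<Longrightarrow> f x = f y"
  shows "simple_function M f"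
  by (rule simple_function_refined[OF simple_function_block[OF M, of n]]) (auto simp: space_eq_X[OF M] intro: f)

definition cylinders :: "(nat \<Rightarrow> nat) set set" where
  "cylinders = range (\<lambda>(n, w). {x \<in> X. block n x = w})"

lemma cylindersI: "{x \<in> X. block n x = w} \<in> cylinders"
  unfolding cylinders_def by (rule range_eqI[of _ _ "(n, w)"]) simp

text \<open>The identity is measurable from the cylinder \<sigma>-algebra to the Borel one as soon
  as its coordinates are, and the preimage of a set under a coordinate is a countable union of
  cylinders.\<close>

lemma sets_borel_on_eq: "sets (borel_on X) = sigma_sets X cylinders"
proof
  have sub: "cylinders \<subseteq> Pow X" by (auto simp: cylinders_def)
  let ?M = "sigma X cylinders"
  have coord: "(\<lambda>x. x i) \<in> measurable ?M (count_space UNIV)" for i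
  proof (rule measurableI)
    fix A :: "nat set"
    have "(\<lambda>x. x i) -` A \<inter> space ?M = (\<Union>w\<in>{w. w ! i \<in> A}. {x \<in> X. block (Suc i) x = w})"
      using sub by (auto simp: space_measure_of_conv nth_block)
    moreover have "\<dots> \<in> sets ?M"
    proof (rule sets.countable_UN'')
      show "countable {w :: nat list. w ! i \<in> A}" by simp
      show "{x \<in> X. block (Suc i) x = w} \<in> sets ?M" for w
        using sub cylindersI by (auto simp: sets_measure_of)
    qed
    ultimately show "(\<lambda>x. x i) -` A \<inter> space ?M \<in> sets ?M" by simp
  qed simp
  have "(\<lambda>x. x) \<in> borel_measurable ?M"
    by (rule measurable_coordinatewise_then_product)
       (use coord measurable_cong_sets[of ?M ?M "borel :: nat measure" "count_space UNIV"] in \<open>simp add: sets_borel_eq_count_space\<close>)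
  then have "(\<lambda>x. x) \<in> measurable ?M (borel_on X)"
    using sub by (intro measurable_restrict_space2) (auto simp: space_measure_of_conv)
  from measurable_sets[OF this] show "sets (borel_on X) \<subseteq> sigma_sets X cylinders"
    using sub sets.sets_into_space[of _ "borel_on X"]
    by (auto simp: space_measure_of_conv space_restrict_space sets_measure_of Int_absorb2)
  show "sigma_sets X cylinders \<subseteq> sets (borel_on X)"
  proof -
    have "cylinders \<subseteq> sets (borel_on X)" using cylinder_measurable[OF refl] by (auto simp: cylinders_def)
    from sets.sigma_sets_subset[OF this] show ?thesis by (simp add: space_restrict_space)
  qed
qed

lemma Int_stable_cylinders: "Int_stable cylinders"
proof (rule Int_stableI)
  \<comment> \<open>A block of length 0 is never the one-letter word \<open>[0]\<close>, which
    exhibits the empty set as a cylinder.\<close>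
  have 0: "{} \<in> cylinders" using cylindersI[of 0 "[0]"] by (simp add: block_def)
  have *: "{x \<in> X. block m x = v} \<inter> {x \<in> X. block n x = w} \<in> cylinders" if "m \<le> n" for m n v w
  proof (cases "take m w = v")
    case True
    then have "block m x = v" if "block n x = w" for x :: "nat \<Rightarrow> nat"
      using take_block[OF \<open>m \<le> n\<close>, of x] that by simp
    then have "{x \<in> X. block m x = v} \<inter> {x \<in> X. block n x = w} = {x \<in> X. block n x = w}"
      by blast
    then show ?thesis using cylindersI by simp
  next
    case False
    then have "{x \<in> X. block m x = v} \<inter> {x \<in> X. block n x = w} = {}"
      using take_block[OF that] by auto
    then show ?thesis using 0 by simp
  qed
  fix A B assume "A \<in> cylinders" "B \<in> cylinders"
  then obtain m v n w where "A = {x \<in> X. block m x = v}" "B = {x \<in> X. block n x = w}"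
    by (auto simp: cylinders_def)
  then show "A \<inter> B \<in> cylinders" using *[of m n v w] *[of n m w v] by (cases "m \<le> n") (auto simp: Int_commute)
qed

lemma measure_eqI_cylinders:
  assumes "prob_space M" "sets M = sets (borel_on X)" "prob_space N" "sets N = sets (borel_on X)"
    and eq: "\<And>n w. measure M {x \<in> X. block n x = w} = measure N {x \<in> X. block n x = w}"
  shows "M = N"
proof (rule measure_eqI_generator_eq[OF Int_stable_cylinders])
  interpret M: prob_space M by fact
  interpret N: prob_space N by fact
  show "cylinders \<subseteq> Pow X" by (auto simp: cylinders_def)
  show "sets M = sigma_sets X cylinders" "sets N = sigma_sets X cylinders"
    using assms sets_borel_on_eq by auto
  show "emeasure M A = emeasure N A" if "A \<in> cylinders" for A
    using that eq by (auto simp: cylinders_def M.emeasure_eq_measure N.emeasure_eq_measure)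
  show "range (\<lambda>i. X) \<subseteq> cylinders" using cylindersI[of 0 "[]"] by (auto simp: block_def)
  show "(\<Union>i::nat. X) = X" by simp
  show "emeasure M X \<noteq> \<infinity>" by (simp add: M.emeasure_eq_measure)
qed

lemma shift_measurable: "sets M = sets (borel_on X) \<Longrightarrow> sets N = sets (borel_on X) \<Longrightarrow> shift \<in> measurable M N"
proof -
  assume M: "sets M = sets (borel_on X)" and N: "sets N = sets (borel_on X)"
  have "shift \<in> borel_measurable M"
    unfolding shift_def[abs_def]
    by (rule measurable_coordinatewise_then_product) (rule coordinate_borel[OF M])
  then have "shift \<in> measurable M (borel_on X)"
    by (intro measurable_restrict_space2) (auto simp: space_eq_X[OF M] shift_X)
  then show ?thesis using measurable_cong_sets[OF refl N, of M] by simp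
qed

lemma funpow_shift_measurable:
  assumes "sets M = sets (borel_on X)" shows "shift ^^ n \<in> measurable M M"
proof (induction n)
  case (Suc n) then show ?case
    using measurable_comp[OF Suc shift_measurable[OF assms assms]] by (simp add: comp_def)
qed (simp add: id_def)

lemma invariantD:
  assumes "\<mu> \<in> invariant_measures X"
  shows "prob_space \<mu>" "sets \<mu> = sets (borel_on X)" "space \<mu> = X" "measure_preserving \<mu> shift"
proof -
  show *: "prob_space \<mu>" "sets \<mu> = sets (borel_on X)" using assms by (auto simp: invariant_measures_def)
  then show "space \<mu> = X" using space_eq_X by blast
  show "measure_preserving \<mu> shift"
    using * assms shift_measurable[OF *(2) *(2)]
    by (auto simp: measure_preserving_def measure_preserving_axioms_def invariant_measures_def)
qed

lemma invariantI:
  assumes \<mu>: "prob_space \<mu>" "sets \<mu> = sets (borel_on X)"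
    and inv: "\<And>n w. measure \<mu> {x \<in> X. block n (shift x) = w} = measure \<mu> {x \<in> X. block n x = w}"
  shows "\<mu> \<in> invariant_measures X"
proof -
  interpret prob_space \<mu> by fact
  have m: "shift \<in> measurable \<mu> \<mu>" using shift_measurable[OF \<mu>(2) \<mu>(2)] .
  have "distr \<mu> \<mu> shift = \<mu>"
  proof (rule measure_eqI_cylinders)
    show "prob_space (distr \<mu> \<mu> shift)" using m by (rule prob_space_distr)
    fix n w
    have "shift -` {x \<in> X. block n x = w} \<inter> space \<mu> = {x \<in> X. block n (shift x) = w}"
      using space_eq_X[OF \<mu>(2)] shift_X by auto
    then show "measure (distr \<mu> \<mu> shift) {x \<in> X. block n x = w} = measure \<mu> {x \<in> X. block n x = w}"
      using inv cylinder_measurable[OF \<mu>(2)] by (simp add: measure_distr[OF m])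
  qed (use \<mu> in auto)
  with \<mu> show ?thesis by (simp add: invariant_measures_def)
qed

lemma
  assumes \<mu>: "\<mu> \<in> invariant_measures X"
  shows measure_entropy_eq: "measure_entropy \<mu> shift = ereal (shift_entropy \<mu>)"
    and shift_entropy_tendsto: "(\<lambda>n. fin_entropy \<mu> (block n) / real n) \<longlonglongrightarrow> shift_entropy \<mu>"
    and shift_entropy_le: "\<And>n. 1 \<le> n \<Longrightarrow> shift_entropy \<mu> \<le> fin_entropy \<mu> (block n) / real n"
proof -
  note [simp] = invariantD(3)[OF \<mu>]
  interpret measure_preserving \<mu> shift using invariantD[OF \<mu>] by blast
  have s: "simple_function \<mu> (\<lambda>x. x 0)"
    by (rule simple_function_determined[OF invariantD(2)[OF \<mu>], of 1]) (simp add: block_eq_iff)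
  have "\<exists>N. determined (\<lambda>x. x 0) N B" if "B \<in> cylinders" for B
  proof -
    obtain n w where "B = {x \<in> X. block n x = w}" using \<open>B \<in> cylinders\<close> by (auto simp: cylinders_def)
    then have "determined (\<lambda>x. x 0) n B"
      using cylinder_measurable[OF invariantD(2)[OF \<mu>]] by (auto simp: determined_def itinerary_shift)
    then show ?thesis by blast
  qed
  then show "measure_entropy \<mu> shift = ereal (shift_entropy \<mu>)"
    unfolding shift_entropy_def using invariantD[OF \<mu>] sets_borel_on_eq
    by (intro measure_entropy_generator[OF s]) auto
  show "(\<lambda>n. fin_entropy \<mu> (block n) / real n) \<longlonglongrightarrow> shift_entropy \<mu>"
    "\<And>n. 1 \<le> n \<Longrightarrow> shift_entropy \<mu> \<le> fin_entropy \<mu> (block n) / real n"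
    using entropy_rate_tendsto[OF s] entropy_rate_le[OF s] by (simp_all add: shift_entropy_def itinerary_shift)
qed

lemma fin_entropy_block_le:
  assumes "prob_space \<nu>" "sets \<nu> = sets (borel_on X)"
  shows "fin_entropy \<nu> (block n) \<le> real n * ln (real k)"
proof -
  interpret prob_space \<nu> by fact
  have "fin_entropy \<nu> (block n) \<le> ln (real (card (words n)))"
    using block_words finite_words space_eq_X[OF assms(2)]
    by (intro fin_entropy_le_card simple_function_block assms) auto
  then show ?thesis using k_pos by (simp add: card_words ln_realpow)
qed

text \<open>The index set \<open>words n\<close> does not depend on the measure, as is needed when
  measures are averaged or pass to a limit.\<close>

lemma fin_entropy_words:
  assumes "prob_space \<nu>" "sets \<nu> = sets (borel_on X)" "\<And>x. x \<in> X \<Longrightarrow> g x \<in> X"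
  shows "fin_entropy \<nu> (\<lambda>x. block n (g x))
    = - (\<Sum>w\<in>words n. level_prob \<nu> (\<lambda>x. block n (g x)) w * ln (level_prob \<nu> (\<lambda>x. block n (g x)) w))"
  by (rule fin_entropy_superset[OF finite_words]) (use assms block_words space_eq_X in auto)

end

text \<open>Summing the increments over all \<open>i < n\<close> compares the last \<open>q\<close>
  values of \<open>a\<close> with the first \<open>q\<close>; this takes the place of splitting
  \<open>n\<close> into residue classes modulo \<open>q\<close>. It is applied to block entropies of
  a measure and to the logarithmic counts of words in a fibre.\<close>

lemma telescoping_average:
  fixes a c :: "nat \<Rightarrow> real"
  assumes inc: "\<And>i. a (i + q) \<le> a i + c i" and mono: "mono a"
  shows "real q * a n \<le> (\<Sum>i<n. c i) + (\<Sum>i<q. a i)"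
proof -
  have eq: "(\<Sum>i<n. a (i + q)) + (\<Sum>i<q. a i) = (\<Sum>i<n. a i) + (\<Sum>i<q. a (n + i))"
  proof (induction n)
    case (Suc n)
    have "(\<Sum>i<q. a (n + i)) + a (n + q) = (\<Sum>i<Suc q. a (n + i))" by simp
    also have "\<dots> = a n + (\<Sum>i<q. a (Suc n + i))"
      unfolding sum.lessThan_Suc_shift by simp
    finally show ?case using Suc by simp
  qed simp
  have "real q * a n = (\<Sum>i<q. a n)" by simp
  also have "\<dots> \<le> (\<Sum>i<q. a (n + i))" by (intro sum_mono monoD[OF mono]) simp
  also have "\<dots> = (\<Sum>i<n. a (i + q) - a i) + (\<Sum>i<q. a i)" using eq by (simp add: sum_subtractf)
  also have "(\<Sum>i<n. a (i + q) - a i) \<le> (\<Sum>i<n. c i)"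
    by (intro sum_mono) (use inc in \<open>simp add: diff_le_eq add.commute\<close>)
  finally show ?thesis by simp
qed

section \<open>Orbit averages, their limits, and equilibrium states of continuous functions\<close>

context one_sided_subshift
begin

text \<open>The mean of the images of \<nu> under the first \<open>n\<close> powers of the shift. As
  the law of \<open>x\<close> moved by an independent uniform number of steps it is a probability
  measure at once.\<close>

definition orbit_average :: "nat \<Rightarrow> (nat \<Rightarrow> nat) measure \<Rightarrow> (nat \<Rightarrow> nat) measure" where
  "orbit_average n \<nu> =
     distr (measure_pmf (pmf_of_set {..<n}) \<Otimes>\<^sub>M \<nu>) (borel_on X) (\<lambda>(i, x). (shift ^^ i) x)"

lemma
  assumes \<nu>: "prob_space \<nu>" "sets \<nu> = sets (borel_on X)"
  shows prob_orbit_average: "prob_space (orbit_average n \<nu>)"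
    and sets_orbit_average: "sets (orbit_average n \<nu>) = sets (borel_on X)"
    and measure_orbit_average: "\<And>A. 1 \<le> n \<Longrightarrow> A \<in> sets (borel_on X) \<Longrightarrow>
      measure (orbit_average n \<nu>) A = (\<Sum>i<n. measure \<nu> {x \<in> X. (shift ^^ i) x \<in> A}) / real n"
proof -
  let ?p = "measure_pmf (pmf_of_set {..<n})" and ?f = "\<lambda>(i, x). (shift ^^ i) x"
  interpret \<nu>: prob_space \<nu> by fact
  interpret P: pair_prob_space ?p \<nu> by standard
  have "?f \<in> measurable (count_space UNIV \<Otimes>\<^sub>M \<nu>) (borel_on X)"
    using funpow_shift_measurable[OF \<nu>(2)] measurable_cong_sets[OF refl \<nu>(2), of \<nu>]
    by (intro measurable_pair_measure_countable1) auto
  moreover have "sets (?p \<Otimes>\<^sub>M \<nu>) = sets (count_space UNIV \<Otimes>\<^sub>M \<nu>)"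
    by (intro sets_pair_measure_cong) auto
  ultimately have f: "?f \<in> measurable (?p \<Otimes>\<^sub>M \<nu>) (borel_on X)"
    using measurable_cong_sets[OF _ refl] by blast
  show "prob_space (orbit_average n \<nu>)" unfolding orbit_average_def using f by (rule P.prob_space_distr)
  show "sets (orbit_average n \<nu>) = sets (borel_on X)" by (simp add: orbit_average_def)
  fix A assume n: "1 \<le> n" and A: "A \<in> sets (borel_on X)"
  define S where "S = ?f -` A \<inter> space (?p \<Otimes>\<^sub>M \<nu>)"
  have S: "S \<in> sets (?p \<Otimes>\<^sub>M \<nu>)" unfolding S_def using f A by (rule measurable_sets)
  have "measure (orbit_average n \<nu>) A = measure (?p \<Otimes>\<^sub>M \<nu>) S"
    unfolding orbit_average_def S_def using f A by (rule measure_distr)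
  also have "\<dots> = (\<integral>z. indicator S z \<partial>(?p \<Otimes>\<^sub>M \<nu>))" using S by simp
  also have "\<dots> = (\<integral>i. (\<integral>x. indicator S (i, x) \<partial>\<nu>) \<partial>?p)"
    using S by (intro P.integral_fst'[symmetric] integrable_real_indicator) (auto simp: P.emeasure_eq_measure)
  also have "\<dots> = (\<integral>i. measure \<nu> {x \<in> X. (shift ^^ i) x \<in> A} \<partial>?p)"
  proof (rule Bochner_Integration.integral_cong[OF refl])
    fix i
    have m: "{x \<in> X. (shift ^^ i) x \<in> A} \<in> sets \<nu>"
      using measurable_sets[OF funpow_shift_measurable[OF \<nu>(2), of i], of A] A
      by (simp add: \<nu>(2) vimage_def Int_def space_eq_X[OF \<nu>(2)] conj_commute)
    have "(\<integral>x. indicator S (i, x) \<partial>\<nu>) = (\<integral>x. indicator {x \<in> X. (shift ^^ i) x \<in> A} x \<partial>\<nu>)"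
      by (intro Bochner_Integration.integral_cong)
        (auto simp: S_def space_pair_measure space_eq_X[OF \<nu>(2)] indicator_def)
    also have "\<dots> = measure \<nu> {x \<in> X. (shift ^^ i) x \<in> A}" using m by simp
    finally show "(\<integral>x. indicator S (i, x) \<partial>\<nu>) = measure \<nu> {x \<in> X. (shift ^^ i) x \<in> A}" .
  qed
  also have "\<dots> = (\<Sum>i<n. measure \<nu> {x \<in> X. (shift ^^ i) x \<in> A}) / real n"
    using n by (subst integral_pmf_of_set) (auto simp: lessThan_empty_iff)
  finally show "measure (orbit_average n \<nu>) A = (\<Sum>i<n. measure \<nu> {x \<in> X. (shift ^^ i) x \<in> A}) / real n" .
qed

text \<open>Concavity of entropy: in Gibbs' inequality for each single shift, the averaged law
  \<open>r\<close> is the competing weight, and summing these inequalities reassembles the entropy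
  of \<open>r\<close>.\<close>

lemma fin_entropy_orbit_average:
  assumes \<nu>: "prob_space \<nu>" "sets \<nu> = sets (borel_on X)" and n: "1 \<le> n"
  shows "(\<Sum>i<n. fin_entropy \<nu> (\<lambda>x. block q ((shift ^^ i) x))) \<le> real n * fin_entropy (orbit_average n \<nu>) (block q)"
proof -
  let ?f = "\<lambda>i x. block q ((shift ^^ i) x)"
  note avg = prob_orbit_average[OF \<nu>, of n] sets_orbit_average[OF \<nu>, of n]
  interpret \<nu>: prob_space \<nu> by fact
  have sp: "space \<nu> = X" "space (orbit_average n \<nu>) = X"
    using space_eq_X[OF \<nu>(2)] space_eq_X[OF avg(2)] by auto
  define r where "r = level_prob (orbit_average n \<nu>) (block q)"
  have r: "real n * r w = (\<Sum>i<n. level_prob \<nu> (?f i) w)" for w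
    unfolding r_def level_prob_def sp
    by (subst measure_orbit_average[OF \<nu> n cylinder_measurable[OF refl]])
       (use n funpow_shift_X in \<open>auto intro!: sum.cong arg_cong[of _ _ "measure \<nu>"]\<close>)
  have r0: "0 \<le> r w" for w by (simp add: r_def level_prob_def)
  have s: "simple_function \<nu> (?f i)" for i
    by (rule simple_function_determined[OF \<nu>(2), of "q + i"]) (auto simp: block_eq_iff funpow_shift)
  have sub: "?f i ` space \<nu> \<subseteq> words q" for i using sp funpow_shift_X block_words by auto
  have s': "simple_function (orbit_average n \<nu>) (block q)" using avg(2) by (rule simple_function_block)
  have sumr: "(\<Sum>w\<in>words q. r w) = 1"
  proof -
    have "(\<Sum>w\<in>words q. r w) = (\<Sum>w\<in>block q ` space (orbit_average n \<nu>). r w)"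
      using sp block_words level_prob_eq_0[of _ "block q" "orbit_average n \<nu>"]
      by (intro sum.mono_neutral_right finite_words) (auto simp: r_def)
    then show ?thesis using prob_space.sum_level_prob[OF avg(1) s'] by (simp add: r_def)
  qed
  have each: "fin_entropy \<nu> (?f i) \<le> - (\<Sum>w\<in>words q. level_prob \<nu> (?f i) w * ln (r w))" if i: "i < n" for i
  proof -
    have "(\<Sum>v\<in>{v \<in> ?f i ` space \<nu>. 0 < level_prob \<nu> (?f i) v}. exp (ln (r v)))
        = (\<Sum>v\<in>{v \<in> ?f i ` space \<nu>. 0 < level_prob \<nu> (?f i) v}. r v)"
    proof (intro sum.cong refl exp_ln)
      fix v assume "v \<in> {v \<in> ?f i ` space \<nu>. 0 < level_prob \<nu> (?f i) v}"
      then have "0 < level_prob \<nu> (?f i) v" by simp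
      also have "\<dots> \<le> (\<Sum>i<n. level_prob \<nu> (?f i) v)"
        using i by (intro member_le_sum) (auto simp: \<nu>.level_prob_nonneg)
      finally have "0 < real n * r v" by (simp only: r)
      then show "0 < r v" using n by (simp add: zero_less_mult_iff)
    qed
    also have "\<dots> \<le> (\<Sum>w\<in>words q. r w)"
      using sub r0 by (intro sum_mono2 finite_words) auto
    finally have "fin_entropy \<nu> (?f i) \<le> - (\<integral>x. ln (r (?f i x)) \<partial>\<nu>)"
      using sumr by (intro \<nu>.gibbs_inequality s) simp
    also have "(\<integral>x. ln (r (?f i x)) \<partial>\<nu>) = (\<Sum>w\<in>?f i ` space \<nu>. level_prob \<nu> (?f i) w * ln (r w))"
      by (rule \<nu>.integral_simple_compose[OF s])
    also have "\<dots> = (\<Sum>w\<in>words q. level_prob \<nu> (?f i) w * ln (r w))"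
      by (intro sum.mono_neutral_left finite_words sub) (simp add: level_prob_eq_0)
    finally show ?thesis .
  qed
  have "(\<Sum>i<n. fin_entropy \<nu> (?f i)) \<le> (\<Sum>i<n. - (\<Sum>w\<in>words q. level_prob \<nu> (?f i) w * ln (r w)))"
    using each by (intro sum_mono) auto
  also have "\<dots> = - (\<Sum>w\<in>words q. \<Sum>i<n. level_prob \<nu> (?f i) w * ln (r w))"
    by (simp add: sum_negf sum.swap[of _ "{..<n}"])
  also have "\<dots> = real n * - (\<Sum>w\<in>words q. r w * ln (r w))"
    by (simp add: sum_distrib_right[symmetric] r[symmetric] sum_distrib_left mult.assoc)
  also have "- (\<Sum>w\<in>words q. r w * ln (r w)) = fin_entropy (orbit_average n \<nu>) (block q)"
    using fin_entropy_words[OF avg, of "\<lambda>x. x" q] by (simp add: r_def)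
  finally show ?thesis .
qed

text \<open>Appending \<open>q\<close> symbols adds at most the entropy of the
  \<open>q\<close>-block at that place, so \<open>telescoping_average\<close> applies. The error
  collects the entropies of blocks shorter than \<open>q\<close>, each at most
  \<open>q ln k\<close>.\<close>

lemma fin_entropy_block_average:
  assumes \<nu>: "prob_space \<nu>" "sets \<nu> = sets (borel_on X)" and n: "1 \<le> n"
  shows "real q * fin_entropy \<nu> (block n) \<le> real n * fin_entropy (orbit_average n \<nu>) (block q) + (real q)\<^sup>2 * ln (real k)"
proof -
  interpret \<nu>: prob_space \<nu> by fact
  have sp: "space \<nu> = X" using space_eq_X[OF \<nu>(2)] .
  note s = simple_function_block[OF \<nu>(2)]
  have s': "simple_function \<nu> (\<lambda>x. block q ((shift ^^ i) x))" for i
    by (rule simple_function_determined[OF \<nu>(2), of "q + i"]) (auto simp: block_eq_iff funpow_shift)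
  have "real q * fin_entropy \<nu> (block n)
      \<le> (\<Sum>i<n. fin_entropy \<nu> (\<lambda>x. block q ((shift ^^ i) x))) + (\<Sum>i<q. fin_entropy \<nu> (block i))"
  proof (rule telescoping_average)
    show "mono (\<lambda>i. fin_entropy \<nu> (block i))"
      by (intro monoI \<nu>.fin_entropy_mono[OF s]) (simp add: block_eq_iff)
    fix i
    have "fin_entropy \<nu> (block (i + q)) \<le> fin_entropy \<nu> (\<lambda>x. (block i x, block q ((shift ^^ i) x)))"
      by (rule \<nu>.fin_entropy_mono[OF simple_function_Pair[OF s s']]) (simp add: block_add)
    also have "\<dots> \<le> fin_entropy \<nu> (block i) + fin_entropy \<nu> (\<lambda>x. block q ((shift ^^ i) x))"
      by (rule \<nu>.fin_entropy_Pair_le[OF s s'])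
    finally show "fin_entropy \<nu> (block (i + q)) \<le> fin_entropy \<nu> (block i) + fin_entropy \<nu> (\<lambda>x. block q ((shift ^^ i) x))" .
  qed
  also have "(\<Sum>i<n. fin_entropy \<nu> (\<lambda>x. block q ((shift ^^ i) x))) \<le> real n * fin_entropy (orbit_average n \<nu>) (block q)"
    by (rule fin_entropy_orbit_average[OF \<nu> n])
  also have "(\<Sum>i<q. fin_entropy \<nu> (block i)) \<le> (\<Sum>i<q. real q * ln (real k))"
  proof (rule sum_mono)
    fix i assume "i \<in> {..<q}"
    then have "real i * ln (real k) \<le> real q * ln (real k)" using k_pos by (intro mult_right_mono) auto
    with fin_entropy_block_le[OF \<nu>, of i] show "fin_entropy \<nu> (block i) \<le> real q * ln (real k)" by linarith
  qed
  also have "\<dots> = (real q)\<^sup>2 * ln (real k)" by (simp add: power2_eq_square)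
  finally show ?thesis by simp
qed

lemma tendsto_fin_entropy_block:
  assumes M: "\<And>j. prob_space (M j)" "\<And>j. sets (M j) = sets (borel_on X)"
    and \<mu>: "prob_space \<mu>" "sets \<mu> = sets (borel_on X)"
    and lim: "\<And>w. (\<lambda>j. measure (M j) {x \<in> X. block q x = w}) \<longlonglongrightarrow> measure \<mu> {x \<in> X. block q x = w}"
  shows "(\<lambda>j. fin_entropy (M j) (block q)) \<longlonglongrightarrow> fin_entropy \<mu> (block q)"
proof -
  have eq: "fin_entropy N (block q) = - (\<Sum>w\<in>words q. measure N {x \<in> X. block q x = w} * ln (measure N {x \<in> X. block q x = w}))"
    if "prob_space N" "sets N = sets (borel_on X)" for N
    using fin_entropy_words[OF that, of "\<lambda>x. x" q] by (simp add: level_prob_def space_eq_X[OF that(2)])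
  show ?thesis
    unfolding eq[OF M] eq[OF \<mu>]
    by (intro tendsto_minus tendsto_sum continuous_on_tendsto_compose[OF continuous_on_x_ln_x lim]) auto
qed

text \<open>Indicators of block events are continuous on \<open>X\<close>, so weak convergence
  includes convergence of the measures of all block events.\<close>

lemma weak_compactness_blocks:
  assumes M: "\<And>j. prob_space (M j)" "\<And>j. sets (M j) = sets (borel_on X)"
  obtains r \<mu> where "strict_mono (r :: nat \<Rightarrow> nat)" "prob_space \<mu>" "sets \<mu> = sets (borel_on X)"
    "\<And>f :: (nat \<Rightarrow> nat) \<Rightarrow> real. continuous_on X f \<Longrightarrow> (\<lambda>j. \<integral>x. f x \<partial>M (r j)) \<longlonglongrightarrow> (\<integral>x. f x \<partial>\<mu>)"
    "\<And>n P. (\<lambda>j. measure (M (r j)) {x \<in> X. P (block n x)}) \<longlonglongrightarrow> measure \<mu> {x \<in> X. P (block n x)}"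
proof -
  obtain r \<mu> where r: "strict_mono (r :: nat \<Rightarrow> nat)" "prob_space \<mu>" "sets \<mu> = sets (borel_on X)"
    "\<And>f :: (nat \<Rightarrow> nat) \<Rightarrow> real. continuous_on X f \<Longrightarrow> (\<lambda>j. \<integral>x. f x \<partial>M (r j)) \<longlonglongrightarrow> (\<integral>x. f x \<partial>\<mu>)"
    by (rule weak_compactness[where X=X and k=k and \<nu>=M, OF closed_X _ M], erule digit_le) (rule that)
  have "(\<lambda>j. measure (M (r j)) {x \<in> X. P (block n x)}) \<longlonglongrightarrow> measure \<mu> {x \<in> X. P (block n x)}" for n P
  proof -
    let ?A = "{x \<in> X. P (block n x)}"
    have "continuous_on X (indicator ?A :: _ \<Rightarrow> real)"
    proof (rule continuous_on_finitely_determined[where n=n])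
      fix x y assume "x \<in> X" "y \<in> X" "\<forall>i<n. x i = y i"
      moreover from this(3) have "block n x = block n y" by (simp add: block_eq_iff)
      ultimately show "indicator ?A x = (indicator ?A y :: real)" by (simp add: indicator_def)
    qed
    from r(4)[OF this] show ?thesis
      using block_event_measurable[OF M(2), of P n] block_event_measurable[OF r(3), of P n] by simp
  qed
  with r show ?thesis by (rule that)
qed

text \<open>The Krylov--Bogoliubov construction, with Misiurewicz' entropy estimate for the limit.\<close>

theorem limit_of_orbit_averages:
  assumes \<nu>: "\<And>j. prob_space (\<nu> j)" "\<And>j. sets (\<nu> j) = sets (borel_on X)"
  obtains r \<mu> where "strict_mono (r :: nat \<Rightarrow> nat)" "\<mu> \<in> invariant_measures X"
    "\<And>n P. (\<lambda>j. measure (orbit_average (Suc (r j)) (\<nu> (r j))) {x \<in> X. P (block n x)})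
      \<longlonglongrightarrow> measure \<mu> {x \<in> X. P (block n x)}"
    "\<forall>c. (\<forall>j. c * real (Suc j) \<le> fin_entropy (\<nu> j) (block (Suc j))) \<longrightarrow> c \<le> shift_entropy \<mu>"
proof -
  \<comment> \<open>\<open>Suc j\<close> in place of \<open>j\<close> avoids an average over no
    shifts.\<close>
  let ?M = "\<lambda>j. orbit_average (Suc j) (\<nu> j)"
  have M: "prob_space (?M j)" "sets (?M j) = sets (borel_on X)" for j
    using prob_orbit_average[OF \<nu>] sets_orbit_average[OF \<nu>] by auto
  obtain r \<mu> where r: "strict_mono (r :: nat \<Rightarrow> nat)" and \<mu>: "prob_space \<mu>" "sets \<mu> = sets (borel_on X)"
    and lim: "\<And>n P. (\<lambda>j. measure (?M (r j)) {x \<in> X. P (block n x)}) \<longlonglongrightarrow> measure \<mu> {x \<in> X. P (block n x)}"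
    by (rule weak_compactness_blocks[of ?M, OF M]) (rule that)
  have inv_n: "(\<lambda>j. 1 / real (Suc (r j))) \<longlonglongrightarrow> 0"
    using LIMSEQ_subseq_LIMSEQ[OF LIMSEQ_Suc[OF lim_const_over_n[of 1]] r] by (simp add: comp_def)
  have "\<mu> \<in> invariant_measures X"
  proof (rule invariantI[OF \<mu>])
    fix n w
    let ?A = "{x \<in> X. block n x = w}" and ?B = "{x \<in> X. block n (shift x) = w}"
    have AB: "?A \<in> sets (borel_on X)" "?B \<in> sets (borel_on X)"
      using cylinder_measurable[OF refl] block_event_measurable[OF refl, of "\<lambda>v. tl v = w" "Suc n"]
      by (auto simp: block_shift)
    \<comment> \<open>One more shift changes a mean of \<open>Suc j\<close> terms only in its first
      and last term, hence by at most \<open>1 / Suc j\<close>.\<close>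
    have diff: "\<bar>measure (?M j) ?B - measure (?M j) ?A\<bar> \<le> 1 / real (Suc j)" for j
    proof -
      interpret prob_space "\<nu> j" using \<nu> by blast
      define t where "t i = measure (\<nu> j) {x \<in> X. (shift ^^ i) x \<in> ?A}" for i
      have "{x \<in> X. (shift ^^ i) x \<in> ?B} = {x \<in> X. (shift ^^ Suc i) x \<in> ?A}" for i
        using funpow_shift_X shift_X by auto
      then have "measure (?M j) ?B = (\<Sum>i<Suc j. t (Suc i)) / real (Suc j)"
        using measure_orbit_average[OF \<nu> _ AB(2), of "Suc j" j] by (simp only: t_def)
      moreover have "measure (?M j) ?A = (\<Sum>i<Suc j. t i) / real (Suc j)"
        using measure_orbit_average[OF \<nu> _ AB(1), of "Suc j" j] by (simp only: t_def)
      moreover have "(\<Sum>i<Suc j. t (Suc i)) - (\<Sum>i<Suc j. t i) = t (Suc j) - t 0"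
        by (simp only: sum_subtractf[symmetric] sum_lessThan_telescope)
      ultimately have "measure (?M j) ?B - measure (?M j) ?A = (t (Suc j) - t 0) / real (Suc j)"
        by (simp only: diff_divide_distrib[symmetric])
      moreover have "0 \<le> t i" "t i \<le> 1" for i by (simp_all add: t_def)
      then have "\<bar>t (Suc j) - t 0\<bar> \<le> 1" by (smt (verit))
      ultimately show ?thesis by (simp add: divide_right_mono)
    qed
    have to_0: "(\<lambda>j. measure (?M (r j)) ?B - measure (?M (r j)) ?A) \<longlonglongrightarrow> 0"
      by (rule Lim_null_comparison[OF _ inv_n]) (use diff in auto)
    have "(\<lambda>j. measure (?M (r j)) ?B - measure (?M (r j)) ?A) \<longlonglongrightarrow> measure \<mu> ?B - measure \<mu> ?A"
      unfolding block_shift by (intro tendsto_diff lim)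
    from LIMSEQ_unique[OF to_0 this] show "measure \<mu> ?B = measure \<mu> ?A" by simp
  qed
  moreover have "c \<le> shift_entropy \<mu>" if c: "\<And>j. c * real (Suc j) \<le> fin_entropy (\<nu> j) (block (Suc j))" for c
  proof (rule LIMSEQ_le_const[OF shift_entropy_tendsto[OF \<open>\<mu> \<in> invariant_measures X\<close>]])
    \<comment> \<open>The block length \<open>q\<close> is fixed while the measures converge, since
      only the entropy of a fixed block is continuous in the measure; \<open>q\<close> goes to
      infinity afterwards.\<close>
    have "c \<le> fin_entropy \<mu> (block q) / real q" if q: "1 \<le> q" for q
    proof -
      have bound: "real q * c \<le> fin_entropy (?M j) (block q) + (real q)\<^sup>2 * ln (real k) * (1 / real (Suc j))" for j
      proof -
        have "real q * (c * real (Suc j)) \<le> real q * fin_entropy (\<nu> j) (block (Suc j))"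
          using c by (intro mult_left_mono) auto
        also have "\<dots> \<le> real (Suc j) * fin_entropy (?M j) (block q) + (real q)\<^sup>2 * ln (real k)"
          by (intro fin_entropy_block_average \<nu>) simp
        finally show ?thesis by (simp add: field_simps)
      qed
      have "(\<lambda>j. fin_entropy (?M (r j)) (block q) + (real q)\<^sup>2 * ln (real k) * (1 / real (Suc (r j))))
          \<longlonglongrightarrow> fin_entropy \<mu> (block q) + (real q)\<^sup>2 * ln (real k) * 0"
        by (intro tendsto_add tendsto_mult tendsto_const inv_n tendsto_fin_entropy_block M \<mu> lim)
      then have "real q * c \<le> fin_entropy \<mu> (block q) + (real q)\<^sup>2 * ln (real k) * 0"
        by (rule LIMSEQ_le_const) (use bound in blast)
      with q show ?thesis by (simp add: field_simps)
    qed
    then show "\<exists>N. \<forall>n\<ge>N. c \<le> fin_entropy \<mu> (block n) / real n" by blast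
  qed
  ultimately show ?thesis using r lim that by blast
qed

lemma invariant_measures_nonempty: "invariant_measures X \<noteq> {}"
proof -
  obtain x where x: "x \<in> X" using X_nonempty by blast
  have "prob_space (return (borel_on X) x)" using x by (intro prob_space_return) (simp add: space_restrict_space)
  then show ?thesis using limit_of_orbit_averages[of "\<lambda>_. return (borel_on X) x"] by (metis empty_iff sets_return)
qed

text \<open>Entropy is upper semicontinuous here: it is a lower bound for every
  \<open>fin_entropy \<mu> (block q) / q\<close>, each of them continuous in \<mu>, and it is also
  their limit. A weak limit of measures whose free energies increase to the pressure therefore
  attains it.\<close>

theorem equilibrium_states_nonempty:
  assumes \<phi>: "continuous_on X \<phi>"
  shows "equilibrium_states X \<phi> \<noteq> {}"
proof -
  define E where "E \<mu> = shift_entropy \<mu> + (\<integral>x. \<phi> x \<partial>\<mu>)" for \<mu>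
  have E: "free_energy \<phi> \<mu> = ereal (E \<mu>)" if "\<mu> \<in> invariant_measures X" for \<mu>
    using measure_entropy_eq[OF that] by (simp add: free_energy_def E_def)
  have ne: "free_energy \<phi> ` invariant_measures X \<noteq> {}" using invariant_measures_nonempty by simp
  obtain u where u: "incseq u" "range u \<subseteq> free_energy \<phi> ` invariant_measures X"
    "variational_pressure X \<phi> = (SUP i. u i)"
    unfolding variational_pressure_def using Sup_countable_SUP[OF ne] by metis
  have "\<forall>i. \<exists>m. m \<in> invariant_measures X \<and> u i = free_energy \<phi> m" using u(2) by blast
  from choice[OF this] obtain m where m: "\<And>i. m i \<in> invariant_measures X" "\<And>i. u i = free_energy \<phi> (m i)" by blast
  note pm = invariantD[OF m(1)]
  obtain r \<mu> where r: "strict_mono (r :: nat \<Rightarrow> nat)" and \<mu>: "prob_space \<mu>" "sets \<mu> = sets (borel_on X)"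
    and limf: "\<And>f :: (nat \<Rightarrow> nat) \<Rightarrow> real. continuous_on X f \<Longrightarrow> (\<lambda>j. \<integral>x. f x \<partial>m (r j)) \<longlonglongrightarrow> (\<integral>x. f x \<partial>\<mu>)"
    and lim: "\<And>n P. (\<lambda>j. measure (m (r j)) {x \<in> X. P (block n x)}) \<longlonglongrightarrow> measure \<mu> {x \<in> X. P (block n x)}"
    by (rule weak_compactness_blocks[of m, OF pm(1,2)]) (rule that)
  have inv: "\<mu> \<in> invariant_measures X"
  proof (rule invariantI[OF \<mu>])
    fix n w
    let ?A = "{x \<in> X. block n x = w}" and ?B = "{x \<in> X. block n (shift x) = w}"
    have to_B: "(\<lambda>j. measure (m (r j)) ?B) \<longlonglongrightarrow> measure \<mu> ?B"
      unfolding block_shift by (rule lim)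
    have "measure (m j) ?B = measure (m j) ?A" for j
    proof -
      have d: "distr (m j) (m j) shift = m j" using m(1) by (simp add: invariant_measures_def)
      have "measure (distr (m j) (m j) shift) ?A = measure (m j) (shift -` ?A \<inter> space (m j))"
        using shift_measurable[OF pm(2) pm(2)] cylinder_measurable[OF pm(2)] by (rule measure_distr)
      moreover have "shift -` ?A \<inter> space (m j) = ?B" using pm(3)[of j] shift_X by auto
      ultimately show ?thesis using d by simp
    qed
    with to_B lim[of "\<lambda>v. v = w" n] show "measure \<mu> ?B = measure \<mu> ?A"
      by (simp add: LIMSEQ_unique)
  qed
  have lim_u: "(\<lambda>j. u (r j)) \<longlonglongrightarrow> variational_pressure X \<phi>"
    using LIMSEQ_subseq_LIMSEQ[OF LIMSEQ_SUP[OF u(1)] r] by (simp add: u(3) comp_def)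
  \<comment> \<open>Bounding the entropies by those of \<open>q\<close>-blocks before the limit in
    \<open>j\<close> makes both terms converge.\<close>
  have le_q: "variational_pressure X \<phi> \<le> ereal (fin_entropy \<mu> (block q) / real q + (\<integral>x. \<phi> x \<partial>\<mu>))" if q: "1 \<le> q" for q
  proof (rule LIMSEQ_le[OF lim_u])
    show "(\<lambda>j. ereal (fin_entropy (m (r j)) (block q) / real q + (\<integral>x. \<phi> x \<partial>m (r j))))
        \<longlonglongrightarrow> ereal (fin_entropy \<mu> (block q) / real q + (\<integral>x. \<phi> x \<partial>\<mu>))"
      using q by (intro tendsto_ereal tendsto_add tendsto_divide tendsto_const limf \<phi> tendsto_fin_entropy_block pm \<mu> lim) auto
    show "\<exists>N. \<forall>j\<ge>N. u (r j) \<le> ereal (fin_entropy (m (r j)) (block q) / real q + (\<integral>x. \<phi> x \<partial>m (r j)))"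
      using shift_entropy_le[OF m(1) q] by (auto simp: m(2) E[OF m(1)] E_def)
  qed
  have "variational_pressure X \<phi> \<le> ereal (E \<mu>)"
  proof (rule LIMSEQ_le_const)
    show "(\<lambda>q. ereal (fin_entropy \<mu> (block q) / real q + (\<integral>x. \<phi> x \<partial>\<mu>))) \<longlonglongrightarrow> ereal (E \<mu>)"
      unfolding E_def by (intro tendsto_ereal tendsto_add tendsto_const shift_entropy_tendsto inv)
    show "\<exists>N. \<forall>q\<ge>N. variational_pressure X \<phi> \<le> ereal (fin_entropy \<mu> (block q) / real q + (\<integral>x. \<phi> x \<partial>\<mu>))"
      using le_q by blast
  qed
  moreover have "ereal (E \<mu>) \<le> variational_pressure X \<phi>"
    unfolding variational_pressure_def E[OF inv, symmetric] using inv by (rule SUP_upper)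
  ultimately have "\<mu> \<in> equilibrium_states X \<phi>" using inv E[OF inv] by (simp add: equilibrium_states_def)
  then show ?thesis by blast
qed

end

section \<open>Fibres of a one-block factor map\<close>

locale one_block_factor =
  X: one_sided_subshift k X + Y: one_sided_subshift l Y for k X l Y +
  fixes \<pi> :: "(nat \<Rightarrow> nat) \<Rightarrow> (nat \<Rightarrow> nat)"
  assumes factor: "factor_map X Y \<pi>" and one_block: "one_block X \<pi>"
begin

lemma continuous_\<pi>: "continuous_on X \<pi>" and image_\<pi>: "\<pi> ` X = Y"
  and \<pi>_shift: "x \<in> X \<Longrightarrow> \<pi> (shift x) = shift (\<pi> x)"
  using factor by (auto simp: factor_map_def)

lemma \<pi>_Y: "x \<in> X \<Longrightarrow> \<pi> x \<in> Y"
  using image_\<pi> by auto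

lemma \<pi>_funpow_shift: "x \<in> X \<Longrightarrow> \<pi> ((shift ^^ n) x) = (shift ^^ n) (\<pi> x)"
  by (induction n) (simp_all add: \<pi>_shift X.funpow_shift_X)

lemma block_\<pi>_cong:
  assumes "x \<in> X" "y \<in> X" "block n x = block n y" shows "block n (\<pi> x) = block n (\<pi> y)"
proof -
  have "\<pi> x i = \<pi> y i" if "i < n" for i
  proof -
    obtain p where "\<forall>x\<in>X. \<pi> x i = p (x i)" using one_block by (auto simp: one_block_def)
    with assms that show ?thesis by (simp add: block_eq_iff)
  qed
  then show ?thesis by (simp add: block_eq_iff)
qed

lemma block_\<pi>_mono:
  assumes "x \<in> X" "y \<in> X" "block n x = block n y" "m \<le> n" shows "block m (\<pi> x) = block m (\<pi> y)"
  using block_\<pi>_cong[OF assms(1-3)] assms(4) by (auto simp: block_eq_iff)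

section \<open>Words over points and over cylinders of \<open>Y\<close>\<close>

definition fibre_words :: "nat \<Rightarrow> (nat \<Rightarrow> nat) \<Rightarrow> nat list set" where
  "fibre_words n y = block n ` {x \<in> X. \<pi> x = y}"

text \<open>An outer approximation of \<open>fibre_words n y\<close>, obtained by knowing only the
  first \<open>i\<close> symbols of \<open>y\<close>. Being constant on cylinders of
  \<open>Y\<close>, it depends measurably on the point and combines with entropies of finite
  blocks.\<close>

definition approx_words :: "nat \<Rightarrow> nat \<Rightarrow> nat list \<Rightarrow> nat list set" where
  "approx_words n i w = block n ` {x \<in> X. block i (\<pi> x) = w}"

lemma fibre_words_subset: "fibre_words n y \<subseteq> X.words n"
  and approx_words_subset: "approx_words n i w \<subseteq> X.words n"
  by (auto simp: fibre_words_def approx_words_def X.block_words)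

lemma finite_fibre_words: "finite (fibre_words n y)" and finite_approx_words: "finite (approx_words n i w)"
  using fibre_words_subset approx_words_subset X.finite_words finite_subset by metis+

lemma fibre_words_nonempty: "y \<in> Y \<Longrightarrow> fibre_words n y \<noteq> {}"
  using image_\<pi> by (auto simp: fibre_words_def)

lemma fibre_words_approx: "fibre_words n y \<subseteq> approx_words n i (block i y)"
  by (auto simp: fibre_words_def approx_words_def)

lemma card_fibre_words_ge_1: "y \<in> Y \<Longrightarrow> 1 \<le> card (fibre_words n y)"
  using fibre_words_nonempty[of y n] finite_fibre_words[of n y] by (simp add: Suc_le_eq card_gt_0_iff)

lemma card_fibre_words_le_approx: "card (fibre_words n y) \<le> card (approx_words n i (block i y))"
  by (intro card_mono finite_approx_words fibre_words_approx)

lemma card_approx_words_le: "card (approx_words n i w) \<le> k ^ n"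
  using card_mono[OF X.finite_words approx_words_subset] by (simp add: X.card_words)

text \<open>Compactness: the sets \<open>G i\<close> of points that show \<open>u\<close> and lie
  over the \<open>i\<close>-cylinder of \<open>y\<close> are closed, nonempty and decreasing, and a
  common point lies over \<open>y\<close> itself.\<close>

lemma approx_words_limit:
  assumes u: "\<And>i. u \<in> approx_words n i (block i y)"
  shows "u \<in> fibre_words n y"
proof -
  define G where "G i = {x \<in> X. block n x = u \<and> block i (\<pi> x) = block i y}" for i
  have G_nonempty: "G i \<noteq> {}" for i using u[of i] by (auto simp: G_def approx_words_def)
  have G_mono: "G j \<subseteq> G i" if "i \<le> j" for i j
    using that by (auto simp: G_def block_eq_iff)
  have closed_G: "closed (G i)" for i
  proof -
    have c: "continuous_on X (indicator (G i) :: _ \<Rightarrow> real)"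
    proof (rule continuous_on_finitely_determined[where n="max n i"])
      fix x z assume xz: "x \<in> X" "z \<in> X" "\<forall>j<max n i. x j = z j"
      then have "block (max n i) x = block (max n i) z" "block n x = block n z" by (auto simp: block_eq_iff)
      moreover from block_\<pi>_mono[OF xz(1,2) this(1), of i] have "block i (\<pi> x) = block i (\<pi> z)" by simp
      ultimately show "indicator (G i) x = (indicator (G i) z :: real)" using xz by (simp add: indicator_def G_def)
    qed
    have "closed (X \<inter> indicator (G i) -` {1 :: real})"
      by (rule continuous_closed_preimage[OF c X.closed_X]) simp
    moreover have "X \<inter> indicator (G i) -` {1 :: real} = G i" by (auto simp: G_def indicator_def)
    ultimately show ?thesis by simp
  qed
  have "X \<inter> \<Inter> (range G) \<noteq> {}"
  proof (rule compact_imp_fip[OF X.compact_X])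
    show "closed T" if "T \<in> range G" for T using that closed_G by auto
    fix F' assume F': "finite F'" "F' \<subseteq> range G"
    obtain I where I: "finite I" "F' = G ` I" using finite_subset_image[OF F'] by blast
    define j where "j = (if I = {} then 0 else Max I)"
    have "G j \<subseteq> G i" if "i \<in> I" for i
      using that I(1) by (intro G_mono) (auto simp: j_def)
    then have "G j \<subseteq> X \<inter> \<Inter> F'" unfolding I(2) by (auto simp: G_def)
    with G_nonempty[of j] show "X \<inter> \<Inter> F' \<noteq> {}" by blast
  qed
  then obtain x where x: "x \<in> X" "\<And>i. x \<in> G i" by auto
  have "\<pi> x = y"
  proof
    fix i
    have "block (Suc i) (\<pi> x) = block (Suc i) y" using x(2)[of "Suc i"] by (simp add: G_def)
    then show "\<pi> x i = y i" by (simp add: block_eq_iff)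
  qed
  moreover have "block n x = u" using x(2)[of 0] by (simp add: G_def)
  ultimately show ?thesis using x(1) by (auto simp: fibre_words_def)
qed

text \<open>Each of the finitely many words outside the fibre drops out at some cylinder length and,
  the approximations being decreasing, never returns.\<close>

lemma eventually_approx_words:
  "\<forall>\<^sub>F i in sequentially. approx_words n i (block i y) = fibre_words n y"
proof -
  have "\<forall>\<^sub>F i in sequentially. \<forall>u\<in>X.words n - fibre_words n y. u \<notin> approx_words n i (block i y)"
  proof (rule eventually_ball_finite)
    show "finite (X.words n - fibre_words n y)" using X.finite_words by simp
    show "\<forall>u\<in>X.words n - fibre_words n y. \<forall>\<^sub>F i in sequentially. u \<notin> approx_words n i (block i y)"
    proof
      fix u assume "u \<in> X.words n - fibre_words n y"
      then obtain i where "u \<notin> approx_words n i (block i y)" using approx_words_limit[of u n y] by blast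
      moreover have "approx_words n j (block j y) \<subseteq> approx_words n i (block i y)" if "i \<le> j" for j
        using that by (auto simp: approx_words_def block_eq_iff intro!: imageI)
      ultimately show "\<forall>\<^sub>F i in sequentially. u \<notin> approx_words n i (block i y)"
        unfolding eventually_sequentially by blast
    qed
  qed
  then show ?thesis
    by eventually_elim (use approx_words_subset fibre_words_approx in blast)
qed

definition fibre_log :: "nat \<Rightarrow> (nat \<Rightarrow> nat) \<Rightarrow> real" where
  "fibre_log n y = ln (real (card (fibre_words n y)))"

definition approx_log :: "nat \<Rightarrow> nat \<Rightarrow> (nat \<Rightarrow> nat) \<Rightarrow> real" where
  "approx_log n i y = ln (real (card (approx_words n i (block i y))))"

lemma k_pos: "1 \<le> k" by (rule X.k_pos)

lemma ln_k_nonneg: "0 \<le> ln (real k)" using k_pos by simp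

lemma
  assumes y: "y \<in> Y"
  shows fibre_log_nonneg: "0 \<le> fibre_log n y" and fibre_log_le: "fibre_log n y \<le> real n * ln (real k)"
    and approx_log_nonneg: "0 \<le> approx_log n i y" and approx_log_le: "approx_log n i y \<le> real n * ln (real k)"
    and fibre_log_le_approx_log: "fibre_log n y \<le> approx_log n i y"
proof -
  have c: "1 \<le> card (fibre_words n y)" "card (fibre_words n y) \<le> card (approx_words n i (block i y))"
    "card (approx_words n i (block i y)) \<le> k ^ n"
    using card_fibre_words_ge_1[OF y] card_fibre_words_le_approx card_approx_words_le by auto
  show 1: "0 \<le> fibre_log n y" "fibre_log n y \<le> approx_log n i y" using c by (auto simp: fibre_log_def approx_log_def)
  have "ln (real (card (approx_words n i (block i y)))) \<le> ln (real (k ^ n))"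
    using c k_pos by (subst ln_le_cancel_iff) (auto simp flip: of_nat_power)
  also have "\<dots> = real n * ln (real k)" using k_pos by (simp add: ln_realpow)
  finally show 2: "approx_log n i y \<le> real n * ln (real k)" by (simp add: approx_log_def)
  show "0 \<le> approx_log n i y" "fibre_log n y \<le> real n * ln (real k)" using 1 2 by auto
qed

lemma approx_log_tendsto: "(\<lambda>i. approx_log n i y) \<longlonglongrightarrow> fibre_log n y"
proof (rule tendsto_eventually)
  show "\<forall>\<^sub>F i in sequentially. approx_log n i y = fibre_log n y"
    using eventually_approx_words[of n y] by eventually_elim (simp add: approx_log_def fibre_log_def)
qed

lemma approx_log_measurable: "sets M = sets (borel_on Y) \<Longrightarrow> approx_log n i \<in> borel_measurable M"
proof -
  assume M: "sets M = sets (borel_on Y)"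
  have "continuous_on Y (approx_log n i)"
  proof (rule continuous_on_finitely_determined[where n=i])
    fix x y :: "nat \<Rightarrow> nat" assume "\<forall>j<i. x j = y j"
    then have "block i x = block i y" by (simp add: block_eq_iff)
    then show "approx_log n i x = approx_log n i y" by (simp add: approx_log_def)
  qed
  then show ?thesis
    unfolding measurable_cong_sets[OF M refl] by (rule borel_measurable_continuous_on_restrict)
qed

lemma fibre_log_measurable: "sets M = sets (borel_on Y) \<Longrightarrow> fibre_log n \<in> borel_measurable M"
  by (rule borel_measurable_LIMSEQ_real[OF approx_log_tendsto approx_log_measurable])

lemma fibre_log_mono: "y \<in> Y \<Longrightarrow> mono (\<lambda>n. fibre_log n y)"
proof (rule monoI)
  fix m n :: nat assume y: "y \<in> Y" and mn: "m \<le> n"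
  have "fibre_words m y = take m ` fibre_words n y"
    unfolding fibre_words_def image_image take_block[OF mn] ..
  then have "card (fibre_words m y) \<le> card (fibre_words n y)"
    using card_image_le[OF finite_fibre_words] by simp
  then show "fibre_log m y \<le> fibre_log n y"
    using card_fibre_words_ge_1[OF y, of m] by (simp add: fibre_log_def)
qed

text \<open>Cutting a word over \<open>y\<close> after \<open>m\<close> symbols leaves a word over
  \<open>y\<close> and one over \<open>(shift ^^ m) y\<close>. This is only an inclusion, since two
  such words need not fit together.\<close>

lemma fibre_log_subadditive:
  assumes y: "y \<in> Y"
  shows "fibre_log (m + n) y \<le> fibre_log m y + fibre_log n ((shift ^^ m) y)"
proof -
  have sy: "(shift ^^ m) y \<in> Y" using Y.funpow_shift_X[OF y] .
  have "fibre_words (m + n) y \<subseteq> (\<lambda>(u, v). u @ v) ` (fibre_words m y \<times> fibre_words n ((shift ^^ m) y))"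
  proof
    fix w assume "w \<in> fibre_words (m + n) y"
    then obtain x where x: "x \<in> X" "\<pi> x = y" "w = block (m + n) x" by (auto simp: fibre_words_def)
    then have "block m x \<in> fibre_words m y" "block n ((shift ^^ m) x) \<in> fibre_words n ((shift ^^ m) y)"
      using X.funpow_shift_X[OF x(1), of m] \<pi>_funpow_shift[OF x(1), of m] by (auto simp: fibre_words_def)
    then show "w \<in> (\<lambda>(u, v). u @ v) ` (fibre_words m y \<times> fibre_words n ((shift ^^ m) y))"
      using x(3) by (force simp: block_add)
  qed
  then have "card (fibre_words (m + n) y) \<le> card ((\<lambda>(u, v). u @ v) ` (fibre_words m y \<times> fibre_words n ((shift ^^ m) y)))"
    by (rule card_mono[rotated]) (simp add: finite_fibre_words)
  also have "\<dots> \<le> card (fibre_words m y \<times> fibre_words n ((shift ^^ m) y))"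
    by (intro card_image_le) (simp add: finite_fibre_words)
  finally have le: "card (fibre_words (m + n) y) \<le> card (fibre_words m y) * card (fibre_words n ((shift ^^ m) y))"
    by (simp add: card_cartesian_product)
  have "fibre_log (m + n) y \<le> ln (real (card (fibre_words m y) * card (fibre_words n ((shift ^^ m) y))))"
    unfolding fibre_log_def
    using le card_fibre_words_ge_1[OF y, of "m + n"] card_fibre_words_ge_1[OF y, of m] card_fibre_words_ge_1[OF sy, of n]
    by (subst ln_le_cancel_iff) (auto simp flip: of_nat_mult)
  also have "\<dots> = fibre_log m y + fibre_log n ((shift ^^ m) y)"
    using card_fibre_words_ge_1[OF y, of m] card_fibre_words_ge_1[OF sy, of n] by (simp add: fibre_log_def ln_mult)
  finally show ?thesis .
qed

text \<open>The function \<open>F\<close> expressed by fibre words, hence free of the choice of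
  points in \<open>D\<close>; \<open>card_fiber_selection\<close> provides the link, and
  \<open>growth_limsup\<close> shows that on \<open>Y\<close> the conversion to a real loses
  nothing.\<close>

definition growth :: "(nat \<Rightarrow> nat) \<Rightarrow> real" where
  "growth y = real_of_ereal (limsup (\<lambda>n. ereal (fibre_log n y / real n)))"

lemma fibre_average_bounds:
  assumes "y \<in> Y" shows "0 \<le> fibre_log n y / real n" "fibre_log n y / real n \<le> ln (real k)"
proof -
  show "0 \<le> fibre_log n y / real n" using fibre_log_nonneg[OF assms] by simp
  show "fibre_log n y / real n \<le> ln (real k)"
    using fibre_log_le[OF assms, of n] ln_k_nonneg by (cases "n = 0") (auto simp: field_simps)
qed

lemma
  assumes y: "y \<in> Y"
  shows growth_limsup: "limsup (\<lambda>n. ereal (fibre_log n y / real n)) = ereal (growth y)"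
    and growth_nonneg: "0 \<le> growth y" and growth_le: "growth y \<le> ln (real k)"
proof -
  let ?L = "limsup (\<lambda>n. ereal (fibre_log n y / real n))"
  have "ereal 0 \<le> ?L"
    by (rule le_Limsup) (auto intro!: always_eventually simp: fibre_log_nonneg[OF y])
  moreover have "?L \<le> ereal (ln (real k))"
    by (rule Limsup_bounded) (intro always_eventually allI, simp only: ereal_less_eq fibre_average_bounds[OF y])
  ultimately show "?L = ereal (growth y)" "0 \<le> growth y" "growth y \<le> ln (real k)"
    unfolding growth_def by (cases ?L; simp)+
qed

lemma growth_measurable: "sets M = sets (borel_on Y) \<Longrightarrow> growth \<in> borel_measurable M"
proof -
  assume M: "sets M = sets (borel_on Y)"
  note [measurable] = fibre_log_measurable[OF M]
  show ?thesis unfolding growth_def[abs_def] by measurable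
qed

text \<open>A selection has exactly one point for every word of the fibre, so taking the
  \<open>n\<close>-block is a bijection from \<open>D\<close> onto
  \<open>fibre_words n y\<close>.\<close>

lemma card_fiber_selection:
  assumes D: "fiber_selection X \<pi> n y D" shows "card D = card (fibre_words n y)"
proof -
  have cyl: "cylinder X w = {x \<in> X. block n x = w}" if "length w = n" for w
    using that by (auto simp: cylinder_def list_eq_iff_nth_eq nth_block)
  have sub: "D \<subseteq> {x \<in> X. \<pi> x = y}"
    and ex1: "\<And>w. length w = n \<Longrightarrow> {x \<in> X. \<pi> x = y} \<inter> cylinder X w \<noteq> {} \<Longrightarrow> \<exists>!x. x \<in> D \<inter> cylinder X w"
    using D by (auto simp: fiber_selection_def)
  have ex1': "\<exists>!z. z \<in> D \<and> block n z = block n x" if "x \<in> X" "\<pi> x = y" for x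
  proof -
    have "{x \<in> X. \<pi> x = y} \<inter> cylinder X (block n x) \<noteq> {}" using that by (auto simp: cyl)
    then have "\<exists>!z. z \<in> D \<inter> cylinder X (block n x)" by (intro ex1) simp_all
    moreover have "z \<in> D \<inter> cylinder X (block n x) \<longleftrightarrow> z \<in> D \<and> block n z = block n x" for z
      using sub by (auto simp: cyl)
    ultimately show ?thesis by simp
  qed
  have "bij_betw (block n) D (fibre_words n y)"
  proof (rule bij_betw_imageI)
    show "inj_on (block n) D"
    proof (rule inj_onI)
      fix x z assume xz: "x \<in> D" "z \<in> D" "block n x = block n z"
      then have "x \<in> X" "\<pi> x = y" using sub by auto
      from ex1'[OF this] xz show "x = z" by auto
    qed
    show "block n ` D = fibre_words n y"
    proof
      show "block n ` D \<subseteq> fibre_words n y" using sub by (auto simp: fibre_words_def)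
      show "fibre_words n y \<subseteq> block n ` D"
      proof
        fix w assume "w \<in> fibre_words n y"
        then obtain x where "x \<in> X" "\<pi> x = y" "w = block n x" by (auto simp: fibre_words_def)
        from ex1'[OF this(1,2)] obtain z where "z \<in> D" "block n z = block n x" by blast
        then show "w \<in> block n ` D" unfolding \<open>w = block n x\<close> by (metis imageI)
      qed
    qed
  qed
  then show ?thesis by (rule bij_betw_same_card)
qed

section \<open>Push-forwards and the upper bound for relative entropy\<close>

lemma \<pi>_measurable: "sets M = sets (borel_on X) \<Longrightarrow> \<pi> \<in> measurable M (borel_on Y)"
proof -
  assume M: "sets M = sets (borel_on X)"
  have "\<pi> \<in> borel_measurable M"
    unfolding measurable_cong_sets[OF M refl] using continuous_\<pi> by (rule borel_measurable_continuous_on_restrict)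
  then show ?thesis using \<pi>_Y by (intro measurable_restrict_space2) (auto simp: X.space_eq_X[OF M])
qed

lemma simple_function_block_\<pi>:
  assumes "sets M = sets (borel_on X)" shows "simple_function M (\<lambda>x. block n (\<pi> x))"
  by (rule X.simple_function_determined[OF assms]) (rule block_\<pi>_cong)

lemma
  assumes M: "prob_space M" "sets M = sets (borel_on X)"
  shows prob_push_forward: "prob_space (push_forward Y \<pi> M)"
    and sets_push_forward: "sets (push_forward Y \<pi> M) = sets (borel_on Y)"
    and measure_push_forward: "\<And>n w. measure (push_forward Y \<pi> M) {y \<in> Y. block n y = w} = measure M {x \<in> X. block n (\<pi> x) = w}"
proof -
  interpret prob_space M by fact
  show "prob_space (push_forward Y \<pi> M)"
    unfolding push_forward_def using \<pi>_measurable[OF M(2)] by (rule prob_space_distr)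
  show "sets (push_forward Y \<pi> M) = sets (borel_on Y)" by (simp add: push_forward_def)
  fix n w
  have "\<pi> -` {y \<in> Y. block n y = w} \<inter> space M = {x \<in> X. block n (\<pi> x) = w}"
    using \<pi>_Y by (auto simp: X.space_eq_X[OF M(2)])
  then show "measure (push_forward Y \<pi> M) {y \<in> Y. block n y = w} = measure M {x \<in> X. block n (\<pi> x) = w}"
    unfolding push_forward_def using \<pi>_measurable[OF M(2)] Y.cylinder_measurable[OF refl]
    by (simp add: measure_distr)
qed

lemma push_forward_invariant:
  assumes \<mu>: "\<mu> \<in> invariant_measures X" shows "push_forward Y \<pi> \<mu> \<in> invariant_measures Y"
proof (rule Y.invariantI)
  note m = X.invariantD[OF \<mu>]
  interpret measure_preserving \<mu> shift by (rule m(4))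
  show "prob_space (push_forward Y \<pi> \<mu>)" "sets (push_forward Y \<pi> \<mu>) = sets (borel_on Y)"
    using prob_push_forward[OF m(1,2)] sets_push_forward[OF m(1,2)] by auto
  fix n w
  let ?A = "{x \<in> X. block n (\<pi> x) = w}"
  have A: "?A \<in> sets \<mu>"
    using simple_function_level_sets[OF simple_function_block_\<pi>[OF m(2), of n], of "\<lambda>v. v = w"] by (simp add: m(3))
  have "measure (push_forward Y \<pi> \<mu>) {y \<in> Y. block n (shift y) = w} = measure \<mu> (\<pi> -` {y \<in> Y. block n (shift y) = w} \<inter> space \<mu>)"
    unfolding push_forward_def
  proof (rule measure_distr[OF \<pi>_measurable[OF m(2)]])
    have "shift -` {y \<in> Y. block n y = w} \<inter> space (borel_on Y) = {y \<in> Y. block n (shift y) = w}"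
      by (auto simp: space_restrict_space Y.shift_X)
    then show "{y \<in> Y. block n (shift y) = w} \<in> sets (borel_on Y)"
      using measurable_sets[OF Y.shift_measurable[OF refl refl] Y.cylinder_measurable[OF refl, of n w]] by simp
  qed
  also have "\<pi> -` {y \<in> Y. block n (shift y) = w} \<inter> space \<mu> = shift -` ?A \<inter> space \<mu>"
    by (auto simp: m(3) \<pi>_Y \<pi>_shift X.shift_X)
  also have "measure \<mu> \<dots> = measure (distr \<mu> \<mu> shift) ?A" using T_meas A by (rule measure_distr[symmetric])
  also have "\<dots> = measure (push_forward Y \<pi> \<mu>) {y \<in> Y. block n y = w}"
    by (simp add: distr_T measure_push_forward[OF m(1,2)])
  finally show "measure (push_forward Y \<pi> \<mu>) {y \<in> Y. block n (shift y) = w}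
    = measure (push_forward Y \<pi> \<mu>) {y \<in> Y. block n y = w}" .
qed

lemma integrable_bounded_Y:
  assumes "prob_space m" "sets m = sets (borel_on Y)" "f \<in> borel_measurable m" "\<And>y. y \<in> Y \<Longrightarrow> \<bar>f y\<bar> \<le> (B :: real)"
  shows "integrable m f"
proof -
  interpret prob_space m by fact
  show ?thesis using assms(3,4) Y.space_eq_X[OF assms(2)] by (intro integrable_const_bound[where B=B]) (auto intro!: AE_I2)
qed

lemma integrable_fibre_log:
  assumes "prob_space m" "sets m = sets (borel_on Y)" shows "integrable m (fibre_log n)"
  using fibre_log_nonneg fibre_log_le
  by (intro integrable_bounded_Y[OF assms fibre_log_measurable[OF assms(2)], where B="real n * ln (real k)"]) simp

lemma integrable_approx_log:
  assumes "prob_space m" "sets m = sets (borel_on Y)" shows "integrable m (approx_log n i)"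
  using approx_log_nonneg approx_log_le
  by (intro integrable_bounded_Y[OF assms approx_log_measurable[OF assms(2)], where B="real n * ln (real k)"]) simp

lemma integrable_growth:
  assumes "prob_space m" "sets m = sets (borel_on Y)" shows "integrable m growth"
  using growth_nonneg growth_le
  by (intro integrable_bounded_Y[OF assms growth_measurable[OF assms(2)], where B="ln (real k)"]) simp

theorem entropy_le_relative:
  assumes \<mu>: "\<mu> \<in> invariant_measures X"
  defines "m \<equiv> push_forward Y \<pi> \<mu>"
  shows "shift_entropy \<mu> \<le> shift_entropy m + (\<integral>y. growth y \<partial>m)"
proof -
  note pm = X.invariantD[OF \<mu>]
  have m: "m \<in> invariant_measures Y" unfolding m_def by (rule push_forward_invariant[OF \<mu>])
  note pY = Y.invariantD[OF m]
  interpret measure_preserving \<mu> shift by (rule pm(4))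
  interpret m: prob_space m by (rule pY(1))
  note [simp] = pm(3)
  note sX = X.simple_function_block[OF pm(2)] and sY = simple_function_block_\<pi>[OF pm(2)]
  let ?Z = "\<lambda>n x. block n (\<pi> x)"
  \<comment> \<open>\<open>d n\<close> is the entropy of the \<open>n\<close>-block of
    \<open>x\<close> given that of \<open>\<pi> x\<close>: a one-block map makes the latter a
    function of the former.\<close>
  define d where "d n = fin_entropy \<mu> (block n) - fin_entropy \<mu> (?Z n)" for n
  define e where "e q i = (\<integral>y. approx_log q i y \<partial>m)" for q i
  define c where "c q = (\<integral>y. fibre_log q y \<partial>m)" for q
  have HY: "fin_entropy m (block n) = fin_entropy \<mu> (?Z n)" for n
    unfolding m_def push_forward_def using \<pi>_measurable[OF pm(2)] Y.simple_function_block[OF refl] by (rule fin_entropy_distr)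
  have e_c: "(\<lambda>i. e q i) \<longlonglongrightarrow> c q" for q
    unfolding e_def c_def
  proof (rule integral_dominated_convergence[where w="\<lambda>_. real q * ln (real k)"])
    show "AE y in m. (\<lambda>i. approx_log q i y) \<longlonglongrightarrow> fibre_log q y" using approx_log_tendsto by simp
    show "AE y in m. norm (approx_log q i y) \<le> real q * ln (real k)" for i
      using approx_log_nonneg approx_log_le pY(3) by (intro AE_I2) auto
  qed (auto intro: approx_log_measurable[OF pY(2)] fibre_log_measurable[OF pY(2)])
  \<comment> \<open>Split the block of \<open>x\<close> into its first \<open>q\<close> symbols
    \<open>?A\<close> and the following \<open>n\<close> symbols \<open>?B\<close>. Given the
    \<open>Y\<close>-word \<open>?W\<close>, the part \<open>?A\<close> costs at most the mean
    logarithm of the number of words over the cylinder of \<open>?W\<close>. The part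
    \<open>?B\<close> costs no more than it would given only the \<open>Y\<close>-word
    \<open>?C\<close> below it, and that is \<open>d n\<close> by invariance.\<close>
  have step: "d (q + n) \<le> d n + e q (q + n)" for q n
  proof -
    let ?A = "block q" and ?B = "\<lambda>x. block n ((shift ^^ q) x)" and ?W = "?Z (q + n)" and ?C = "\<lambda>x. ?Z n ((shift ^^ q) x)"
    have sB: "simple_function \<mu> ?B" and sC: "simple_function \<mu> ?C"
      using simple_function_funpow[OF sX] simple_function_funpow[OF sY] by auto
    have "fin_entropy \<mu> (block (q + n)) \<le> fin_entropy \<mu> (\<lambda>x. (?A x, ?B x, ?W x))"
      by (rule fin_entropy_mono[OF simple_function_Pair[OF sX simple_function_Pair[OF sB sY]]]) (simp add: block_add)
    moreover have "fin_entropy \<mu> (\<lambda>x. (?A x, ?B x, ?W x)) + fin_entropy \<mu> ?W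
        \<le> fin_entropy \<mu> (\<lambda>x. (?A x, ?W x)) + fin_entropy \<mu> (\<lambda>x. (?B x, ?W x))"
      by (rule fin_entropy_submodular[OF sX sB sY])
    moreover have "fin_entropy \<mu> (\<lambda>x. (?B x, ?W x)) \<le> fin_entropy \<mu> (\<lambda>x. (?B x, ?W x, ?C x))"
      by (rule fin_entropy_mono[OF simple_function_Pair[OF sB simple_function_Pair[OF sY sC]]]) simp
    moreover have "fin_entropy \<mu> (\<lambda>x. (?B x, ?W x, ?C x)) + fin_entropy \<mu> ?C
        \<le> fin_entropy \<mu> (\<lambda>x. (?B x, ?C x)) + fin_entropy \<mu> (\<lambda>x. (?W x, ?C x))"
      by (rule fin_entropy_submodular[OF sB sY sC])
    moreover have "fin_entropy \<mu> (\<lambda>x. (?B x, ?C x)) \<le> fin_entropy \<mu> ?B"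
      by (rule fin_entropy_mono[OF sB]) (simp add: block_\<pi>_cong X.funpow_shift_X)
    moreover have "fin_entropy \<mu> (\<lambda>x. (?W x, ?C x)) \<le> fin_entropy \<mu> ?W"
      by (rule fin_entropy_mono[OF sY]) (simp add: \<pi>_funpow_shift block_add)
    moreover have "fin_entropy \<mu> ?B = fin_entropy \<mu> (block n)" "fin_entropy \<mu> ?C = fin_entropy \<mu> (?Z n)"
      using fin_entropy_funpow[OF sX] fin_entropy_funpow[OF sY] by auto
    moreover have "fin_entropy \<mu> (\<lambda>x. (?A x, ?W x)) \<le> fin_entropy \<mu> ?W + e q (q + n)"
    proof -
      have "fin_entropy \<mu> (\<lambda>x. (?A x, ?W x)) \<le> fin_entropy \<mu> ?W + (\<integral>x. ln (real (card (approx_words q (q + n) (?W x)))) \<partial>\<mu>)"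
        by (rule fin_entropy_Pair_le_card[OF sX sY]) (simp add: approx_words_def)
      also have "(\<integral>x. ln (real (card (approx_words q (q + n) (?W x)))) \<partial>\<mu>) = e q (q + n)"
        unfolding e_def m_def push_forward_def
        by (subst integral_distr[OF \<pi>_measurable[OF pm(2)] approx_log_measurable[OF refl]]) (simp add: approx_log_def)
      finally show ?thesis .
    qed
    ultimately show ?thesis by (simp add: d_def)
  qed
  let ?\<delta> = "shift_entropy \<mu> - shift_entropy m"
  have d_lim: "(\<lambda>n. d n / real n) \<longlonglongrightarrow> ?\<delta>"
    using tendsto_diff[OF X.shift_entropy_tendsto[OF \<mu>] Y.shift_entropy_tendsto[OF m]]
    by (simp add: d_def HY diff_divide_distrib)
  \<comment> \<open>In \<open>step\<close> the cylinder length grows with \<open>n\<close>. So for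
    fixed \<open>q\<close>, from some \<open>n0\<close> on, every advance by \<open>q\<close>
    symbols costs at most \<open>c q + \<epsilon>\<close>; advancing from \<open>n0\<close> in steps
    of \<open>q\<close> and dividing by the length gives the bound.\<close>
  have bound: "?\<delta> \<le> c q / real q" if q: "1 \<le> q" for q
  proof (rule field_le_epsilon)
    fix \<epsilon> :: real assume \<epsilon>: "0 < \<epsilon>"
    have "\<forall>\<^sub>F i in sequentially. e q i < c q + \<epsilon>" using e_c[of q] \<epsilon> by (intro order_tendstoD(2)) auto
    then obtain n0 where n0: "\<And>i. n0 \<le> i \<Longrightarrow> e q i \<le> c q + \<epsilon>"
      unfolding eventually_sequentially by (meson less_imp_le)
    have iter: "d (n0 + j * q) \<le> d n0 + real j * (c q + \<epsilon>)" for j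
    proof (induction j)
      case (Suc j)
      have "d (n0 + Suc j * q) = d (q + (n0 + j * q))" by (simp add: ac_simps)
      also have "\<dots> \<le> d (n0 + j * q) + e q (q + (n0 + j * q))" by (rule step)
      also have "e q (q + (n0 + j * q)) \<le> c q + \<epsilon>" by (intro n0) simp
      finally show ?case using Suc by (simp add: algebra_simps)
    qed simp
    have sm: "strict_mono (\<lambda>j. n0 + j * q)" using q by (auto intro!: strict_monoI)
    have 1: "(\<lambda>j. d (n0 + j * q) / real (n0 + j * q)) \<longlonglongrightarrow> ?\<delta>"
      using LIMSEQ_subseq_LIMSEQ[OF d_lim sm] by (simp add: comp_def)
    have 2: "(\<lambda>j. (d n0 + real j * (c q + \<epsilon>)) / real (n0 + j * q)) \<longlonglongrightarrow> (c q + \<epsilon>) / real q"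
    proof -
      have "(\<lambda>j. (d n0 / real j + (c q + \<epsilon>)) / (real n0 / real j + real q)) \<longlonglongrightarrow> (0 + (c q + \<epsilon>)) / (0 + real q)"
        using q by (intro tendsto_divide tendsto_add tendsto_const lim_const_over_n) auto
      moreover have "\<forall>\<^sub>F j in sequentially. (d n0 / real j + (c q + \<epsilon>)) / (real n0 / real j + real q)
          = (d n0 + real j * (c q + \<epsilon>)) / real (n0 + j * q)"
        using eventually_gt_at_top[of 0]
      proof eventually_elim
        case (elim j)
        then have "(d n0 / real j + (c q + \<epsilon>)) = (d n0 + real j * (c q + \<epsilon>)) / real j"
          "(real n0 / real j + real q) = real (n0 + j * q) / real j" by (simp_all add: field_simps)
        with elim show ?case by simp
      qed
      ultimately show ?thesis by (simp add: tendsto_cong)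
    qed
    have "?\<delta> \<le> (c q + \<epsilon>) / real q"
      by (rule LIMSEQ_le[OF 1 2]) (use iter in \<open>auto intro!: exI[of _ 0] divide_right_mono\<close>)
    also have "\<dots> \<le> c q / real q + \<epsilon>"
    proof -
      have "\<epsilon> / real q \<le> \<epsilon> / 1" using q \<epsilon> by (intro divide_left_mono) auto
      then show ?thesis by (simp add: add_divide_distrib)
    qed
    finally show "?\<delta> \<le> c q / real q + \<epsilon>" .
  qed
  have "?\<delta> \<le> (\<integral>y. growth y \<partial>m)"
  proof (rule m.le_integral_limsup[where B="ln (real k)"])
    show "(\<lambda>y. fibre_log n y / real n) \<in> borel_measurable m" for n
      using fibre_log_measurable[OF pY(2)] by (intro borel_measurable_divide) auto
    show "growth \<in> borel_measurable m" using growth_measurable[OF pY(2)] .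
    show "?\<delta> \<le> (\<integral>y. fibre_log n y / real n \<partial>m)" if "1 \<le> n" for n
      using bound[OF that] by (simp add: c_def)
  qed (use fibre_average_bounds growth_limsup growth_nonneg growth_le in \<open>auto simp: pY(3)\<close>)
  then show ?thesis by simp
qed

end

section \<open>The relative variational principle\<close>

lemma (in prob_space) level_prob_compose:
  assumes f: "simple_function M f" and S: "finite S" "f ` space M \<subseteq> S"
  shows "level_prob M (\<lambda>x. h (f x)) v = (\<Sum>w\<in>S. if h w = v then level_prob M f w else 0)"
proof -
  let ?\<phi> = "\<lambda>w. if h w = v then 1 else 0 :: real"
  have "level_prob M (\<lambda>x. h (f x)) v = (\<integral>x. indicator {x \<in> space M. h (f x) = v} x \<partial>M)"
    using simple_function_level_sets[OF f, of "\<lambda>w. h w = v"] by (simp add: level_prob_def)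
  also have "\<dots> = (\<integral>x. ?\<phi> (f x) \<partial>M)"
    by (intro Bochner_Integration.integral_cong) (auto simp: indicator_def)
  also have "\<dots> = (\<Sum>w\<in>f ` space M. level_prob M f w * ?\<phi> w)" by (rule integral_simple_compose[OF f])
  also have "\<dots> = (\<Sum>w\<in>S. level_prob M f w * ?\<phi> w)"
    by (intro sum.mono_neutral_left S) (simp add: level_prob_eq_0)
  also have "\<dots> = (\<Sum>w\<in>S. if h w = v then level_prob M f w else 0)" by (intro sum.cong) auto
  finally show ?thesis .
qed

section \<open>Lifting invariant measures from \<open>Y\<close> to \<open>X\<close> with large
  entropy\<close>

context one_block_factor
begin

text \<open>Draw the \<open>N\<close>-block \<open>w\<close> of \<open>Y\<close> according to \<open>m\<close>, then an \<open>n\<close>-block uniformly among those of points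
  lying over the cylinder of \<open>w\<close>.\<close>

lemma uniform_fibre_measure:
  assumes m: "prob_space m" "sets m = sets (borel_on Y)" and nN: "n \<le> N"
  obtains \<nu> where "prob_space \<nu>" "sets \<nu> = sets (borel_on X)"
    "\<And>(h :: nat list \<Rightarrow> nat list) v. level_prob \<nu> (\<lambda>x. h (block N (\<pi> x))) v = level_prob m (\<lambda>y. h (block N y)) v"
    "fin_entropy m (block n) + (\<integral>y. fibre_log n y \<partial>m) \<le> fin_entropy \<nu> (block n)"
proof -
  interpret m: prob_space m by (rule m(1))
  have spm: "space m = Y" using Y.space_eq_X[OF m(2)] .
  note sm = Y.simple_function_block[OF m(2)]
  define B where "B = block N ` Y"
  define C where "C = approx_words n N"
  define lp where "lp = level_prob m (block N)"
  have finB: "finite B" using sm[of N] by (simp add: B_def simple_function_def spm)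
  have finC: "finite (C w)" for w by (simp add: C_def finite_approx_words)
  have C_pos: "0 < card (C w)" if "w \<in> B" for w
  proof -
    obtain y where "y \<in> Y" "w = block N y" using \<open>w \<in> B\<close> by (auto simp: B_def)
    then have "C w \<noteq> {}" using fibre_words_nonempty[of y n] fibre_words_approx[of n y N] by (auto simp: C_def)
    with finC show ?thesis by (simp add: card_gt_0_iff)
  qed
  have lp0: "0 \<le> lp w" for w by (simp add: lp_def m.level_prob_nonneg)
  have sum_lp: "(\<Sum>w\<in>B. lp w) = 1" using m.sum_level_prob[OF sm[of N]] by (simp add: B_def lp_def spm)
  define S where "S = Sigma B C"
  define p where "p = (\<lambda>(w, u :: nat list). lp w / real (card (C w)))"
  have finS: "finite S" using finB finC by (simp add: S_def)
  have p0: "0 \<le> p z" for z using lp0 by (auto simp: p_def split_def)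
  have sumS: "(\<Sum>(w, u)\<in>S. g w / real (card (C w))) = (\<Sum>w\<in>B. g w)" for g :: "nat list \<Rightarrow> real"
  proof -
    have "(\<Sum>(w, u)\<in>S. g w / real (card (C w))) = (\<Sum>w\<in>B. \<Sum>u\<in>C w. g w / real (card (C w)))"
      unfolding S_def using finB finC by (subst sum.Sigma) auto
    also have "\<dots> = (\<Sum>w\<in>B. g w)" using C_pos by (intro sum.cong) auto
    finally show ?thesis .
  qed
  define Q where "Q = point_measure S (\<lambda>z. ennreal (p z))"
  have spQ: "space Q = S" by (simp add: Q_def space_point_measure)
  interpret Q: prob_space Q
    unfolding Q_def using sumS[of lp] sum_lp p0 by (intro prob_space_point_measure finS) (auto simp: p_def)
  have mQ: "measure Q A = (\<Sum>z\<in>A. p z)" if "A \<subseteq> S" for A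
    unfolding Q_def using that p0 finS by (subst measure_point_measure_finite_if) auto
  have sQ: "simple_function Q f" for f :: "_ \<Rightarrow> 'x" unfolding Q_def by (simp add: finS simple_function_point_measure)
  \<comment> \<open>One point of \<open>X\<close> represents each pair \<open>(w, u)\<close>. Only
    its \<open>n\<close>-block and the \<open>N\<close>-block of its image will matter, so the
    measure obtained may have finite support.\<close>
  define pick where "pick = (\<lambda>(w, u). SOME x. x \<in> X \<and> block N (\<pi> x) = w \<and> block n x = u)"
  have pick: "pick z \<in> X" "block N (\<pi> (pick z)) = fst z" "block n (pick z) = snd z" if "z \<in> S" for z
  proof -
    have "\<exists>x. x \<in> X \<and> block N (\<pi> x) = fst z \<and> block n x = snd z"
      using that by (auto simp: S_def C_def approx_words_def)
    from someI_ex[OF this] show "pick z \<in> X" "block N (\<pi> (pick z)) = fst z" "block n (pick z) = snd z"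
      by (auto simp: pick_def split_def)
  qed
  have pick_m: "pick \<in> measurable Q (borel_on X)"
    unfolding Q_def measurable_point_measure_eq1 using pick(1) by (auto simp: space_restrict_space)
  define \<nu> where "\<nu> = distr Q (borel_on X) pick"
  have \<nu>: "prob_space \<nu>" "sets \<nu> = sets (borel_on X)"
    using Q.prob_space_distr[OF pick_m] by (auto simp: \<nu>_def)
  have lp_fst: "level_prob Q fst w = lp w" if "w \<in> B" for w
  proof -
    have "level_prob Q fst w = (\<Sum>z\<in>{z \<in> S. fst z = w}. p z)"
      unfolding level_prob_def spQ by (rule mQ) auto
    also have "\<dots> = (\<Sum>z\<in>S. if fst z = w then p z else 0)" using finS by (simp add: sum.inter_filter)
    also have "\<dots> = (\<Sum>(w', u)\<in>S. (if w' = w then lp w' else 0) / real (card (C w')))"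
      by (intro sum.cong) (auto simp: p_def)
    also have "\<dots> = lp w" unfolding sumS using finB that by simp
    finally show ?thesis .
  qed
  have fst_sub: "fst ` space Q \<subseteq> B" by (auto simp: spQ S_def)
  have blk_sub: "block N ` space m \<subseteq> B" by (auto simp: spm B_def)
  have law: "level_prob Q (\<lambda>z. h (fst z)) v = level_prob m (\<lambda>y. h (block N y)) v" for h :: "nat list \<Rightarrow> nat list" and v
    unfolding Q.level_prob_compose[OF sQ finB fst_sub] m.level_prob_compose[OF sm finB blk_sub]
    by (intro sum.cong refl if_cong) (simp_all add: lp_fst lp_def[symmetric])
  have law_\<nu>: "level_prob \<nu> (\<lambda>x. h (block N (\<pi> x))) v = level_prob m (\<lambda>y. h (block N y)) v"
    for h :: "nat list \<Rightarrow> nat list" and v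
  proof -
    have "{x \<in> X. h (block N (\<pi> x)) = v} \<in> sets (borel_on X)"
      using simple_function_level_sets[OF simple_function_block_\<pi>[OF refl, of N], of "\<lambda>w. h w = v"]
      by (simp add: space_restrict_space)
    then have "level_prob \<nu> (\<lambda>x. h (block N (\<pi> x))) v = measure Q (pick -` {x \<in> X. h (block N (\<pi> x)) = v} \<inter> space Q)"
      unfolding level_prob_def X.space_eq_X[OF \<nu>(2)] unfolding \<nu>_def using pick_m by (simp add: measure_distr)
    also have "pick -` {x \<in> X. h (block N (\<pi> x)) = v} \<inter> space Q = {z \<in> space Q. h (fst z) = v}"
      using pick by (auto simp: spQ)
    finally show ?thesis using law[of h v] by (simp add: level_prob_def)
  qed
  have H\<nu>: "fin_entropy \<nu> (block n) = fin_entropy Q snd"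
  proof -
    have "fin_entropy \<nu> (block n) = fin_entropy Q (\<lambda>z. block n (pick z))"
      unfolding \<nu>_def using pick_m X.simple_function_block[OF refl] by (rule Q.fin_entropy_distr)
    also have "\<dots> = fin_entropy Q snd" using pick(3) by (intro Q.fin_entropy_cong sQ) (simp add: spQ)
    finally show ?thesis .
  qed
  have HW: "fin_entropy Q fst = - (\<Sum>w\<in>B. lp w * ln (lp w))"
    unfolding fin_entropy_superset[OF finB fst_sub] by (simp add: lp_fst)
  have HV: "fin_entropy Q (\<lambda>z. take n (fst z)) = fin_entropy m (block n)"
  proof -
    have "fin_entropy m (block n) = fin_entropy m (\<lambda>y. take n (block N y))" by (simp add: take_block[OF nN])
    also have "\<dots> = - (\<Sum>v\<in>take n ` B. level_prob m (\<lambda>y. take n (block N y)) v * ln (level_prob m (\<lambda>y. take n (block N y)) v))"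
      using finB by (intro fin_entropy_superset) (auto simp: spm B_def)
    also have "\<dots> = fin_entropy Q (\<lambda>z. take n (fst z))"
      unfolding law[symmetric] using finB fst_sub by (intro fin_entropy_superset[symmetric]) auto
    finally show ?thesis by simp
  qed
  have HUW: "fin_entropy Q (\<lambda>z. z) = fin_entropy Q fst + (\<Sum>w\<in>B. lp w * ln (real (card (C w))))"
  proof -
    have "level_prob Q (\<lambda>z. z) z = p z" if "z \<in> S" for z
    proof -
      have "{z' \<in> space Q. z' = z} = {z}" using that by (auto simp: spQ)
      then show ?thesis using mQ[of "{z}"] that by (simp add: level_prob_def)
    qed
    then have "fin_entropy Q (\<lambda>z. z) = - (\<Sum>z\<in>S. p z * ln (p z))" by (simp add: fin_entropy_def spQ)
    also have "(\<Sum>z\<in>S. p z * ln (p z)) = (\<Sum>(w, u)\<in>S. (lp w * (ln (lp w) - ln (real (card (C w))))) / real (card (C w)))"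
    proof (intro sum.cong refl, clarify)
      fix w u assume "(w, u) \<in> S"
      then have c: "0 < real (card (C w))" using C_pos by (auto simp: S_def)
      show "p (w, u) * ln (p (w, u)) = lp w * (ln (lp w) - ln (real (card (C w)))) / real (card (C w))"
        using c lp0[of w] by (cases "lp w = 0") (simp_all add: p_def ln_div)
    qed
    also have "\<dots> = (\<Sum>w\<in>B. lp w * (ln (lp w) - ln (real (card (C w)))))" by (rule sumS)
    finally show ?thesis by (simp add: HW right_diff_distrib sum_subtractf)
  qed
  \<comment> \<open>Replacing the fibre by the preimage of a cylinder only adds words, which is the
    favourable direction here.\<close>
  have Hc: "(\<integral>y. fibre_log n y \<partial>m) \<le> (\<Sum>w\<in>B. lp w * ln (real (card (C w))))"
  proof -
    have "(\<integral>y. fibre_log n y \<partial>m) \<le> (\<integral>y. approx_log n N y \<partial>m)"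
      using fibre_log_le_approx_log by (intro integral_mono integrable_fibre_log integrable_approx_log m) (simp add: spm)
    also have "\<dots> = (\<integral>y. ln (real (card (C (block N y)))) \<partial>m)" by (simp add: approx_log_def[abs_def] C_def)
    also have "\<dots> = (\<Sum>w\<in>B. lp w * ln (real (card (C w))))"
      using m.integral_simple_compose[OF sm[of N], of "\<lambda>w. ln (real (card (C w)))"] by (simp add: B_def lp_def spm)
    finally show ?thesis .
  qed
  \<comment> \<open>The \<open>n\<close>-prefix of the \<open>Y\<close>-word is a function of
    \<open>w\<close> and, \<pi> being one-block, also of \<open>u\<close>. Submodularity over it
    gives \<open>H(u) \<ge> H(w, u) - H(w) + H(V)\<close>, where \<open>H(w, u) - H(w)\<close> is
    the mean of \<open>ln (card (C w))\<close> and \<open>H(V)\<close> is the entropy of the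
    \<open>n\<close>-block under \<open>m\<close>.\<close>
  let ?V = "\<lambda>z :: nat list \<times> nat list. take n (fst z)"
  have V_det: "?V z = ?V z'" if "z \<in> S" "z' \<in> S" "snd z = snd z'" for z z'
  proof -
    have "block n (\<pi> (pick z)) = block n (\<pi> (pick z'))"
      using that pick by (intro block_\<pi>_cong) auto
    then have "take n (block N (\<pi> (pick z))) = take n (block N (\<pi> (pick z')))" by (simp only: take_block[OF nN])
    then show ?thesis using pick(2) that by simp
  qed
  have "fin_entropy Q (\<lambda>z. z) \<le> fin_entropy Q (\<lambda>z. (snd z, fst z, ?V z))"
    by (intro Q.fin_entropy_mono sQ) (auto simp: prod_eq_iff)
  moreover have "fin_entropy Q (\<lambda>z. (snd z, fst z, ?V z)) + fin_entropy Q ?V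
      \<le> fin_entropy Q (\<lambda>z. (snd z, ?V z)) + fin_entropy Q (\<lambda>z. (fst z, ?V z))"
    by (intro Q.fin_entropy_submodular sQ)
  moreover have "fin_entropy Q (\<lambda>z. (snd z, ?V z)) \<le> fin_entropy Q snd"
  proof (rule Q.fin_entropy_mono[OF sQ])
    fix z z' assume "z \<in> space Q" "z' \<in> space Q" "snd z = snd z'"
    with V_det[of z z'] show "(snd z, ?V z) = (snd z', ?V z')" by (simp add: spQ)
  qed
  moreover have "fin_entropy Q (\<lambda>z. (fst z, ?V z)) \<le> fin_entropy Q fst"
    by (intro Q.fin_entropy_mono sQ) simp
  ultimately have "fin_entropy m (block n) + (\<integral>y. fibre_log n y \<partial>m) \<le> fin_entropy \<nu> (block n)"
    using HUW Hc HV H\<nu> by linarith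
  with \<nu> law_\<nu> show ?thesis by (rule that)
qed

text \<open>Deleting the first symbol of a word over \<open>y\<close> leaves a word over
  \<open>shift y\<close> and merges at most \<open>k\<close> words into one, which is invisible to
  the growth rate. A point over \<open>shift y\<close> need not be the shift of a point over
  \<open>y\<close>; the inequality is the form that \<open>ergodic_integral_le\<close> asks
  for.\<close>

lemma growth_le_shift:
  assumes y: "y \<in> Y" shows "growth y \<le> growth (shift y)"
proof (rule field_le_epsilon)
  have sy: "shift y \<in> Y" using y by (rule Y.shift_X)
  fix e :: real assume e: "0 < e"
  have "limsup (\<lambda>n. ereal (fibre_log n (shift y) / real n)) < ereal (growth (shift y) + e / 2)"
    using e by (simp add: growth_limsup[OF sy])
  then have 1: "\<forall>\<^sub>F n in sequentially. fibre_log n (shift y) / real n < growth (shift y) + e / 2"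
    by (auto dest: Limsup_lessD)
  have 2: "\<forall>\<^sub>F n in sequentially. ln (real k) / real n < e / 2"
    using e by (intro order_tendstoD(2)[OF lim_const_over_n]) auto
  have "\<forall>\<^sub>F n in sequentially. fibre_log (Suc n) y / real (Suc n) \<le> growth (shift y) + e"
    using 1 2 eventually_gt_at_top[of 0]
  proof eventually_elim
    case (elim n)
    have "fibre_log (Suc n) y \<le> fibre_log 1 y + fibre_log n (shift y)"
      using fibre_log_subadditive[OF y, of 1 n] by simp
    also have "fibre_log 1 y \<le> ln (real k)" using fibre_log_le[OF y, of 1] by simp
    finally have "fibre_log (Suc n) y / real (Suc n) \<le> (ln (real k) + fibre_log n (shift y)) / real (Suc n)"
      by (intro divide_right_mono) auto
    also have "\<dots> \<le> (ln (real k) + fibre_log n (shift y)) / real n"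
      using elim(3) ln_k_nonneg fibre_log_nonneg[OF sy] by (intro divide_left_mono) auto
    also have "\<dots> \<le> growth (shift y) + e" unfolding add_divide_distrib using elim(1,2) by linarith
    finally show ?case .
  qed
  then have "\<forall>\<^sub>F n in sequentially. ereal (fibre_log n y / real n) \<le> ereal (growth (shift y) + e)"
    by (subst (asm) eventually_sequentially_Suc) simp
  then have "limsup (\<lambda>n. ereal (fibre_log n y / real n)) \<le> ereal (growth (shift y) + e)" by (rule Limsup_bounded)
  then show "growth y \<le> growth (shift y) + e" by (simp add: growth_limsup[OF y])
qed

text \<open>An instance of \<open>ergodic_integral_le\<close> with \<open>u = growth\<close> and
  \<open>g = fibre_log q / q\<close>. A length \<open>n\<close> at which
  \<open>fibre_log n y / n\<close> nearly reaches its upper limit is a good block, because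
  subadditivity bounds \<open>fibre_log n y\<close> by the orbit sum of \<open>g\<close> up to a
  constant.\<close>

lemma integral_growth_le:
  assumes m: "m \<in> invariant_measures Y" and q: "1 \<le> q"
  shows "real q * (\<integral>y. growth y \<partial>m) \<le> (\<integral>y. fibre_log q y \<partial>m)"
proof -
  note pm = Y.invariantD[OF m]
  interpret measure_preserving m shift by (rule pm(4))
  have "(\<integral>y. growth y \<partial>m) \<le> (\<integral>y. fibre_log q y / real q \<partial>m)"
  proof (rule ergodic_integral_le[where K="ln (real k)"])
    show "(\<lambda>y. fibre_log q y / real q) \<in> borel_measurable m"
      using fibre_log_measurable[OF pm(2)] by (intro borel_measurable_divide) auto
    show "growth \<in> borel_measurable m" using growth_measurable[OF pm(2)] .
    show "\<bar>fibre_log q y / real q\<bar> \<le> ln (real k)" if "y \<in> space m" for y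
    proof -
      have "y \<in> Y" using that by (simp add: pm(3))
      from fibre_average_bounds[OF this, of q] show ?thesis by linarith
    qed
    show "\<bar>growth y\<bar> \<le> ln (real k)" if "y \<in> space m" for y
      using that growth_nonneg[of y] growth_le[of y] by (simp add: pm(3))
    show "growth y \<le> growth (shift y)" if "y \<in> space m" for y
      using that growth_le_shift by (simp add: pm(3))
    fix y and e :: real assume "y \<in> space m" and e: "0 < e"
    then have y: "y \<in> Y" by (simp add: pm(3))
    \<comment> \<open>\<open>K\<close> bounds the boundary terms \<open>fibre_log i y\<close>,
      \<open>i < q\<close>, left over by telescoping. Beyond \<open>n1\<close> they cost at most
      \<open>e / 2\<close> per step, and the other \<open>e / 2\<close> is spent on approaching the
      upper limit.\<close>
    define K where "K = real q * ln (real k)"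
    have K0: "0 \<le> K" using ln_k_nonneg by (simp add: K_def)
    obtain n1 :: nat where n1: "K / (e / 2) < real n1" using reals_Archimedean2 by blast
    have "\<exists>n\<ge>max 1 n1. growth y - e / 2 < fibre_log n y / real n"
    proof (rule ccontr)
      assume "\<not> ?thesis"
      then have "\<forall>n\<ge>max 1 n1. fibre_log n y / real n \<le> growth y - e / 2" by (meson not_less)
      then have "\<forall>\<^sub>F n in sequentially. ereal (fibre_log n y / real n) \<le> ereal (growth y - e / 2)"
        by (auto simp: eventually_sequentially simp del: ereal_less_eq intro!: exI[of _ "max 1 n1"] ereal_less_eq(3)[THEN iffD2])
      then have "limsup (\<lambda>n. ereal (fibre_log n y / real n)) \<le> ereal (growth y - e / 2)" by (rule Limsup_bounded)
      with e show False by (simp add: growth_limsup[OF y])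
    qed
    then obtain n where n: "1 \<le> n" "n1 \<le> n" "growth y - e / 2 < fibre_log n y / real n" by auto
    have "real q * fibre_log n y \<le> (\<Sum>i<n. fibre_log q ((shift ^^ i) y)) + (\<Sum>i<q. fibre_log i y)"
      by (rule telescoping_average[OF fibre_log_subadditive[OF y] fibre_log_mono[OF y]])
    also have "(\<Sum>i<q. fibre_log i y) \<le> (\<Sum>i<q. K)"
    proof (rule sum_mono)
      fix i assume "i \<in> {..<q}"
      then have "real i * ln (real k) \<le> K" unfolding K_def using ln_k_nonneg by (intro mult_right_mono) auto
      with fibre_log_le[OF y, of i] show "fibre_log i y \<le> K" by linarith
    qed
    finally have "real q * fibre_log n y \<le> (\<Sum>i<n. fibre_log q ((shift ^^ i) y)) + real q * K" by simp
    then have 1: "fibre_log n y \<le> (\<Sum>i<n. fibre_log q ((shift ^^ i) y) / real q) + K"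
      using q by (simp add: field_simps flip: sum_divide_distrib)
    have 2: "real n * (growth y - e / 2) \<le> fibre_log n y" using n by (simp add: field_simps)
    have "K / (e / 2) \<le> real n" using n1 n(2) by linarith
    then have 3: "K \<le> real n * (e / 2)" using e by (simp add: field_simps)
    have "real n * (growth y - e) = real n * (growth y - e / 2) - real n * (e / 2)" by (simp add: algebra_simps)
    also have "\<dots> \<le> (\<Sum>i<n. fibre_log q ((shift ^^ i) y) / real q)" using 1 2 3 by linarith
    finally show "\<exists>n\<ge>1. real n * (growth y - e) \<le> (\<Sum>i<n. fibre_log q ((shift ^^ i) y) / real q)"
      using n(1) by blast
  qed
  then show ?thesis using q by (simp add: field_simps)
qed

theorem relative_entropy_attained:
  assumes m: "m \<in> invariant_measures Y"
  obtains \<mu> where "\<mu> \<in> invariant_measures X" "push_forward Y \<pi> \<mu> = m"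
    "shift_entropy m + (\<integral>y. growth y \<partial>m) \<le> shift_entropy \<mu>"
proof -
  note pm = Y.invariantD[OF m]
  interpret M: measure_preserving m shift by (rule pm(4))
  \<comment> \<open>Length \<open>2 * Suc j\<close> leaves room for an \<open>a\<close>-block with
    \<open>a \<le> Suc j\<close> starting at any place below \<open>Suc j\<close>, so all the shifts
    that enter the average see the exact law of \<open>m\<close>.\<close>
  have "\<forall>j. \<exists>\<nu>. prob_space \<nu> \<and> sets \<nu> = sets (borel_on X)
    \<and> (\<forall>(h :: nat list \<Rightarrow> nat list) v. level_prob \<nu> (\<lambda>x. h (block (2 * Suc j) (\<pi> x))) v = level_prob m (\<lambda>y. h (block (2 * Suc j) y)) v)
    \<and> fin_entropy m (block (Suc j)) + (\<integral>y. fibre_log (Suc j) y \<partial>m) \<le> fin_entropy \<nu> (block (Suc j))"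
  proof
    fix j
    have "Suc j \<le> 2 * Suc j" by simp
    from uniform_fibre_measure[OF pm(1,2) this] show "\<exists>\<nu>. prob_space \<nu> \<and> sets \<nu> = sets (borel_on X)
      \<and> (\<forall>(h :: nat list \<Rightarrow> nat list) v. level_prob \<nu> (\<lambda>x. h (block (2 * Suc j) (\<pi> x))) v = level_prob m (\<lambda>y. h (block (2 * Suc j) y)) v)
      \<and> fin_entropy m (block (Suc j)) + (\<integral>y. fibre_log (Suc j) y \<partial>m) \<le> fin_entropy \<nu> (block (Suc j))"
      by metis
  qed
  from choice[OF this] obtain \<nu> where \<nu>: "\<And>j. prob_space (\<nu> j)" "\<And>j. sets (\<nu> j) = sets (borel_on X)"
    and law: "\<And>j (h :: nat list \<Rightarrow> nat list) v. level_prob (\<nu> j) (\<lambda>x. h (block (2 * Suc j) (\<pi> x))) v = level_prob m (\<lambda>y. h (block (2 * Suc j) y)) v"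
    and ent: "\<And>j. fin_entropy m (block (Suc j)) + (\<integral>y. fibre_log (Suc j) y \<partial>m) \<le> fin_entropy (\<nu> j) (block (Suc j))"
    by blast
  note sp\<nu> = X.space_eq_X[OF \<nu>(2)]
  obtain r \<mu> where r: "strict_mono (r :: nat \<Rightarrow> nat)" and \<mu>: "\<mu> \<in> invariant_measures X"
    and lim: "\<And>n P. (\<lambda>j. measure (X.orbit_average (Suc (r j)) (\<nu> (r j))) {x \<in> X. P (block n x)})
      \<longlonglongrightarrow> measure \<mu> {x \<in> X. P (block n x)}"
    and ent_lim: "\<forall>c. (\<forall>j. c * real (Suc j) \<le> fin_entropy (\<nu> j) (block (Suc j))) \<longrightarrow> c \<le> shift_entropy \<mu>"
    by (rule X.limit_of_orbit_averages[of \<nu>, OF \<nu>]) (rule that)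
  note p\<mu> = X.invariantD[OF \<mu>]
  have "shift_entropy m + (\<integral>y. growth y \<partial>m) \<le> shift_entropy \<mu>"
  proof (rule ent_lim[rule_format])
    fix j
    have "shift_entropy m * real (Suc j) \<le> fin_entropy m (block (Suc j))"
      using Y.shift_entropy_le[OF m, of "Suc j"] by (simp add: pos_le_divide_eq)
    moreover have "real (Suc j) * (\<integral>y. growth y \<partial>m) \<le> (\<integral>y. fibre_log (Suc j) y \<partial>m)"
      by (rule integral_growth_le[OF m]) simp
    ultimately show "(shift_entropy m + (\<integral>y. growth y \<partial>m)) * real (Suc j) \<le> fin_entropy (\<nu> j) (block (Suc j))"
      using ent[of j] by (simp only: distrib_right mult.commute[of "real (Suc j)"])
  qed
  moreover have "push_forward Y \<pi> \<mu> = m"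
  proof (rule Y.measure_eqI_cylinders)
    show "prob_space (push_forward Y \<pi> \<mu>)" "sets (push_forward Y \<pi> \<mu>) = sets (borel_on Y)"
      using prob_push_forward[OF p\<mu>(1,2)] sets_push_forward[OF p\<mu>(1,2)] by auto
    show "prob_space m" "sets m = sets (borel_on Y)" by (rule pm)+
    fix a and v :: "nat list"
    let ?A = "{x \<in> X. block a (\<pi> x) = v}"
    let ?avg = "\<lambda>j. X.orbit_average (Suc j) (\<nu> j)"
    have A: "?A \<in> sets (borel_on X)"
      using simple_function_level_sets[OF simple_function_block_\<pi>[OF refl, of a], of "\<lambda>w. w = v"]
      by (simp add: space_restrict_space)
    have avg: "measure (?avg j) ?A = measure m {y \<in> Y. block a y = v}" if j: "a \<le> Suc j" for j
    proof -
      have "measure (\<nu> j) {x \<in> X. (shift ^^ i) x \<in> ?A} = measure m {y \<in> Y. block a y = v}" if i: "i < Suc j" for i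
      proof -
        have cut: "take a (drop i (block (2 * Suc j) y)) = block a ((shift ^^ i) y)" for y :: "nat \<Rightarrow> nat"
          using i j by (intro nth_equalityI) (auto simp: nth_block funpow_shift add.commute)
        have "{x \<in> X. (shift ^^ i) x \<in> ?A} = {x \<in> X. block a ((shift ^^ i) (\<pi> x)) = v}"
          using X.funpow_shift_X \<pi>_funpow_shift by auto
        then have "measure (\<nu> j) {x \<in> X. (shift ^^ i) x \<in> ?A} = measure m {y \<in> Y. block a ((shift ^^ i) y) = v}"
          using law[of j "\<lambda>w. take a (drop i w)" v] by (simp add: level_prob_def sp\<nu> pm(3) cut del: mult_Suc_right)
        also have "{y \<in> Y. block a ((shift ^^ i) y) = v} = (shift ^^ i) -` {y \<in> Y. block a y = v} \<inter> space m"
          using Y.funpow_shift_X by (auto simp: pm(3))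
        also have "measure m \<dots> = measure (distr m m (shift ^^ i)) {y \<in> Y. block a y = v}"
          using M.funpow_measurable Y.cylinder_measurable[OF pm(2)] by (rule measure_distr[symmetric])
        finally show ?thesis by (simp add: M.distr_funpow)
      qed
      then show ?thesis
        using X.measure_orbit_average[OF \<nu> _ A, of "Suc j" j] by simp
    qed
    \<comment> \<open>The convergence in \<open>lim\<close> speaks of blocks of \<open>x\<close>. As
      \<pi> is one-block, an event about the \<open>a\<close>-block of \<open>\<pi> x\<close> is
      such an event.\<close>
    have "?A = {x \<in> X. block a x \<in> block a ` ?A}"
      using block_\<pi>_cong by blast
    with lim[of "\<lambda>u. u \<in> block a ` ?A" a]
    have to_\<mu>: "(\<lambda>j. measure (?avg (r j)) ?A) \<longlonglongrightarrow> measure \<mu> ?A" by simp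
    have "(\<lambda>j. measure (?avg (r j)) ?A) \<longlonglongrightarrow> measure m {y \<in> Y. block a y = v}"
    proof (rule tendsto_eventually)
      show "\<forall>\<^sub>F j in sequentially. measure (?avg (r j)) ?A = measure m {y \<in> Y. block a y = v}"
        using eventually_ge_at_top[of a]
      proof eventually_elim
        case (elim j)
        then have "a \<le> Suc (r j)" using seq_suble[OF r, of j] by linarith
        then show ?case by (rule avg)
      qed
    qed
    from LIMSEQ_unique[OF to_\<mu> this]
    show "measure (push_forward Y \<pi> \<mu>) {y \<in> Y. block a y = v} = measure m {y \<in> Y. block a y = v}"
      by (simp add: measure_push_forward[OF p\<mu>(1,2)])
  qed
  ultimately show ?thesis using \<mu> that by blast
qed

end

section \<open>Free energies on \<open>X\<close> and on \<open>Y\<close>\<close>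

context one_block_factor
begin

text \<open>This includes the entropy of \<open>m\<close> itself: by
  \<open>SUP_entropy_fibre\<close> it is the largest entropy of an invariant measure over
  \<open>m\<close>.\<close>

definition relative_entropy :: "(nat \<Rightarrow> nat) measure \<Rightarrow> real" where
  "relative_entropy m = shift_entropy m + (\<integral>y. growth y \<partial>m)"

lemma SUP_entropy_fibre:
  assumes m: "m \<in> invariant_measures Y"
  shows "(SUP \<nu>\<in>{\<nu> \<in> invariant_measures X. push_forward Y \<pi> \<nu> = m}. measure_entropy \<nu> shift) = ereal (relative_entropy m)"
proof (rule antisym)
  show "(SUP \<nu>\<in>{\<nu> \<in> invariant_measures X. push_forward Y \<pi> \<nu> = m}. measure_entropy \<nu> shift) \<le> ereal (relative_entropy m)"
    using entropy_le_relative by (intro SUP_least) (auto simp: X.measure_entropy_eq relative_entropy_def)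
  obtain \<mu> where \<mu>: "\<mu> \<in> invariant_measures X" "push_forward Y \<pi> \<mu> = m" "relative_entropy m \<le> shift_entropy \<mu>"
    using relative_entropy_attained[OF m] by (auto simp: relative_entropy_def)
  then show "ereal (relative_entropy m) \<le> (SUP \<nu>\<in>{\<nu> \<in> invariant_measures X. push_forward Y \<pi> \<nu> = m}. measure_entropy \<nu> shift)"
    by (intro SUP_upper2[of \<mu>]) (auto simp: X.measure_entropy_eq)
qed

text \<open>The result is arranged as the free energy of \<open>m\<close> plus the amount, never
  positive, by which \<mu> misses the largest entropy over \<open>m\<close>. \<open>G\<close> stands
  for the given growth function, which agrees with \<open>growth\<close> on \<open>Y\<close> but may
  differ elsewhere.\<close>

lemma free_energy_lift:
  assumes \<mu>: "\<mu> \<in> invariant_measures X" and \<phi>: "continuous_on Y \<phi>" and G: "\<And>y. y \<in> Y \<Longrightarrow> G y = growth y"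
  defines "m \<equiv> push_forward Y \<pi> \<mu>"
  shows "free_energy (\<lambda>x. - G (\<pi> x) + \<phi> (\<pi> x)) \<mu>
    = ereal (shift_entropy \<mu> - relative_entropy m + (shift_entropy m + (\<integral>y. \<phi> y \<partial>m)))"
proof -
  note p\<mu> = X.invariantD[OF \<mu>]
  have m: "m \<in> invariant_measures Y" unfolding m_def by (rule push_forward_invariant[OF \<mu>])
  note pm = Y.invariantD[OF m]
  have \<phi>m: "\<phi> \<in> borel_measurable (borel_on Y)" using \<phi> by (rule borel_measurable_continuous_on_restrict)
  then have \<phi>m': "\<phi> \<in> borel_measurable m" using measurable_cong_sets[OF pm(2) refl] by blast
  have "bounded (\<phi> ` Y)" using compact_continuous_image[OF \<phi> Y.compact_X] by (rule compact_imp_bounded)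
  then obtain B where "\<And>y. y \<in> Y \<Longrightarrow> \<bar>\<phi> y\<bar> \<le> B" by (auto simp: bounded_iff)
  then have int: "integrable m \<phi>" by (intro integrable_bounded_Y[OF pm(1,2) \<phi>m'])
  have "(\<integral>x. - G (\<pi> x) + \<phi> (\<pi> x) \<partial>\<mu>) = (\<integral>x. \<phi> (\<pi> x) - growth (\<pi> x) \<partial>\<mu>)"
    using \<pi>_Y by (intro Bochner_Integration.integral_cong) (auto simp: p\<mu>(3) G)
  also have "\<dots> = (\<integral>y. \<phi> y - growth y \<partial>m)"
    unfolding m_def push_forward_def using \<pi>_measurable[OF p\<mu>(2)] \<phi>m growth_measurable[OF refl]
    by (subst integral_distr) auto
  also have "\<dots> = (\<integral>y. \<phi> y \<partial>m) - (\<integral>y. growth y \<partial>m)"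
    using int integrable_growth[OF pm(1,2)] by (rule Bochner_Integration.integral_diff)
  finally show ?thesis
    by (simp add: free_energy_def X.measure_entropy_eq[OF \<mu>] relative_entropy_def)
qed

end

theorem theorem3p2:
  fixes X Y :: "(nat \<Rightarrow> nat) set"
    and \<pi> :: "(nat \<Rightarrow> nat) \<Rightarrow> (nat \<Rightarrow> nat)"
    and k l :: nat
    and D :: "nat \<Rightarrow> (nat \<Rightarrow> nat) \<Rightarrow> (nat \<Rightarrow> nat) set"
  assumes "subshift k X" and "subshift l Y"
    and "factor_map X Y \<pi>" and "one_block X \<pi>"
    and "\<And>n y. n \<ge> 1 \<Longrightarrow> y \<in> Y \<Longrightarrow> fiber_selection X \<pi> n y (D n y)"
  shows "(\<forall>y\<in>Y. fiber_growth_ereal D y = ereal (fiber_growth D y))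
    \<and> bounded (fiber_growth D ` Y)
    \<and> fiber_growth D \<in> borel_measurable (borel_on Y)
    \<and> compensation_function X Y \<pi> (\<lambda>x. - fiber_growth D (\<pi> x))
    \<and> (\<forall>\<phi>. continuous_on Y \<phi> \<longrightarrow>
         equilibrium_states X (\<lambda>x. - fiber_growth D (\<pi> x) + \<phi> (\<pi> x)) \<noteq> {}
       \<and> (\<forall>\<mu>\<in>invariant_measures X.
            \<mu> \<in> equilibrium_states X (\<lambda>x. - fiber_growth D (\<pi> x) + \<phi> (\<pi> x)) \<longleftrightarrow>
              push_forward Y \<pi> \<mu> \<in> equilibrium_states Y \<phi>
            \<and> max_relative_entropy X Y \<pi> (push_forward Y \<pi> \<mu>) \<mu>))"
proof -
  interpret one_block_factor k X l Y \<pi>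
    using assms(1-4) by unfold_locales
  have ereal_growth: "fiber_growth_ereal D y = ereal (growth y)" if y: "y \<in> Y" for y
  proof -
    \<comment> \<open>Nothing is assumed about \<open>D 0 y\<close>, but at \<open>n = 0\<close>
      both sides are zero because of the division by zero.\<close>
    have "1 / real n * ln (real (card (D n y))) = fibre_log n y / real n" for n
      using card_fiber_selection[OF assms(5)[OF _ y], of n] by (cases "n = 0") (simp_all add: fibre_log_def)
    then show ?thesis using growth_limsup[OF y] by (simp only: fiber_growth_ereal_def)
  qed
  have growth: "fiber_growth D y = growth y" if "y \<in> Y" for y
    using ereal_growth[OF that] by (simp add: fiber_growth_def)
  have "\<bar>fiber_growth D y\<bar> \<le> ln (real k)" if "y \<in> Y" for y
    using growth[OF that] growth_nonneg[OF that] growth_le[OF that] by simp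
  then have bdd: "bounded (fiber_growth D ` Y)" by (auto simp: bounded_iff)
  have meas: "fiber_growth D \<in> borel_measurable (borel_on Y)"
    using growth_measurable[OF refl] growth
    by (subst measurable_cong[where g=growth]) (auto simp: space_restrict_space)
  let ?f = "\<lambda>\<phi> x. - fiber_growth D (\<pi> x) + \<phi> (\<pi> x)"
  let ?g = "\<lambda>\<phi> m. shift_entropy m + (\<integral>y. \<phi> y \<partial>m)"
  have lift: "free_energy (?f \<phi>) \<mu>
      = ereal (shift_entropy \<mu> - relative_entropy (push_forward Y \<pi> \<mu>) + ?g \<phi> (push_forward Y \<pi> \<mu>))"
    if "continuous_on Y \<phi>" "\<mu> \<in> invariant_measures X" for \<phi> \<mu>
    using that(2,1) growth by (rule free_energy_lift)
  have base: "free_energy \<phi> m = ereal (?g \<phi> m)" if "m \<in> invariant_measures Y" for \<phi> m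
    by (simp add: free_energy_def Y.measure_entropy_eq[OF that])
  have rel_le: "shift_entropy \<mu> \<le> relative_entropy (push_forward Y \<pi> \<mu>)" if "\<mu> \<in> invariant_measures X" for \<mu>
    using entropy_le_relative[OF that] by (simp add: relative_entropy_def)
  have attained: "\<exists>\<mu>\<in>invariant_measures X. push_forward Y \<pi> \<mu> = m \<and> free_energy (?f \<phi>) \<mu> = free_energy \<phi> m"
    if \<phi>: "continuous_on Y \<phi>" and m: "m \<in> invariant_measures Y" for \<phi> m
  proof -
    obtain \<mu> where \<mu>: "\<mu> \<in> invariant_measures X" "push_forward Y \<pi> \<mu> = m" "relative_entropy m \<le> shift_entropy \<mu>"
      using relative_entropy_attained[OF m] by (auto simp: relative_entropy_def)
    with rel_le[OF \<mu>(1)] have "free_energy (?f \<phi>) \<mu> = free_energy \<phi> m"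
      unfolding lift[OF \<phi> \<mu>(1)] base[OF m] by simp
    with \<mu> show ?thesis by blast
  qed
  have pressure: "variational_pressure X (?f \<phi>) = variational_pressure Y \<phi>" if \<phi>: "continuous_on Y \<phi>" for \<phi>
    unfolding variational_pressure_def
  proof (rule antisym)
    show "(SUP \<mu>\<in>invariant_measures X. free_energy (?f \<phi>) \<mu>) \<le> (SUP m\<in>invariant_measures Y. free_energy \<phi> m)"
    proof (rule SUP_least)
      fix \<mu> assume \<mu>: "\<mu> \<in> invariant_measures X"
      note m = push_forward_invariant[OF \<mu>]
      have "free_energy (?f \<phi>) \<mu> \<le> free_energy \<phi> (push_forward Y \<pi> \<mu>)"
        unfolding lift[OF \<phi> \<mu>] base[OF m] using rel_le[OF \<mu>] by simp
      with m show "free_energy (?f \<phi>) \<mu> \<le> (SUP m\<in>invariant_measures Y. free_energy \<phi> m)"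
        by (rule SUP_upper2)
    qed
    show "(SUP m\<in>invariant_measures Y. free_energy \<phi> m) \<le> (SUP \<mu>\<in>invariant_measures X. free_energy (?f \<phi>) \<mu>)"
    proof (rule SUP_least)
      fix m assume "m \<in> invariant_measures Y"
      from attained[OF \<phi> this] obtain \<mu> where "\<mu> \<in> invariant_measures X" "free_energy (?f \<phi>) \<mu> = free_energy \<phi> m"
        by blast
      then show "free_energy \<phi> m \<le> (SUP \<mu>\<in>invariant_measures X. free_energy (?f \<phi>) \<mu>)"
        by (intro SUP_upper2[of \<mu>]) auto
    qed
  qed
  then have comp: "compensation_function X Y \<pi> (\<lambda>x. - fiber_growth D (\<pi> x))"
    by (simp add: compensation_function_def)
  have nonempty: "equilibrium_states X (?f \<phi>) \<noteq> {}" if \<phi>: "continuous_on Y \<phi>" for \<phi>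
  proof -
    \<comment> \<open>Semicontinuity is used on \<open>Y\<close>, where \<phi> is continuous;
      \<open>attained\<close> then lifts the equilibrium state without loss of free energy.\<close>
    obtain m where m: "m \<in> invariant_measures Y" "free_energy \<phi> m = variational_pressure Y \<phi>"
      using Y.equilibrium_states_nonempty[OF \<phi>] by (auto simp: equilibrium_states_def)
    from attained[OF \<phi> m(1)] obtain \<mu> where "\<mu> \<in> invariant_measures X" "free_energy (?f \<phi>) \<mu> = free_energy \<phi> m"
      by blast
    then have "\<mu> \<in> equilibrium_states X (?f \<phi>)"
      unfolding equilibrium_states_def mem_Collect_eq pressure[OF \<phi>] using m(2) by simp
    then show ?thesis by blast
  qed
  have char: "\<mu> \<in> equilibrium_states X (?f \<phi>) \<longleftrightarrow>
      push_forward Y \<pi> \<mu> \<in> equilibrium_states Y \<phi> \<and> max_relative_entropy X Y \<pi> (push_forward Y \<pi> \<mu>) \<mu>"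
    if \<phi>: "continuous_on Y \<phi>" and \<mu>: "\<mu> \<in> invariant_measures X" for \<phi> \<mu>
  proof -
    let ?m = "push_forward Y \<pi> \<mu>"
    note m = push_forward_invariant[OF \<mu>]
    obtain m0 where "m0 \<in> invariant_measures Y" "free_energy \<phi> m0 = variational_pressure Y \<phi>"
      using Y.equilibrium_states_nonempty[OF \<phi>] by (auto simp: equilibrium_states_def)
    \<comment> \<open>The pressure is attained by a real free energy and hence finite, so the
      equivalence can be decided among real numbers.\<close>
    then obtain P where P: "variational_pressure Y \<phi> = ereal P" by (metis base)
    have "free_energy \<phi> ?m \<le> variational_pressure Y \<phi>"
      unfolding variational_pressure_def by (rule SUP_upper[OF m])
    then have le: "?g \<phi> ?m \<le> P" by (simp add: P base[OF m])
    have "max_relative_entropy X Y \<pi> ?m \<mu> \<longleftrightarrow> shift_entropy \<mu> = relative_entropy ?m"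
      unfolding max_relative_entropy_def SUP_entropy_fibre[OF m] using \<mu> by (simp add: X.measure_entropy_eq)
    moreover have "?m \<in> equilibrium_states Y \<phi> \<longleftrightarrow> ?g \<phi> ?m = P"
      using m by (simp add: equilibrium_states_def P base)
    moreover have "\<mu> \<in> equilibrium_states X (?f \<phi>) \<longleftrightarrow> shift_entropy \<mu> - relative_entropy ?m + ?g \<phi> ?m = P"
      unfolding equilibrium_states_def using \<mu> by (simp only: mem_Collect_eq pressure[OF \<phi>] P lift[OF \<phi> \<mu>] ereal.inject simp_thms)
    \<comment> \<open>Of the two parts of the free energy, one is at most 0 and the other at most
      \<open>P\<close>; their sum is \<open>P\<close> exactly when both bounds are attained.\<close>
    ultimately show ?thesis using le rel_le[OF \<mu>] by (smt (verit))
  qed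
  show ?thesis using ereal_growth growth bdd meas comp nonempty char by simp
qed

end
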